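(* Let $0\le r\le n$, $\lambda\vdash n$ and $\tau\in\{s_\lambda,e_\lambda,p_\lambda,h_\lambda\}$. The generalized graph shift operation on a bipartite graph decreases the coefficient $b_{\tau,r}$: if $G_1$ and $G_2$ are simple connected bipartite graphs on $n$ vertices with $G_2=\mathrm{GGS}(G_1)$, then $b_{\tau,r}(L_{G_2})\le b_{\tau,r}(L_{G_1})$. Moreover, for all integers $k\ge2$ with $n>2k$, the max-min pair for $b_{\tau,r}$ in $\Omega_{C_{2k}}^v(n)$ is $(G_{P_{n-2k+1}},G_{S_{n-2k+1}})$, i.e. for every $G\in\Omega_{C_{2k}}^v(n)$, $$b_{\tau,r}(L_{G_{S_{n-2k+1}}})\le b_{\tau,r}(L_G)\le b_{\tau,r}(L_{G_{P_{n-2k+1}}}).$$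
   Context: $s_\lambda,e_\lambda,p_\lambda,h_\lambda$ are the Schur, elementary, power sum and complete homogeneous symmetric functions indexed by $\lambda$. The Frobenius characteristic map $\mathrm{ch}$ sends a class function $f$ on $\mathfrak{S}_n$ to $\frac1{n!}\sum_{\psi\in\mathfrak{S}_n}f(\psi)p_{\mathrm{type}(\psi)}$ (so that $\mathrm{ch}(\chi_\lambda)=s_\lambda$ for the irreducible character $\chi_\lambda$); for a symmetric function $\tau$ homogeneous of degree $n$ over $\mathbb{Q}$, $\mathrm{ch}^{-1}_\tau=\mathrm{ch}^{-1}(\tau)$. The generalized matrix function of an $n\times n$ matrix $A=(a_{i,j})$ is $\mathrm{GMF}_\tau(A)=\sum_{\psi\in\mathfrak{S}_n}\mathrm{ch}^{-1}_\tau(\psi)\prod_{i=1}^n a_{i,\psi(i)}$. The Laplacian of a graph $G$ is $L_G=D-A(G)$ (degree matrix minus adjacency matrix), and $b_{\tau,r}(L_G)$ is the coefficient of $(-1)^r x^{n-r}$ in $\mathrm{GMF}_\tau(xI-L_G)$. Generalized graph shift (GGS): let $G_1$ be a graph and let $u$ and $w$ be two distinct vertices of $G_1$ connected by a path $P$ from $u$ to $w$ such that (1) every interior vertex of $P$ (if any) has degree 2 in $G_1$, and (2) $u$ and $w$ are not both contained in one cycle of $G_1$. Let $w'$ be the neighbour of $w$ on $P$. Then $G_2=\mathrm{GGS}(G_1)$ is obtained from $G_1$ by moving all neighbours of $w$ except $w'$ to $u$, i.e. for each neighbour $z\ne w'$ of $w$, the edge $\{w,z\}$ is deleted and the edge $\{u,z\}$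 is added. For $n>m\ge3$, $\Omega_{C_m}^v(n)$ is the set of unlabelled connected unicyclic graphs on $n$ vertices whose unique cycle $C_m$ has length $m$ and in which every vertex of $C_m$ has degree 2 except one vertex $v$ of $C_m$. It is partially ordered by: $G_1\le_{\mathrm{GGS}_n}G_2$ if $G_2$ is obtained from $G_1$ by some number of GGS operations. $G_{S_{n-m+1}}$ is the graph obtained from the cycle $C_m$ and the star on $n-m+1$ vertices by identifying a vertex of the cycle with the centre (the vertex of degree $n-m$) of the star. $G_{P_{n-m+1}}$ is the graph obtained from $C_m$ and the path on $n-m+1$ vertices by identifying a vertex of the cycle with an end vertex of the path. *)

theory Defs
  imports
    "HOL-Library.Multiset"
    "HOL-Library.FuncSet"
    "HOL-Combinatorics.Orbits"
    "Jordan_Normal_Form.Char_Poly"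
    "Graph_Theory.Graph_Theory"
begin

section \<open>Symmetric functions\<close>

text \<open>
  A formal power series over the rationals in the variables $x_0, x_1, \ldots$ is given by its
  coefficients; the monomial $x_{i_1} \cdots x_{i_d}$ is the multiset of its indices. Symmetric
  functions are certain such series. Since only finitely many pairs of monomials multiply to a
  given one, the product is a finite sum.
\<close>

type_synonym symfun = "nat multiset \<Rightarrow> rat"

definition sf_one :: symfun where
  "sf_one = (\<lambda>m. if m = {#} then 1 else 0)"

definition sf_mult :: "symfun \<Rightarrow> symfun \<Rightarrow> symfun" where
  "sf_mult f g = (\<lambda>m. \<Sum>a\<in>{a. a \<subseteq># m}. f a * g (m - a))"

definition sf_prod_list :: "symfun list \<Rightarrow> symfun" where
  "sf_prod_list fs = foldr sf_mult fs sf_one"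

text \<open>The one-part functions $p_k$, $e_k$, $h_k$ (for $k \ge 1$).\<close>

definition psum :: "nat \<Rightarrow> symfun" where
  "psum k = (\<lambda>m. if \<exists>i. m = replicate_mset k i then 1 else 0)"

definition elem :: "nat \<Rightarrow> symfun" where
  "elem k = (\<lambda>m. if size m = k \<and> (\<forall>i. count m i \<le> 1) then 1 else 0)"

definition homog :: "nat \<Rightarrow> symfun" where
  "homog k = (\<lambda>m. if size m = k then 1 else 0)"

definition is_partition :: "nat \<Rightarrow> nat list \<Rightarrow> bool" where
  "is_partition n lam \<longleftrightarrow> sorted_wrt (\<ge>) lam \<and> 0 \<notin> set lam \<and> sum_list lam = n"

definition psum_sf :: "nat list \<Rightarrow> symfun" where
  "psum_sf lam = sf_prod_list (map psum lam)"

definition elem_sf :: "nat list \<Rightarrow> symfun" where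
  "elem_sf lam = sf_prod_list (map elem lam)"

definition homog_sf :: "nat list \<Rightarrow> symfun" where
  "homog_sf lam = sf_prod_list (map homog lam)"

definition cells :: "nat list \<Rightarrow> (nat \<times> nat) set" where
  "cells lam = (SIGMA i:{..<length lam}. {..<lam ! i})"

text \<open>Semistandard Young tableaux: weakly increasing rows, strictly increasing columns.\<close>

definition ssyt :: "nat list \<Rightarrow> (nat \<times> nat \<Rightarrow> nat) set" where
  "ssyt lam = {T \<in> extensional (cells lam).
     (\<forall>i j. (i, j) \<in> cells lam \<and> (i, Suc j) \<in> cells lam \<longrightarrow> T (i, j) \<le> T (i, Suc j)) \<and>
     (\<forall>i j. (i, j) \<in> cells lam \<and> (Suc i, j) \<in> cells lam \<longrightarrow> T (i, j) < T (Suc i, j))}"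

definition schur_sf :: "nat list \<Rightarrow> symfun" where
  "schur_sf lam =
     (\<lambda>m. of_nat (card {T \<in> ssyt lam. image_mset T (mset_set (cells lam)) = m}))"

section \<open>The Frobenius characteristic and generalized matrix functions\<close>

text \<open>The symmetric group is the set of permutations of \<open>{0..<n}\<close>; fixed points are parts of
  size 1 of the cycle type.\<close>

definition cycle_type :: "nat \<Rightarrow> (nat \<Rightarrow> nat) \<Rightarrow> nat list" where
  "cycle_type n \<psi> =
     rev (sorted_list_of_multiset (image_mset card (mset_set (orbit \<psi> ` {0..<n}))))"

text \<open>Class functions are extended by 0 to functions that do not permute \<open>{0..<n}\<close>, so that they
  are determined by their values on the symmetric group.\<close>

definition class_functions :: "nat \<Rightarrow> ((nat \<Rightarrow> nat) \<Rightarrow> rat) set" where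
  "class_functions n = {f.
     (\<forall>\<sigma> \<psi>. \<sigma> permutes {0..<n} \<and> \<psi> permutes {0..<n} \<longrightarrow> f (\<sigma> \<circ> \<psi> \<circ> inv_into UNIV \<sigma>) = f \<psi>) \<and>
     (\<forall>\<psi>. \<not> \<psi> permutes {0..<n} \<longrightarrow> f \<psi> = 0)}"

definition frob_ch :: "nat \<Rightarrow> ((nat \<Rightarrow> nat) \<Rightarrow> rat) \<Rightarrow> symfun" where
  "frob_ch n f =
     (\<lambda>m. 1 / fact n * (\<Sum>\<psi> | \<psi> permutes {0..<n}. f \<psi> * psum_sf (cycle_type n \<psi>) m))"

definition frob_ch_inv :: "nat \<Rightarrow> symfun \<Rightarrow> (nat \<Rightarrow> nat) \<Rightarrow> rat" where
  "frob_ch_inv n = inv_into (class_functions n) (frob_ch n)"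

definition GMF :: "symfun \<Rightarrow> rat poly mat \<Rightarrow> rat poly" where
  "GMF \<tau> A = (\<Sum>\<psi> | \<psi> permutes {0..<dim_row A}.
     Polynomial.smult (frob_ch_inv (dim_row A) \<tau> \<psi>) (\<Prod>i = 0..<dim_row A. A $$ (i, \<psi> i)))"

text \<open>Here \<open>char_poly_matrix L\<close> is $xI - L$, and \<open>b_coeff \<tau> r L\<close> is the coefficient of
  $(-1)^r x^{n-r}$.\<close>

definition b_coeff :: "symfun \<Rightarrow> nat \<Rightarrow> rat mat \<Rightarrow> rat" where
  "b_coeff \<tau> r L = (-1) ^ r * Polynomial.coeff (GMF \<tau> (char_poly_matrix L)) (dim_row L - r)"

section \<open>Graphs\<close>

text \<open>
  A simple graph is a \<open>pair_graph\<close>: a finite symmetric loop-free digraph. Its arcs are the two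
  orientations of each edge, so \<open>out_degree\<close> is the degree. Unlabelled graphs on $n$ vertices are
  represented by all their labellings with vertex set \<open>{0..<n}\<close>.
\<close>

type_synonym ngraph = "nat pair_pre_digraph"

definition simple_graph_on :: "nat \<Rightarrow> ngraph \<Rightarrow> bool" where
  "simple_graph_on n G \<longleftrightarrow> pair_graph G \<and> pverts G = {0..<n}"

definition bipartite :: "ngraph \<Rightarrow> bool" where
  "bipartite G \<longleftrightarrow> (\<exists>A \<subseteq> pverts G. \<forall>(x, y) \<in> parcs G. x \<in> A \<longleftrightarrow> y \<notin> A)"

definition degree_matrix :: "nat \<Rightarrow> ngraph \<Rightarrow> rat mat" where
  "degree_matrix n G =
     mat n n (\<lambda>(i, j). if i = j then of_nat (out_degree (with_proj G) i) else 0)"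

definition adjacency_matrix :: "nat \<Rightarrow> ngraph \<Rightarrow> rat mat" where
  "adjacency_matrix n G = mat n n (\<lambda>(i, j). if (i, j) \<in> parcs G then 1 else 0)"

definition laplacian :: "nat \<Rightarrow> ngraph \<Rightarrow> rat mat" where
  "laplacian n G = degree_matrix n G - adjacency_matrix n G"

text \<open>The library's \<open>cycle\<close> admits the closed walk $a, b, a$ along a single edge, which is not a
  cycle of an undirected graph; hence the length condition. A cycle as a subgraph is given by its
  edges, irrespective of starting point and direction.\<close>

definition undirected_cycle :: "ngraph \<Rightarrow> (nat \<times> nat) list \<Rightarrow> bool" where
  "undirected_cycle G c \<longleftrightarrow> pre_digraph.cycle (with_proj G) c \<and> 3 \<le> length c"

definition cycle_verts :: "(nat \<times> nat) list \<Rightarrow> nat set" where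
  "cycle_verts c = fst ` set c"

definition cycle_edges :: "(nat \<times> nat) list \<Rightarrow> nat set set" where
  "cycle_edges c = (\<lambda>(x, y). {x, y}) ` set c"

definition move_neighbours :: "ngraph \<Rightarrow> nat \<Rightarrow> nat \<Rightarrow> nat \<Rightarrow> ngraph" where
  "move_neighbours G u w w' = (let Z = {z. (w, z) \<in> parcs G \<and> z \<noteq> w'} in
     \<lparr> pverts = pverts G,
       parcs = (parcs G - ({w} \<times> Z \<union> Z \<times> {w})) \<union> ({u} \<times> Z \<union> Z \<times> {u}) \<rparr>)"

text \<open>\<open>ggs G\<^sub>1 G\<^sub>2\<close>: the graph \<open>G\<^sub>2\<close> arises from \<open>G\<^sub>1\<close> by one generalized graph shift. The tail of the
  last arc of the path is the neighbour $w'$ of $w$ on it.\<close>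

definition ggs :: "ngraph \<Rightarrow> ngraph \<Rightarrow> bool" where
  "ggs G\<^sub>1 G\<^sub>2 \<longleftrightarrow> (\<exists>u w P.
     u \<noteq> w \<and>
     pre_digraph.apath (with_proj G\<^sub>1) u P w \<and>
     (\<forall>x \<in> set (pre_digraph.awalk_verts (with_proj G\<^sub>1) u P) - {u, w}.
        out_degree (with_proj G\<^sub>1) x = 2) \<and>
     \<not> (\<exists>c. undirected_cycle G\<^sub>1 c \<and> u \<in> cycle_verts c \<and> w \<in> cycle_verts c) \<and>
     G\<^sub>2 = move_neighbours G\<^sub>1 u w (fst (last P)))"

definition Omega_C :: "nat \<Rightarrow> nat \<Rightarrow> ngraph set" where
  "Omega_C m n = {G. simple_graph_on n G \<and> Digraph_Component.connected (with_proj G) \<and>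
     (\<exists>c. undirected_cycle G c \<and> length c = m \<and>
          (\<forall>c'. undirected_cycle G c' \<longrightarrow> cycle_edges c' = cycle_edges c) \<and>
          (\<exists>!v. v \<in> cycle_verts c \<and> out_degree (with_proj G) v \<noteq> 2))}"

definition graph_of_edges :: "nat \<Rightarrow> (nat \<times> nat) set \<Rightarrow> ngraph" where
  "graph_of_edges n E = \<lparr> pverts = {0..<n}, parcs = E \<union> E\<inverse> \<rparr>"

text \<open>The cycle is on \<open>0, \<dots>, m - 1\<close>, and the identified vertex is \<open>0\<close>: the star has centre \<open>0\<close> and
  leaves \<open>m, \<dots>, n - 1\<close>; the path is \<open>0, m, m + 1, \<dots>, n - 1\<close>.\<close>

definition cycle_edge_set :: "nat \<Rightarrow> (nat \<times> nat) set" where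
  "cycle_edge_set m = (\<lambda>i. (i, Suc i mod m)) ` {0..<m}"

definition cycle_star :: "nat \<Rightarrow> nat \<Rightarrow> ngraph" where
  "cycle_star m n = graph_of_edges n (cycle_edge_set m \<union> {0} \<times> {m..<n})"

definition cycle_path :: "nat \<Rightarrow> nat \<Rightarrow> ngraph" where
  "cycle_path m n =
     graph_of_edges n (cycle_edge_set m \<union> {(0, m)} \<union> {(j, Suc j) | j. m \<le> j \<and> Suc j < n})"

end

theory Submission
  imports Defs
begin

text \<open>
  Write \<open>f\<close> for the class function with characteristic \<open>\<tau>\<close>. In the expansion of the generalized
  matrix function of $xI - L$, expand each diagonal entry $x - d_i$ and read a chosen degree $d_i$ as
  the choice of a neighbour of \<open>i\<close>. A summand then consists of a partial orientation \<open>g\<close>, which sends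
  some of the vertices to a neighbour, together with a permutation \<open>\<psi>\<close> whose nontrivial cycles are
  among the directed cycles of \<open>g\<close> (2-cycles along an edge included). In a bipartite graph all signs
  cancel, because a permutation along edges moves an even number of vertices. So the coefficient is
  the sum, over all partial orientations with \<open>r\<close> oriented vertices, of the weight of \<open>g\<close>, where this
  weight is the sum of \<open>f \<psi>\<close> over all \<open>\<psi>\<close> below \<open>g\<close> (\<open>b_coeff_eq_orientation_sum\<close>). Two facts
  finish the comparison of two graphs.

  The weights are nonnegative for all four kinds of \<open>\<tau>\<close>
  (\<open>frob_ch_inv_cycle_weight_nonneg\<close>). In the language of symmetric functions the weight is the scalar
  product of \<open>\<tau>\<close> with a power of $p_1$ times the product of $p_1^i + p_i$ over the lengths $i$ of the
  cycles of \<open>g\<close>. For $p_\lambda$ this is clear, as \<open>f\<close> is nonnegative. For $h_\lambda$ and $e_\lambda$,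
  \<open>f\<close> counts words of content $\lambda$ that are fixed by \<open>\<psi>\<close>, up to the sign of \<open>\<psi>\<close>, and every cycle on
  which a word is constant contributes a factor $1 \pm 1$. For $s_\lambda$ one works with coefficients
  of alternating polynomials: $p_i$ moves one exponent by $i$, and every sorted exponent vector that
  it reaches, with whatever sign, is also reached by $i$ moves by one, which carry no sign
  (\<open>schur_cone_psum_op_combined\<close>). That the class functions used here have the right characteristic
  is Burnside's lemma on words, combined for $s_\lambda$ with the Pieri rule for alternating functions
  and the removal of the largest entries of a tableau; that they are the only ones is the linear
  independence of the power sums (\<open>frob_ch_inj\<close>).

  The partial orientations of the shifted graph $G_2$ are mapped injectively to those of $G_1$, with
  the same weights (\<open>orientation_sum_shift_le\<close>). The graph $G_1$ is a path from $u$ to $w$ with a graph $A$ attached at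
  $u$ and a graph $B$ attached at $w$, and in $G_2$ both are attached at $u$. An orientation of $G_2$ in
  which $u$ does not point into $B$ becomes one of $G_1$ by moving $B$ back to $w$. If $u$ points into
  $B$, then first reverse the path, which carries $A$ and $B$ to $w$, and move $A$ back to $u$. In both
  cases only arcs that enter the attaching vertex from the part moved are changed, and these lie on
  no directed cycle. In the first case $w$ does not point into $B$ and in the second it does, so the two
  images are disjoint.

  The extremal graphs follow by shifting repeatedly. A graph of the class considered is, up to
  relabelling, the cycle on \<open>0, \<dots>, m - 1\<close> with a tree rooted at 0, given by a parent function
  (\<open>Omega_C_relabel\<close>). Moving the children of a child of the root to the root ends with the star.
  At a branching vertex without branchings below it, moving all but one branch to the far end of the
  remaining branch, which is a bare path, undoes a shift; this ends with the path.
\<close>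

section \<open>Products of symmetric functions as weight enumerators\<close>

text \<open>
  Products of such series are again of this form, with pairs as elements. The one-part functions
  are of this form, with finite fibres; an infinite fibre would be counted as 0.
\<close>

definition weight_series :: "'a set \<Rightarrow> ('a \<Rightarrow> nat multiset) \<Rightarrow> symfun" where
  "weight_series X wt = (\<lambda>m. of_nat (card {x \<in> X. wt x = m}))"

lemma finite_submultisets: "finite {a. a \<subseteq># (m :: 'a multiset)}"
proof -
  have "{a. a \<subseteq># m} \<subseteq> mset ` {xs. set xs \<subseteq> set_mset m \<and> length xs \<le> size m}"
  proof
    fix a assume "a \<in> {a. a \<subseteq># m}"
    then have a: "a \<subseteq># m" by simp
    obtain xs where xs: "mset xs = a" using ex_mset by blast
    have "set xs \<subseteq> set_mset m" using a xs mset_subset_eqD by fastforce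
    moreover have "length xs \<le> size m" using a xs size_mset_mono by fastforce
    ultimately show "a \<in> mset ` {xs. set xs \<subseteq> set_mset m \<and> length xs \<le> size m}"
      using xs by blast
  qed
  then show ?thesis using finite_lists_length_le finite_subset by fastforce
qed

text \<open>
  Weights add up in products, since a pair of weight \<open>m\<close> is determined by the
  submultiset of \<open>m\<close> used by its first component.
\<close>

lemma sf_mult_weight_series:
  assumes X: "\<And>m. finite {x \<in> X. wt x = m}" and Y: "\<And>m. finite {y \<in> Y. wt' y = m}"
  shows "sf_mult (weight_series X wt) (weight_series Y wt') = weight_series (X \<times> Y) (\<lambda>(x, y). wt x + wt' y)"
proof
  fix m
  have "{p \<in> X \<times> Y. (case p of (x, y) \<Rightarrow> wt x + wt' y) = m} =
    (\<Union>a\<in>{a. a \<subseteq># m}. {x \<in> X. wt x = a} \<times> {y \<in> Y. wt' y = m - a})" (is "?L = ?R")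
  proof
    show "?L \<subseteq> ?R"
    proof
      fix p assume "p \<in> ?L"
      then obtain x y where p: "p = (x, y)" "x \<in> X" "y \<in> Y" "wt x + wt' y = m" by auto
      then have "wt x \<subseteq># m" "wt' y = m - wt x" by auto
      with p show "p \<in> ?R" by blast
    qed
    show "?R \<subseteq> ?L" by (auto)
  qed
  then have "card {p \<in> X \<times> Y. (case p of (x, y) \<Rightarrow> wt x + wt' y) = m} =
    (\<Sum>a\<in>{a. a \<subseteq># m}. card ({x \<in> X. wt x = a} \<times> {y \<in> Y. wt' y = m - a}))"
    by (simp only:, subst card_UN_disjoint) (auto simp: finite_submultisets X Y)
  then show "sf_mult (weight_series X wt) (weight_series Y wt') m = weight_series (X \<times> Y) (\<lambda>(x, y). wt x + wt' y) m"
    by (simp add: sf_mult_def weight_series_def card_cartesian_product)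
qed

lemma weight_series_bij:
  assumes "bij_betw h X Y" "\<And>x. x \<in> X \<Longrightarrow> wt' (h x) = wt x"
  shows "weight_series X wt = weight_series Y wt'"
proof
  fix m
  have "bij_betw h {x \<in> X. wt x = m} {y \<in> Y. wt' y = m}"
    using assms by (auto simp: bij_betw_def inj_on_def)
  then show "weight_series X wt m = weight_series Y wt' m"
    by (simp add: weight_series_def bij_betw_same_card)
qed

text \<open>
  Finiteness of the fibres is part of the induction, because \<open>card\<close> of an infinite
  fibre would be 0.
\<close>

lemma sf_prod_list_weight_series:
  assumes "\<And>l m. l \<in> set ls \<Longrightarrow> finite {x \<in> X l. wt l x = m}"
    and "\<And>l. l \<in> set ls \<Longrightarrow> F l = weight_series (X l) (wt l)"
  shows "sf_prod_list (map F ls) =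
    weight_series {xs. list_all2 (\<lambda>l x. x \<in> X l) ls xs} (\<lambda>xs. sum_list (map2 wt ls xs))"
    and "\<And>m. finite {xs. list_all2 (\<lambda>l x. x \<in> X l) ls xs \<and> sum_list (map2 wt ls xs) = m}"
proof -
  have "sf_prod_list (map F ls) =
      weight_series {xs. list_all2 (\<lambda>l x. x \<in> X l) ls xs} (\<lambda>xs. sum_list (map2 wt ls xs)) \<and>
     (\<forall>m. finite {xs. list_all2 (\<lambda>l x. x \<in> X l) ls xs \<and> sum_list (map2 wt ls xs) = m})"
    using assms
  proof (induction ls)
    case Nil
    show ?case
      by (auto simp: sf_prod_list_def sf_one_def weight_series_def fun_eq_iff)
  next
    case (Cons l ls)
    let ?Y = "{xs. list_all2 (\<lambda>l x. x \<in> X l) ls xs}"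
    let ?w = "\<lambda>xs. sum_list (map2 wt ls xs)"
    have IH: "sf_prod_list (map F ls) = weight_series ?Y ?w" "\<And>m. finite {xs \<in> ?Y. ?w xs = m}"
      using Cons by auto
    have fl: "\<And>m. finite {x \<in> X l. wt l x = m}" using Cons.prems by auto
    have bij: "bij_betw (\<lambda>(x, xs). x # xs) (X l \<times> ?Y) {xs. list_all2 (\<lambda>l x. x \<in> X l) (l # ls) xs}"
      by (auto simp: bij_betw_def inj_on_def list_all2_Cons1 image_iff)
    have "sf_prod_list (map F (l # ls)) = sf_mult (weight_series (X l) (wt l)) (weight_series ?Y ?w)"
      using Cons.prems IH by (simp add: sf_prod_list_def)
    also have "\<dots> = weight_series (X l \<times> ?Y) (\<lambda>(x, y). wt l x + ?w y)"
      by (rule sf_mult_weight_series) (use fl IH in auto)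
    also have "\<dots> = weight_series {xs. list_all2 (\<lambda>l x. x \<in> X l) (l # ls) xs} (\<lambda>xs. sum_list (map2 wt (l # ls) xs))"
      by (rule weight_series_bij[OF bij]) auto
    finally have 1: "sf_prod_list (map F (l # ls)) = \<dots>" .
    have 2: "finite {xs. list_all2 (\<lambda>l x. x \<in> X l) (l # ls) xs \<and> sum_list (map2 wt (l # ls) xs) = m}" for m
    proof -
      have "{xs. list_all2 (\<lambda>l x. x \<in> X l) (l # ls) xs \<and> sum_list (map2 wt (l # ls) xs) = m} \<subseteq>
        (\<lambda>(x, xs). x # xs) ` (\<Union>a\<in>{a. a \<subseteq># m}. {x \<in> X l. wt l x = a} \<times> {xs \<in> ?Y. ?w xs = m - a})"
      proof
        fix xs assume "xs \<in> {xs. list_all2 (\<lambda>l x. x \<in> X l) (l # ls) xs \<and> sum_list (map2 wt (l # ls) xs) = m}"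
        then obtain y ys where xs: "xs = y # ys" "y \<in> X l" "ys \<in> ?Y" "wt l y + ?w ys = m"
          by (auto simp: list_all2_Cons1)
        then have "wt l y \<subseteq># m" "?w ys = m - wt l y" by auto
        then have "(y, ys) \<in> (\<Union>a\<in>{a. a \<subseteq># m}. {x \<in> X l. wt l x = a} \<times> {xs \<in> ?Y. ?w xs = m - a})"
          using xs by blast
        then show "xs \<in> (\<lambda>(x, xs). x # xs) ` (\<Union>a\<in>{a. a \<subseteq># m}. {x \<in> X l. wt l x = a} \<times> {xs \<in> ?Y. ?w xs = m - a})"
          using xs(1) by (intro image_eqI[of _ _ "(y, ys)"]) auto
      qed
      moreover have "finite (\<Union>a\<in>{a. a \<subseteq># m}. {x \<in> X l. wt l x = a} \<times> {xs \<in> ?Y. ?w xs = m - a})"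
        using finite_submultisets[of m] fl IH(2) by (intro finite_UN_I finite_cartesian_product) auto
      ultimately show ?thesis using finite_surj by blast
    qed
    show ?case by (intro conjI allI 1 2)
  qed
  note * = this
  show "sf_prod_list (map F ls) =
    weight_series {xs. list_all2 (\<lambda>l x. x \<in> X l) ls xs} (\<lambda>xs. sum_list (map2 wt ls xs))"
    by (rule *[THEN conjunct1])
  show "\<And>m. finite {xs. list_all2 (\<lambda>l x. x \<in> X l) ls xs \<and> sum_list (map2 wt ls xs) = m}"
    by (rule *[THEN conjunct2, rule_format])
qed

text \<open>
  If \<open>\<psi>\<close> permutes \<open>V\<close>, these are the colourings that are constant
  on the cycles of \<open>\<psi>\<close>.
\<close>

definition colourings :: "'v set \<Rightarrow> 'c set \<Rightarrow> ('v \<Rightarrow> 'v) \<Rightarrow> ('v \<Rightarrow> 'c) set" where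
  "colourings V C \<psi> = {\<kappa> \<in> V \<rightarrow>\<^sub>E C. \<forall>x\<in>V. \<kappa> (\<psi> x) = \<kappa> x}"

text \<open>
  The content of a colouring: each colour with the number of vertices that carry it.
\<close>

definition profile :: "'v set \<Rightarrow> ('v \<Rightarrow> 'c) \<Rightarrow> 'c multiset" where
  "profile V \<kappa> = image_mset \<kappa> (mset_set V)"

lemma psum_weight_series: "k > 0 \<Longrightarrow> psum k = weight_series UNIV (\<lambda>i. replicate_mset k i)"
proof
  fix m assume k: "k > 0"
  show "psum k m = weight_series UNIV (\<lambda>i. replicate_mset k i) m"
  proof (cases "\<exists>i. m = replicate_mset k i")
    case True
    then obtain i where m: "m = replicate_mset k i" by blast
    have "replicate_mset k j = replicate_mset k i \<Longrightarrow> j = i" for j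
      using k by (metis in_replicate_mset not_gr_zero)
    then have "{j. replicate_mset k j = m} = {i}" using m by auto
    then show ?thesis using True by (simp add: psum_def weight_series_def)
  next
    case False
    then have "{j. replicate_mset k j = m} = {}" by auto
    then show ?thesis using False by (simp add: psum_def weight_series_def)
  qed
qed

lemma finite_replicate_fibre: "k > 0 \<Longrightarrow> finite {i \<in> UNIV. replicate_mset k i = m}"
  by (rule finite_subset[of _ "set_mset m"]) auto

lemma orbit_colouring_const:
  assumes "\<psi> permutes V" "\<kappa> \<in> colourings V C \<psi>" "x \<in> V" "y \<in> orbit \<psi> x"
  shows "\<kappa> y = \<kappa> x"
  using assms(4)
proof induction
  case base
  then show ?case using assms(2,3) by (simp add: colourings_def)
next
  case (step y)
  have "y \<in> V" using permutes_orbit_subset[OF assms(1,3)] step by blast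
  then show ?case using assms(2) step by (simp add: colourings_def)
qed

lemma orbit_eq_of_mem:
  assumes "\<psi> permutes V" "finite V" "y \<in> orbit \<psi> x"
  shows "orbit \<psi> y = orbit \<psi> x"
  by (rule orbit_cyclic_eq3[OF cyclic_on_orbit[OF assms(1,2)] assms(3)])

lemma self_in_orbit:
  assumes "\<psi> permutes V" "finite V" shows "x \<in> orbit \<psi> x"
  by (rule permutation_self_in_orbit) (use assms permutation_permutes in blast)

lemma orbits_disjoint:
  assumes "\<psi> permutes V" "finite V" "O1 \<in> orbit \<psi> ` V" "O2 \<in> orbit \<psi> ` V" "O1 \<noteq> O2"
  shows "O1 \<inter> O2 = {}"
proof (rule ccontr)
  assume "O1 \<inter> O2 \<noteq> {}"
  then obtain z where z: "z \<in> O1" "z \<in> O2" by blast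
  obtain x y where "O1 = orbit \<psi> x" "O2 = orbit \<psi> y" using assms(3,4) by auto
  then show False using z orbit_eq_of_mem[OF assms(1,2)] assms(5) by metis
qed

lemma Union_orbits:
  assumes "\<psi> permutes V" "finite V"
  shows "\<Union> (orbit \<psi> ` V) = V"
  using self_in_orbit[OF assms] permutes_orbit_subset[OF assms(1)] by auto

lemma image_mset_const: "(\<And>x. x \<in> A \<Longrightarrow> f x = c) \<Longrightarrow> finite A \<Longrightarrow>
  image_mset f (mset_set A) = replicate_mset (card A) c"
proof -
  assume a: "\<And>x. x \<in> A \<Longrightarrow> f x = c" and f: "finite A"
  then have "image_mset f (mset_set A) = image_mset (\<lambda>_. c) (mset_set A)"
    by (intro image_mset_cong) auto
  then show ?thesis using f by (simp add: image_mset_const_eq)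
qed

lemma mset_set_Union_list:
  assumes "\<forall>B\<in>set Bs. finite B" "distinct Bs"
    "\<And>A B. A \<in> set Bs \<Longrightarrow> B \<in> set Bs \<Longrightarrow> A \<noteq> B \<Longrightarrow> A \<inter> B = {}"
  shows "mset_set (\<Union>(set Bs)) = sum_list (map mset_set Bs)"
  using assms
proof (induction Bs)
  case (Cons B Bs)
  have "B \<inter> \<Union>(set Bs) = {}" using Cons.prems by fastforce
  moreover have "finite B" "finite (\<Union>(set Bs))" using Cons.prems by auto
  ultimately have "mset_set (B \<union> \<Union>(set Bs)) = mset_set B + mset_set (\<Union>(set Bs))"
    by (simp add: mset_set_Union)
  then show ?case using Cons by simp
qed simp

lemma image_mset_sum_list: "image_mset f (sum_list ms) = sum_list (map (image_mset f) ms)"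
  by (induction ms) auto

text \<open>
  An invariant colouring chooses one colour for each cycle, and a cycle of length $k$ coloured
  $i$ contributes the monomial $x_i^k$ of $p_k$.
\<close>

lemma psum_sf_cycle_type:
  assumes p: "\<psi> permutes {0..<n}"
  shows "psum_sf (cycle_type n \<psi>) = weight_series (colourings {0..<n} UNIV \<psi>) (profile {0..<n})"
proof -
  let ?V = "{0..<n}"
  have fV: "finite ?V" by simp
  obtain Bs0 where Bs0: "set Bs0 = orbit \<psi> ` ?V" "distinct Bs0"
    using finite_distinct_list[OF finite_imageI[OF fV, of "orbit \<psi>"]] by auto
  define Bs where "Bs = rev (sort_key card Bs0)"
  have Bs: "set Bs = orbit \<psi> ` ?V" "distinct Bs"
    using Bs0 by (auto simp: Bs_def)
  have "map card (sort_key card Bs0) = sort (map card Bs0)"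
    by (rule properties_for_sort[symmetric]) simp_all
  moreover have "mset_set (orbit \<psi> ` ?V) = mset Bs0"
    using Bs0 mset_set_set by metis
  ultimately have ct: "cycle_type n \<psi> = map card Bs"
    by (simp add: cycle_type_def Bs_def rev_map[symmetric] flip: mset_map)
  have finB: "finite B" and cardB: "card B > 0" and subB: "B \<subseteq> ?V" if Bin: "B \<in> set Bs" for B
  proof -
    obtain x where x: "x \<in> ?V" "B = orbit \<psi> x" using Bin[unfolded Bs(1)] by blast
    show "B \<subseteq> ?V" using x permutes_orbit_subset[OF p] by blast
    then show "finite B" using finite_subset by blast
    then show "card B > 0" using x self_in_orbit[OF p fV, of x] by (auto simp: card_gt_0_iff)
  qed
  have disj: "\<And>A B. A \<in> set Bs \<Longrightarrow> B \<in> set Bs \<Longrightarrow> A \<noteq> B \<Longrightarrow> A \<inter> B = {}"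
    using orbits_disjoint[OF p fV] Bs by auto
  let ?X = "{cs. list_all2 (\<lambda>B c. c \<in> (UNIV :: nat set)) Bs cs}"
  let ?w = "\<lambda>cs. sum_list (map2 (\<lambda>B c. replicate_mset (card B) c) Bs cs)"
  have "psum_sf (cycle_type n \<psi>) = sf_prod_list (map (\<lambda>B. psum (card B)) Bs)"
    by (simp add: psum_sf_def ct o_def)
  also have "\<dots> = weight_series ?X ?w"
    using cardB by (intro sf_prod_list_weight_series(1)) (auto simp: psum_weight_series intro: finite_replicate_fibre[simplified])
  also have "\<dots> = weight_series (colourings ?V (UNIV :: nat set) \<psi>) (profile ?V)"
  proof (rule sym, rule weight_series_bij)
    let ?h = "\<lambda>\<kappa>. map (\<lambda>B. \<kappa> (Min B)) Bs"
    have MinB: "Min B \<in> B" if "B \<in> set Bs" for B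
      using finB cardB that by (metis Min_in card_gt_0_iff)
    have const: "\<kappa> x = \<kappa> (Min B)" if k: "\<kappa> \<in> colourings ?V (UNIV :: nat set) \<psi>" and Bin: "B \<in> set Bs" and xB: "x \<in> B" for \<kappa> :: "nat \<Rightarrow> nat" and B x
    proof -
      obtain y where y: "y \<in> ?V" "B = orbit \<psi> y" using Bin[unfolded Bs(1)] by blast
      have "\<kappa> x = \<kappa> y" by (rule orbit_colouring_const[OF p k y(1)]) (use y xB in simp)
      moreover have "\<kappa> (Min B) = \<kappa> y"
        by (rule orbit_colouring_const[OF p k y(1)]) (use y MinB[OF Bin] in simp)
      ultimately show ?thesis by simp
    qed
    have UB: "\<Union>(set Bs) = ?V" using Union_orbits[OF p fV] Bs by simp
    show "bij_betw ?h (colourings ?V (UNIV :: nat set) \<psi>) ?X"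
      unfolding bij_betw_def
    proof
      show "inj_on ?h (colourings ?V (UNIV :: nat set) \<psi>)"
      proof (rule inj_onI)
        fix \<kappa> \<kappa>' :: "nat \<Rightarrow> nat"
        assume k: "\<kappa> \<in> colourings ?V (UNIV :: nat set) \<psi>" "\<kappa>' \<in> colourings ?V (UNIV :: nat set) \<psi>" "?h \<kappa> = ?h \<kappa>'"
        show "\<kappa> = \<kappa>'"
        proof
          fix x
          show "\<kappa> x = \<kappa>' x"
          proof (cases "x \<in> ?V")
            case True
            then obtain B where B: "B \<in> set Bs" "x \<in> B" using UB by blast
            then have "\<kappa> (Min B) = \<kappa>' (Min B)" using k(3) by simp
            then show ?thesis using const[OF k(1) B] const[OF k(2) B] by simp
          next
            case False
            then show ?thesis using k by (auto simp: colourings_def PiE_def extensional_def)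
          qed
        qed
      qed
      show "?h ` colourings ?V (UNIV :: nat set) \<psi> = ?X"
      proof
        show "?h ` colourings ?V (UNIV :: nat set) \<psi> \<subseteq> ?X" by (auto simp: list_all2_conv_all_nth)
        show "?X \<subseteq> ?h ` colourings ?V (UNIV :: nat set) \<psi>"
        proof
          fix cs assume "cs \<in> ?X"
          then have len: "length cs = length Bs" by (auto dest: list_all2_lengthD)
          define c where "c B = the (map_of (zip Bs cs) B)" for B
          have c: "c (Bs ! i) = cs ! i" if "i < length Bs" for i
            using that len Bs(2) by (simp add: c_def map_of_zip_nth)
          define \<kappa> where "\<kappa> = restrict (\<lambda>x. c (orbit \<psi> x)) ?V"
          have "\<kappa> \<in> colourings ?V (UNIV :: nat set) \<psi>"
            using permutes_in_image[OF p] orbit_eq_of_mem[OF p fV orbit.base]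
            by (auto simp: colourings_def \<kappa>_def)
          moreover have "?h \<kappa> = cs"
          proof (rule nth_equalityI)
            show "length (?h \<kappa>) = length cs" using len by simp
            fix i assume i: "i < length (?h \<kappa>)"
            then have B: "Bs ! i \<in> set Bs" by simp
            then obtain y where y: "y \<in> ?V" "Bs ! i = orbit \<psi> y" unfolding Bs by blast
            have "orbit \<psi> (Min (Bs ! i)) = Bs ! i"
              using MinB[OF B] y orbit_eq_of_mem[OF p fV] by metis
            then show "?h \<kappa> ! i = cs ! i"
              using i c MinB[OF B] subB[OF B] by (auto simp: \<kappa>_def)
          qed
          ultimately show "cs \<in> ?h ` colourings ?V (UNIV :: nat set) \<psi>" by blast
        qed
      qed
    qed
    fix \<kappa> :: "nat \<Rightarrow> nat" assume k: "\<kappa> \<in> colourings ?V (UNIV :: nat set) \<psi>"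
    have "profile ?V \<kappa> = sum_list (map (image_mset \<kappa> \<circ> mset_set) Bs)"
      using mset_set_Union_list[of Bs] finB disj Bs(2) UB
      by (auto simp: profile_def image_mset_sum_list)
    also have "map (image_mset \<kappa> \<circ> mset_set) Bs = map (\<lambda>B. replicate_mset (card B) (\<kappa> (Min B))) Bs"
      using const[OF k] finB by (auto intro!: image_mset_const)
    also have "sum_list \<dots> = ?w (?h \<kappa>)"
      by (simp add: map2_map_map[of _ id, simplified])
    finally show "?w (?h \<kappa>) = profile ?V \<kappa>" by simp
  qed
  finally show ?thesis .
qed

section \<open>Class functions from invariant colourings\<close>

definition stabiliser :: "'v set \<Rightarrow> ('v \<Rightarrow> 'c) \<Rightarrow> ('v \<Rightarrow> 'v) set" where
  "stabiliser V \<omega> = {\<psi>. \<psi> permutes V \<and> (\<forall>x\<in>V. \<omega> (\<psi> x) = \<omega> x)}"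

lemma finite_colourings: "finite V \<Longrightarrow> finite C \<Longrightarrow> finite (colourings V C \<psi>)"
  unfolding colourings_def by (rule finite_subset[of _ "V \<rightarrow>\<^sub>E C"]) (auto intro: finite_PiE)

text \<open>
  Burnside counting on one class of words. Every word with the content of
  \<open>\<omega>0\<close> is a rearrangement of \<open>\<omega>0\<close>; its stabiliser is in
  bijection with the permutations that turn \<open>\<omega>0\<close> into it, and every
  permutation turns \<open>\<omega>0\<close> into exactly one word.
\<close>

lemma sum_card_stabiliser:
  assumes V: "finite V" and \<omega>0: "\<omega>0 \<in> V \<rightarrow>\<^sub>E D"
  shows "(\<Sum>\<omega> | \<omega> \<in> V \<rightarrow>\<^sub>E D \<and> profile V \<omega> = profile V \<omega>0. card (stabiliser V \<omega>)) = fact (card V)"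
proof -
  let ?W = "{\<omega>. \<omega> \<in> V \<rightarrow>\<^sub>E D \<and> profile V \<omega> = profile V \<omega>0}"
  let ?P = "{\<psi>. \<psi> permutes V}"
  let ?T = "\<lambda>\<omega>. {\<psi>. \<psi> permutes V \<and> restrict (\<omega>0 \<circ> \<psi>) V = \<omega>}"
  have fP: "finite ?P" using V finite_permutations by blast
  have card_eq: "card (stabiliser V \<omega>) = card (?T \<omega>)" if w: "\<omega> \<in> ?W" for \<omega>
  proof -
    have "image_mset \<omega> (mset_set V) = image_mset \<omega>0 (mset_set V)"
      using w by (simp add: profile_def)
    then obtain \<sigma> where s: "\<sigma> permutes V" "\<forall>x\<in>V. \<omega> x = \<omega>0 (\<sigma> x)"
      using image_mset_eq_implies_permutes[OF V] by metis
    have "bij_betw (\<lambda>\<psi>. \<sigma> \<circ> \<psi>) (stabiliser V \<omega>) (?T \<omega>)"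
      unfolding bij_betw_def
    proof
      show "inj_on (\<lambda>\<psi>. \<sigma> \<circ> \<psi>) (stabiliser V \<omega>)"
        using permutes_inj[OF s(1)] by (auto simp: inj_on_def fun_eq_iff dest: injD)
      show "(\<lambda>\<psi>. \<sigma> \<circ> \<psi>) ` stabiliser V \<omega> = ?T \<omega>"
      proof
        show "(\<lambda>\<psi>. \<sigma> \<circ> \<psi>) ` stabiliser V \<omega> \<subseteq> ?T \<omega>"
        proof
          fix \<phi> assume "\<phi> \<in> (\<lambda>\<psi>. \<sigma> \<circ> \<psi>) ` stabiliser V \<omega>"
          then obtain \<psi> where p: "\<phi> = \<sigma> \<circ> \<psi>" "\<psi> permutes V" "\<forall>x\<in>V. \<omega> (\<psi> x) = \<omega> x"
            by (auto simp: stabiliser_def)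
          have "restrict (\<omega>0 \<circ> \<phi>) V = \<omega>"
          proof
            fix x show "restrict (\<omega>0 \<circ> \<phi>) V x = \<omega> x"
              using p s permutes_in_image[OF p(2)] w by (cases "x \<in> V") (auto simp: PiE_def extensional_def)
          qed
          then show "\<phi> \<in> ?T \<omega>" using p s(1) by (simp add: permutes_compose)
        qed
        show "?T \<omega> \<subseteq> (\<lambda>\<psi>. \<sigma> \<circ> \<psi>) ` stabiliser V \<omega>"
        proof
          fix \<phi> assume "\<phi> \<in> ?T \<omega>"
          then have p: "\<phi> permutes V" "restrict (\<omega>0 \<circ> \<phi>) V = \<omega>" by auto
          let ?\<psi> = "inv_into UNIV \<sigma> \<circ> \<phi>"
          have pp: "?\<psi> permutes V" using p s by (simp add: permutes_compose permutes_inv)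
          have sp: "\<sigma> \<circ> ?\<psi> = \<phi>" using permutes_inv_o(1)[OF s(1)] by (simp add: o_assoc)
          have "\<omega> (?\<psi> x) = \<omega> x" if "x \<in> V" for x
          proof -
            have "\<omega> (?\<psi> x) = \<omega>0 (\<sigma> (?\<psi> x))" using s(2) permutes_in_image[OF pp] that by auto
            also have "\<sigma> (?\<psi> x) = \<phi> x" using sp by (metis comp_apply)
            also have "\<omega>0 (\<phi> x) = \<omega> x" using p(2) that by auto
            finally show ?thesis .
          qed
          then have "?\<psi> \<in> stabiliser V \<omega>" using pp by (simp add: stabiliser_def)
          then show "\<phi> \<in> (\<lambda>\<psi>. \<sigma> \<circ> \<psi>) ` stabiliser V \<omega>"
            by (rule image_eqI[rotated]) (rule sp[symmetric])
        qed
      qed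
    qed
    then show ?thesis by (rule bij_betw_same_card)
  qed
  have maps: "restrict (\<omega>0 \<circ> \<psi>) V \<in> ?W" if "\<psi> permutes V" for \<psi>
  proof -
    have "restrict (\<omega>0 \<circ> \<psi>) V \<in> V \<rightarrow>\<^sub>E D" using \<omega>0 permutes_in_image[OF that] by auto
    moreover have "profile V (restrict (\<omega>0 \<circ> \<psi>) V) = image_mset \<omega>0 (image_mset \<psi> (mset_set V))"
      unfolding profile_def image_mset.compositionality using V by (intro image_mset_cong) auto
    moreover have "image_mset \<psi> (mset_set V) = mset_set V"
      using that by (simp add: image_mset_mset_set permutes_inj_on permutes_image)
    ultimately show ?thesis by (simp add: profile_def)
  qed
  have Weq: "?W = (\<lambda>\<psi>. restrict (\<omega>0 \<circ> \<psi>) V) ` ?P"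
  proof
    show "(\<lambda>\<psi>. restrict (\<omega>0 \<circ> \<psi>) V) ` ?P \<subseteq> ?W" using maps by (intro image_subsetI) blast
    show "?W \<subseteq> (\<lambda>\<psi>. restrict (\<omega>0 \<circ> \<psi>) V) ` ?P"
    proof
      fix \<omega> assume w: "\<omega> \<in> ?W"
      then have "image_mset \<omega> (mset_set V) = image_mset \<omega>0 (mset_set V)"
        by (simp add: profile_def)
      then obtain \<sigma> where s: "\<sigma> permutes V" "\<forall>x\<in>V. \<omega> x = \<omega>0 (\<sigma> x)"
        using image_mset_eq_implies_permutes[OF V] by metis
      have "restrict (\<omega>0 \<circ> \<sigma>) V = \<omega>"
        using s w by (auto simp: fun_eq_iff PiE_def extensional_def)
      then show "\<omega> \<in> (\<lambda>\<psi>. restrict (\<omega>0 \<circ> \<psi>) V) ` ?P" using s by blast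
    qed
  qed
  then have fW: "finite ?W" using fP by simp
  have "(\<Sum>\<omega>\<in>?W. card (stabiliser V \<omega>)) = (\<Sum>\<omega>\<in>?W. card (?T \<omega>))"
    using card_eq by (intro sum.cong) auto
  also have "\<dots> = card (\<Union>\<omega>\<in>?W. ?T \<omega>)"
    using fW fP by (subst card_UN_disjoint) auto
  also have "(\<Union>\<omega>\<in>?W. ?T \<omega>) = ?P" using maps by blast
  also have "card ?P = fact (card V)" using card_permutations V by blast
  finally show ?thesis .
qed

text \<open>
  The flag \<open>sg\<close> selects the sign character instead of the trivial one. It allows
  $h_\<lambda>$ and $e_\<lambda>$ to be treated together.
\<close>

definition linear_char :: "bool \<Rightarrow> ('v \<Rightarrow> 'v) \<Rightarrow> rat" where
  "linear_char sg \<psi> = (if sg then of_int (sign \<psi>) else 1)"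

text \<open>
  The contents of words that survive the sum over the group: all of them without the sign, and
  only those without repeated letters with the sign.
\<close>

definition admissible :: "bool \<Rightarrow> 'c multiset \<Rightarrow> bool" where
  "admissible sg M \<longleftrightarrow> sg \<longrightarrow> (\<forall>x. count M x \<le> 1)"

lemma count_profile: "finite V \<Longrightarrow> count (profile V \<omega>) c = card {x \<in> V. \<omega> x = c}"
  by (simp add: profile_def count_image_mset_eq_card_vimage)

lemma inj_on_iff_profile: "finite V \<Longrightarrow> inj_on \<omega> V \<longleftrightarrow> (\<forall>x. count (profile V \<omega>) x \<le> 1)"
  by (auto simp: count_profile inj_on_def card_le_Suc0_iff_eq)

text \<open>
  With the sign, a repeated letter gives a transposition in the stabiliser, which pairs off even
  and odd elements.
\<close>

lemma sum_sign_stabiliser: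
  assumes V: "finite V"
  shows "(\<Sum>\<psi>\<in>stabiliser V \<omega>. linear_char sg \<psi>) =
    (if admissible sg (profile V \<omega>) then of_nat (card (stabiliser V \<omega>)) else 0)"
proof (cases sg)
  case False
  then show ?thesis by (simp add: linear_char_def admissible_def)
next
  case sg: True
  show ?thesis
  proof (cases "inj_on \<omega> V")
    case True
    have "stabiliser V \<omega> = {id}"
    proof -
      have "\<psi> = id" if "\<psi> \<in> stabiliser V \<omega>" for \<psi>
      proof
        fix x
        have p: "\<psi> permutes V" "\<forall>x\<in>V. \<omega> (\<psi> x) = \<omega> x" using that by (auto simp: stabiliser_def)
        show "\<psi> x = id x"
          using p True permutes_in_image[OF p(1)] permutes_not_in[OF p(1)]
          by (cases "x \<in> V") (auto dest: inj_onD)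
      qed
      moreover have "id \<in> stabiliser V \<omega>" by (simp add: stabiliser_def permutes_id)
      ultimately show ?thesis by blast
    qed
    moreover have "admissible sg (profile V \<omega>)"
      using True V by (simp add: admissible_def inj_on_iff_profile)
    ultimately show ?thesis by (simp add: linear_char_def)
  next
    case False
    then obtain x y where xy: "x \<in> V" "y \<in> V" "x \<noteq> y" "\<omega> x = \<omega> y" by (auto simp: inj_on_def)
    let ?t = "transpose x y"
    have bij: "bij_betw (\<lambda>\<psi>. ?t \<circ> \<psi>) (stabiliser V \<omega>) (stabiliser V \<omega>)"
    proof (rule bij_betwI[where g = "\<lambda>\<psi>. ?t \<circ> \<psi>"])
      have "?t \<circ> \<psi> \<in> stabiliser V \<omega>" if "\<psi> \<in> stabiliser V \<omega>" for \<psi>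
      proof -
        have p: "\<psi> permutes V" "\<forall>x\<in>V. \<omega> (\<psi> x) = \<omega> x" using that by (auto simp: stabiliser_def)
        have "?t permutes V" using xy by (simp add: permutes_swap_id)
        moreover have "\<omega> (?t z) = \<omega> z" for z using xy by (auto simp: transpose_def)
        ultimately show ?thesis using p by (auto simp: stabiliser_def permutes_compose)
      qed
      then show "(\<lambda>\<psi>. ?t \<circ> \<psi>) \<in> stabiliser V \<omega> \<rightarrow> stabiliser V \<omega>" by auto
      then show "(\<lambda>\<psi>. ?t \<circ> \<psi>) \<in> stabiliser V \<omega> \<rightarrow> stabiliser V \<omega>" .
    qed (auto simp: fun_eq_iff)
    have "(\<Sum>\<psi>\<in>stabiliser V \<omega>. of_int (sign \<psi>) :: rat) = (\<Sum>\<psi>\<in>stabiliser V \<omega>. of_int (sign (?t \<circ> \<psi>)))"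
      by (rule sum.reindex_bij_betw[OF bij, symmetric])
    also have "\<dots> = (\<Sum>\<psi>\<in>stabiliser V \<omega>. - of_int (sign \<psi>))"
    proof (rule sum.cong[OF refl])
      fix \<psi> assume "\<psi> \<in> stabiliser V \<omega>"
      then have "permutation \<psi>" using V by (auto simp: stabiliser_def permutation_permutes)
      then show "(of_int (sign (?t \<circ> \<psi>)) :: rat) = - of_int (sign \<psi>)"
        using xy by (simp add: sign_compose permutation_swap_id sign_swap_id)
    qed
    finally have "(\<Sum>\<psi>\<in>stabiliser V \<omega>. of_int (sign \<psi>) :: rat) = 0" by (simp add: sum_negf)
    moreover have "\<not> admissible sg (profile V \<omega>)"
      using False sg V by (simp add: admissible_def inj_on_iff_profile)
    ultimately show ?thesis using sg by (simp add: linear_char_def)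
  qed
qed

lemma ex_profile:
  assumes "finite V" "size M = card V" "set_mset M \<subseteq> D"
  shows "\<exists>\<omega> \<in> V \<rightarrow>\<^sub>E D. profile V \<omega> = M"
proof -
  obtain xs where xs: "mset xs = M" using ex_mset by blast
  then have len: "length xs = card V" using assms by auto
  obtain h where h: "bij_betw h V {0..<card V}" using ex_bij_betw_finite_nat[OF assms(1)] by blast
  let ?w = "restrict (\<lambda>x. xs ! h x) V"
  have "profile V ?w = image_mset (\<lambda>i. xs ! i) (image_mset h (mset_set V))"
    unfolding profile_def image_mset.compositionality using assms(1)
    by (intro image_mset_cong) auto
  also have "image_mset h (mset_set V) = mset_set {0..<length xs}"
    using h len by (simp add: bij_betw_def image_mset_mset_set)
  also have "image_mset (\<lambda>i. xs ! i) (mset_set {0..<length xs}) = M"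
    using xs by (metis map_nth mset_map mset_upt)
  finally have "profile V ?w = M" .
  moreover have "xs ! h x \<in> D" if "x \<in> V" for x
  proof -
    have "h x < length xs" using h that len bij_betwE by fastforce
    then show ?thesis using xs assms(3) nth_mem by fastforce
  qed
  ultimately show ?thesis by (intro bexI[of _ ?w]) auto
qed

lemma profile_props:
  assumes "finite V" "\<omega> \<in> V \<rightarrow>\<^sub>E D"
  shows "size (profile V \<omega>) = card V" "set_mset (profile V \<omega>) \<subseteq> D"
  using assms by (auto simp: profile_def)

lemma finite_msets: "finite D \<Longrightarrow> finite {M. set_mset M \<subseteq> D \<and> size M = n}"
proof -
  assume "finite D"
  then have "finite (mset ` {xs. set xs \<subseteq> D \<and> length xs = n})"
    by (intro finite_imageI finite_lists_length_eq)
  moreover have "{M. set_mset M \<subseteq> D \<and> size M = n} \<subseteq> mset ` {xs. set xs \<subseteq> D \<and> length xs = n}"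
  proof
    fix M assume "M \<in> {M. set_mset M \<subseteq> D \<and> size M = n}"
    moreover obtain xs where "mset xs = M" using ex_mset by blast
    ultimately show "M \<in> mset ` {xs. set xs \<subseteq> D \<and> length xs = n}" by force
  qed
  ultimately show ?thesis by (rule finite_subset[rotated])
qed

text \<open>
  Exchange the two summations: each word contributes the sum of the linear character over its
  stabiliser, and the words of one content contribute $n!$ altogether, or nothing.
\<close>

lemma burnside_profiles:
  fixes \<Psi> :: "'c multiset \<Rightarrow> rat"
  assumes V: "finite V" and D: "finite D"
  shows "(\<Sum>\<psi> | \<psi> permutes V. linear_char sg \<psi> * (\<Sum>\<omega>\<in>colourings V D \<psi>. \<Psi> (profile V \<omega>))) =
    fact (card V) * (\<Sum>M | set_mset M \<subseteq> D \<and> size M = card V \<and> admissible sg M. \<Psi> M)"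
proof -
  let ?P = "{\<psi>. \<psi> permutes V}" and ?W = "V \<rightarrow>\<^sub>E D"
  let ?M = "{M. set_mset M \<subseteq> D \<and> size M = card V}"
  have fP: "finite ?P" using V finite_permutations by blast
  have fW: "finite ?W" using V D by (intro finite_PiE) auto
  have fM: "finite ?M" using finite_msets[OF D] .
  have "(\<Sum>\<psi>\<in>?P. linear_char sg \<psi> * (\<Sum>\<omega>\<in>colourings V D \<psi>. \<Psi> (profile V \<omega>))) =
    (\<Sum>\<psi>\<in>?P. \<Sum>\<omega> | \<omega> \<in> ?W \<and> (\<forall>x\<in>V. \<omega> (\<psi> x) = \<omega> x). linear_char sg \<psi> * \<Psi> (profile V \<omega>))"
    by (simp add: sum_distrib_left colourings_def)
  also have "\<dots> = (\<Sum>\<omega>\<in>?W. \<Sum>\<psi> | \<psi> \<in> ?P \<and> (\<forall>x\<in>V. \<omega> (\<psi> x) = \<omega> x). linear_char sg \<psi> * \<Psi> (profile V \<omega>))"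
    using fP fW by (rule sum.swap_restrict)
  also have "\<dots> = (\<Sum>\<omega>\<in>?W. (\<Sum>\<psi>\<in>stabiliser V \<omega>. linear_char sg \<psi>) * \<Psi> (profile V \<omega>))"
    by (simp add: stabiliser_def sum_distrib_right)
  also have "\<dots> = (\<Sum>\<omega>\<in>?W. (if admissible sg (profile V \<omega>) then of_nat (card (stabiliser V \<omega>)) else 0) * \<Psi> (profile V \<omega>))"
    using V by (simp add: sum_sign_stabiliser)
  also have "\<dots> = (\<Sum>M\<in>?M. \<Sum>\<omega> | \<omega> \<in> ?W \<and> profile V \<omega> = M.
      (if admissible sg (profile V \<omega>) then of_nat (card (stabiliser V \<omega>)) else 0) * \<Psi> (profile V \<omega>))"
    using fW fM profile_props[OF V, where D = D] by (intro sum.group[symmetric]) (simp_all add: image_subset_iff)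
  also have "\<dots> = (\<Sum>M\<in>?M. fact (card V) * (if admissible sg M then \<Psi> M else 0))"
  proof (rule sum.cong[OF refl])
    fix M assume "M \<in> ?M"
    then obtain \<omega>0 where w0: "\<omega>0 \<in> ?W" "profile V \<omega>0 = M" using ex_profile[OF V] by blast
    have "(\<Sum>\<omega> | \<omega> \<in> ?W \<and> profile V \<omega> = M. of_nat (card (stabiliser V \<omega>)) :: rat) = fact (card V)"
      using arg_cong[OF sum_card_stabiliser[OF V w0(1)], of "of_nat :: nat \<Rightarrow> rat"]
      unfolding w0(2) of_nat_sum of_nat_fact .
    then show "(\<Sum>\<omega> | \<omega> \<in> ?W \<and> profile V \<omega> = M.
        (if admissible sg (profile V \<omega>) then of_nat (card (stabiliser V \<omega>)) else 0) * \<Psi> (profile V \<omega>)) =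
      fact (card V) * (if admissible sg M then \<Psi> M else 0)"
      by (auto simp flip: sum_distrib_right)
  qed
  also have "\<dots> = fact (card V) * (\<Sum>M | M \<in> ?M \<and> admissible sg M. \<Psi> M)"
    using sum.inter_filter[OF fM, of \<Psi> "admissible sg"] by (simp only: sum_distrib_left[symmetric])
  finally show ?thesis by (simp add: conj_assoc)
qed

text \<open>
  A linear combination of permutation characters on words, twisted by a linear character;
  \<open>\<Phi>\<close> is the coefficient of the words with a given content. All class
  functions needed for $h_\<lambda>$, $e_\<lambda>$ and $s_\<lambda>$ have this form.
\<close>

definition colour_char :: "bool \<Rightarrow> nat \<Rightarrow> 'c set \<Rightarrow> ('c multiset \<Rightarrow> rat) \<Rightarrow> (nat \<Rightarrow> nat) \<Rightarrow> rat" where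
  "colour_char sg n C \<Phi> \<psi> = (if \<psi> permutes {0..<n}
     then linear_char sg \<psi> * (\<Sum>\<kappa>\<in>colourings {0..<n} C \<psi>. \<Phi> (profile {0..<n} \<kappa>)) else 0)"

lemma profile_comp_permutes:
  assumes "finite V" "\<sigma> permutes V"
  shows "profile V (restrict (\<omega> \<circ> \<sigma>) V) = profile V \<omega>"
proof -
  have "profile V (restrict (\<omega> \<circ> \<sigma>) V) = image_mset \<omega> (image_mset \<sigma> (mset_set V))"
    unfolding profile_def image_mset.compositionality using assms by (intro image_mset_cong) auto
  moreover have "image_mset \<sigma> (mset_set V) = mset_set V"
    using assms(2) by (simp add: image_mset_mset_set permutes_inj_on permutes_image)
  ultimately show ?thesis by (simp add: profile_def)
qed

lemma colour_char_class: "colour_char sg n C \<Phi> \<in> class_functions n"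
  unfolding class_functions_def
proof (intro CollectI conjI allI impI)
  fix \<sigma> \<psi> :: "nat \<Rightarrow> nat"
  let ?V = "{0..<n}"
  assume "\<sigma> permutes ?V \<and> \<psi> permutes ?V"
  then have s: "\<sigma> permutes ?V" and p: "\<psi> permutes ?V" by auto
  let ?c = "\<sigma> \<circ> \<psi> \<circ> inv_into UNIV \<sigma>"
  have c: "?c permutes ?V" using s p by (simp add: permutes_compose permutes_inv)
  have inv: "inv_into UNIV \<sigma> (\<sigma> x) = x" "\<sigma> (inv_into UNIV \<sigma> x) = x" for x
    using s by (simp_all add: permutes_inverses)
  have inv_perm: "inv_into UNIV \<sigma> permutes ?V" using s by (rule permutes_inv)
  have mem: "\<sigma> x \<in> ?V \<longleftrightarrow> x \<in> ?V" "\<psi> x \<in> ?V \<longleftrightarrow> x \<in> ?V" "inv_into UNIV \<sigma> x \<in> ?V \<longleftrightarrow> x \<in> ?V" for x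
    using permutes_in_image[OF s] permutes_in_image[OF p] permutes_in_image[OF inv_perm] by blast+
  have "bij_betw (\<lambda>\<kappa>. restrict (\<kappa> \<circ> \<sigma>) ?V) (colourings ?V C ?c) (colourings ?V C \<psi>)"
  proof (rule bij_betwI[where g = "\<lambda>\<kappa>. restrict (\<kappa> \<circ> inv_into UNIV \<sigma>) ?V"])
    show "(\<lambda>\<kappa>. restrict (\<kappa> \<circ> \<sigma>) ?V) \<in> colourings ?V C ?c \<rightarrow> colourings ?V C \<psi>"
    proof
      fix \<kappa> assume k: "\<kappa> \<in> colourings ?V C ?c"
      have "\<kappa> (\<sigma> (\<psi> x)) = \<kappa> (\<sigma> x)" if "x \<in> ?V" for x
      proof -
        have "\<kappa> (?c (\<sigma> x)) = \<kappa> (\<sigma> x)" using k mem that unfolding colourings_def by blast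
        then show ?thesis by (simp add: inv)
      qed
      moreover have "\<kappa> (\<sigma> x) \<in> C" if "x \<in> ?V" for x
        using k mem that unfolding colourings_def by blast
      ultimately show "restrict (\<kappa> \<circ> \<sigma>) ?V \<in> colourings ?V C \<psi>"
        using mem(2) by (simp add: colourings_def del: atLeastLessThan_iff)
    qed
    show "(\<lambda>\<kappa>. restrict (\<kappa> \<circ> inv_into UNIV \<sigma>) ?V) \<in> colourings ?V C \<psi> \<rightarrow> colourings ?V C ?c"
    proof
      fix \<kappa> assume k: "\<kappa> \<in> colourings ?V C \<psi>"
      have "\<kappa> (\<psi> (inv_into UNIV \<sigma> x)) = \<kappa> (inv_into UNIV \<sigma> x)" if "x \<in> ?V" for x
        using k mem that unfolding colourings_def by blast
      moreover have "\<kappa> (inv_into UNIV \<sigma> x) \<in> C" if "x \<in> ?V" for x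
        using k mem that unfolding colourings_def by blast
      ultimately show "restrict (\<kappa> \<circ> inv_into UNIV \<sigma>) ?V \<in> colourings ?V C ?c"
        using mem by (simp add: colourings_def inv del: atLeastLessThan_iff)
    qed
    fix \<kappa> assume k: "\<kappa> \<in> colourings ?V C ?c"
    show "restrict (restrict (\<kappa> \<circ> \<sigma>) ?V \<circ> inv_into UNIV \<sigma>) ?V = \<kappa>"
    proof
      fix x show "restrict (restrict (\<kappa> \<circ> \<sigma>) ?V \<circ> inv_into UNIV \<sigma>) ?V x = \<kappa> x"
        using k mem(3)[of x] by (cases "x \<in> ?V") (simp_all add: inv colourings_def PiE_def extensional_def del: atLeastLessThan_iff)
    qed
  next
    fix \<kappa> assume k: "\<kappa> \<in> colourings ?V C \<psi>"
    show "restrict (restrict (\<kappa> \<circ> inv_into UNIV \<sigma>) ?V \<circ> \<sigma>) ?V = \<kappa>"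
    proof
      fix x show "restrict (restrict (\<kappa> \<circ> inv_into UNIV \<sigma>) ?V \<circ> \<sigma>) ?V x = \<kappa> x"
        using k mem(1)[of x] by (cases "x \<in> ?V") (simp_all add: inv colourings_def PiE_def extensional_def del: atLeastLessThan_iff)
    qed
  qed
  from sum.reindex_bij_betw[OF this, of "\<lambda>\<kappa>. \<Phi> (profile ?V \<kappa>)"]
  have "(\<Sum>\<kappa>\<in>colourings ?V C \<psi>. \<Phi> (profile ?V \<kappa>)) = (\<Sum>\<kappa>\<in>colourings ?V C ?c. \<Phi> (profile ?V \<kappa>))"
    using s by (simp add: profile_comp_permutes)
  moreover have "linear_char sg ?c = linear_char sg \<psi>"
  proof -
    have perm: "permutation \<sigma>" "permutation \<psi>" "permutation (inv_into UNIV \<sigma>)"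
      using s p inv_perm permutation_permutes by blast+
    then have "sign ?c = sign \<sigma> * sign \<psi> * sign \<sigma>"
      by (simp add: sign_compose permutation_compose sign_inverse)
    also have "\<dots> = sign \<psi>" by (simp add: sign_def)
    finally show ?thesis by (simp add: linear_char_def)
  qed
  ultimately show "colour_char sg n C \<Phi> ?c = colour_char sg n C \<Phi> \<psi>"
    using c p by (simp add: colour_char_def)
qed (simp add: colour_char_def)

text \<open>
  The coefficient of $p_{type(\<psi>)}$ at \<open>m\<close> counts invariant words of content
  \<open>m\<close>. A pair of words is a word of pairs, so Burnside counting turns the sum over
  the group into a sum over contents of pairs, that is, over matrices with prescribed column
  sums.
\<close>

lemma frob_ch_colour_char:
  assumes C: "finite C"
  shows "frob_ch n (colour_char sg n C \<Phi>) m =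
    (\<Sum>M | set_mset M \<subseteq> C \<times> set_mset m \<and> size M = n \<and> admissible sg M \<and> image_mset snd M = m.
       \<Phi> (image_mset fst M))"
proof -
  let ?V = "{0..<n}" and ?P = "{\<psi>. \<psi> permutes {0..<n}}" and ?D = "C \<times> set_mset m"
  let ?\<Psi> = "\<lambda>M. if image_mset snd M = m then \<Phi> (image_mset fst M) else 0"
  have fD: "finite ?D" using C by simp
  have key: "(\<Sum>\<kappa>\<in>colourings ?V C \<psi>. \<Phi> (profile ?V \<kappa>)) * psum_sf (cycle_type n \<psi>) m =
    (\<Sum>\<omega>\<in>colourings ?V ?D \<psi>. ?\<Psi> (profile ?V \<omega>))" if p: "\<psi> permutes ?V" for \<psi>
  proof -
    let ?K = "{\<kappa> \<in> colourings ?V UNIV \<psi>. profile ?V \<kappa> = m}"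
    let ?h = "\<lambda>\<omega>. (restrict (fst \<circ> \<omega>) ?V, restrict (snd \<circ> \<omega>) ?V)"
    have KD: "\<kappa> x \<in># m" if "\<kappa> \<in> ?K" "x \<in> ?V" for \<kappa> x
    proof -
      have "\<kappa> x \<in># profile ?V \<kappa>" using that(2) by (simp add: profile_def)
      then show ?thesis using that(1) by simp
    qed
    have mem: "\<psi> x \<in> ?V \<longleftrightarrow> x \<in> ?V" for x using permutes_in_image[OF p] by blast
    have cfst: "profile ?V (restrict (fst \<circ> \<omega>) ?V) = image_mset fst (profile ?V \<omega>)"
      and csnd: "profile ?V (restrict (snd \<circ> \<omega>) ?V) = image_mset snd (profile ?V \<omega>)" for \<omega> :: "nat \<Rightarrow> 'a \<times> nat"
      unfolding profile_def image_mset.compositionality by (auto intro!: image_mset_cong)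
    have bij: "bij_betw ?h {\<omega> \<in> colourings ?V ?D \<psi>. image_mset snd (profile ?V \<omega>) = m}
      (colourings ?V C \<psi> \<times> ?K)"
    proof (rule bij_betwI[where g = "\<lambda>(\<kappa>, \<kappa>'). restrict (\<lambda>x. (\<kappa> x, \<kappa>' x)) ?V"])
      show "?h \<in> {\<omega> \<in> colourings ?V ?D \<psi>. image_mset snd (profile ?V \<omega>) = m} \<rightarrow> colourings ?V C \<psi> \<times> ?K"
      proof
        fix \<omega> assume "\<omega> \<in> {\<omega> \<in> colourings ?V ?D \<psi>. image_mset snd (profile ?V \<omega>) = m}"
        then have w: "\<And>x. x \<in> ?V \<Longrightarrow> \<omega> x \<in> ?D" "\<And>x. x \<in> ?V \<Longrightarrow> \<omega> (\<psi> x) = \<omega> x"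
          "image_mset snd (profile ?V \<omega>) = m" unfolding colourings_def by blast+
        have "\<And>x. x \<in> ?V \<Longrightarrow> fst (\<omega> x) \<in> C" using w(1) by (metis mem_Times_iff)
        then show "?h \<omega> \<in> colourings ?V C \<psi> \<times> ?K"
          using w(2,3) mem csnd[of \<omega>] by (simp add: colourings_def del: atLeastLessThan_iff)
      qed
      show "(\<lambda>(\<kappa>, \<kappa>'). restrict (\<lambda>x. (\<kappa> x, \<kappa>' x)) ?V) \<in> colourings ?V C \<psi> \<times> ?K \<rightarrow>
        {\<omega> \<in> colourings ?V ?D \<psi>. image_mset snd (profile ?V \<omega>) = m}"
      proof (clarify, intro conjI)
        fix \<kappa> :: "nat \<Rightarrow> 'a" and \<kappa>' :: "nat \<Rightarrow> nat"
        assume k: "\<kappa> \<in> colourings ?V C \<psi>" "\<kappa>' \<in> colourings ?V UNIV \<psi>" "m = profile ?V \<kappa>'"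
        have "\<And>x. x \<in> ?V \<Longrightarrow> \<kappa> x \<in> C" using k unfolding colourings_def by blast
        moreover have "\<And>x. x \<in> ?V \<Longrightarrow> \<kappa> (\<psi> x) = \<kappa> x" "\<And>x. x \<in> ?V \<Longrightarrow> \<kappa>' (\<psi> x) = \<kappa>' x"
          using k unfolding colourings_def by blast+
        moreover have "\<And>x. x \<in> ?V \<Longrightarrow> \<kappa>' x \<in># profile ?V \<kappa>'" by (simp add: profile_def)
        ultimately show "restrict (\<lambda>x. (\<kappa> x, \<kappa>' x)) ?V \<in> colourings ?V (C \<times> set_mset (profile ?V \<kappa>')) \<psi>"
          using mem by (simp add: colourings_def del: atLeastLessThan_iff)
        show "image_mset snd (profile ?V (restrict (\<lambda>x. (\<kappa> x, \<kappa>' x)) ?V)) = profile ?V \<kappa>'"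
          unfolding profile_def image_mset.compositionality by (auto intro!: image_mset_cong)
      qed
      fix \<omega> assume "\<omega> \<in> {\<omega> \<in> colourings ?V ?D \<psi>. image_mset snd (profile ?V \<omega>) = m}"
      then have "\<omega> \<in> extensional ?V" by (auto simp: colourings_def PiE_def)
      then show "(case ?h \<omega> of (\<kappa>, \<kappa>') \<Rightarrow> restrict (\<lambda>x. (\<kappa> x, \<kappa>' x)) ?V) = \<omega>"
        by (auto simp: fun_eq_iff extensional_def restrict_def)
    next
      fix q assume q: "q \<in> colourings ?V C \<psi> \<times> ?K"
      obtain \<kappa> \<kappa>' where qq: "q = (\<kappa>, \<kappa>')" by (cases q)
      have "\<kappa> \<in> extensional ?V" "\<kappa>' \<in> extensional ?V" using q qq by (auto simp: colourings_def PiE_def)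
      then show "?h (case q of (\<kappa>, \<kappa>') \<Rightarrow> restrict (\<lambda>x. (\<kappa> x, \<kappa>' x)) ?V) = q"
        unfolding qq by (auto simp: fun_eq_iff extensional_def restrict_def)
    qed
    have fK: "finite (colourings ?V ?D \<psi>)" using fD by (simp add: finite_colourings)
    have "(\<Sum>\<kappa>\<in>colourings ?V C \<psi>. \<Phi> (profile ?V \<kappa>)) * psum_sf (cycle_type n \<psi>) m =
      (\<Sum>\<kappa>\<in>colourings ?V C \<psi>. \<Sum>\<kappa>'\<in>?K. \<Phi> (profile ?V \<kappa>))"
      by (simp add: psum_sf_cycle_type[OF p] weight_series_def sum_distrib_right mult.commute)
    also have "\<dots> = (\<Sum>q\<in>colourings ?V C \<psi> \<times> ?K. \<Phi> (profile ?V (fst q)))"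
      by (simp only: sum.cartesian_product case_prod_unfold)
    also have "\<dots> = (\<Sum>\<omega>\<in>{\<omega> \<in> colourings ?V ?D \<psi>. image_mset snd (profile ?V \<omega>) = m}. \<Phi> (image_mset fst (profile ?V \<omega>)))"
      using sum.reindex_bij_betw[OF bij, of "\<lambda>q. \<Phi> (profile ?V (fst q))"] cfst by simp
    also have "\<dots> = (\<Sum>\<omega>\<in>colourings ?V ?D \<psi>. ?\<Psi> (profile ?V \<omega>))"
      using fK by (simp add: sum.inter_filter)
    finally show ?thesis .
  qed
  have "frob_ch n (colour_char sg n C \<Phi>) m =
    1 / fact n * (\<Sum>\<psi>\<in>?P. linear_char sg \<psi> * ((\<Sum>\<kappa>\<in>colourings ?V C \<psi>. \<Phi> (profile ?V \<kappa>)) * psum_sf (cycle_type n \<psi>) m))"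
    by (simp add: frob_ch_def colour_char_def mult.assoc)
  also have "(\<Sum>\<psi>\<in>?P. linear_char sg \<psi> * ((\<Sum>\<kappa>\<in>colourings ?V C \<psi>. \<Phi> (profile ?V \<kappa>)) * psum_sf (cycle_type n \<psi>) m))
    = (\<Sum>\<psi>\<in>?P. linear_char sg \<psi> * (\<Sum>\<omega>\<in>colourings ?V ?D \<psi>. ?\<Psi> (profile ?V \<omega>)))"
    using key by (intro sum.cong) auto
  also have "\<dots> = fact n * (\<Sum>M | set_mset M \<subseteq> ?D \<and> size M = n \<and> admissible sg M. ?\<Psi> M)"
    using burnside_profiles[OF _ fD, of ?V] by simp
  also have "(\<Sum>M | set_mset M \<subseteq> ?D \<and> size M = n \<and> admissible sg M. ?\<Psi> M) =
    (\<Sum>M | M \<in> {M. set_mset M \<subseteq> ?D \<and> size M = n \<and> admissible sg M} \<and> image_mset snd M = m. \<Phi> (image_mset fst M))"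
    by (rule sum.inter_filter[symmetric], rule finite_subset[OF _ finite_msets[OF fD, of n]]) auto
  also have "{M. M \<in> {M. set_mset M \<subseteq> ?D \<and> size M = n \<and> admissible sg M} \<and> image_mset snd M = m} =
    {M. set_mset M \<subseteq> ?D \<and> size M = n \<and> admissible sg M \<and> image_mset snd M = m}" by auto
  finally show ?thesis by simp
qed

section \<open>Injectivity of the Frobenius characteristic\<close>

text \<open>The first return time of \<open>x\<close> is the size of its orbit.\<close>

lemma card_orbit_period:
  assumes "x \<in> orbit f x"
  shows "(f ^^ card (orbit f x)) x = x" "card (orbit f x) > 0"
    "inj_on (\<lambda>n. (f ^^ n) x) {0..<card (orbit f x)}"
proof -
  have "card (orbit f x) = funpow_dist1 f x x"
    unfolding orbit_conv_funpow_dist1[OF assms]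
    by (subst card_image[OF inj_on_funpow_dist1[OF assms]]) simp
  then show "(f ^^ card (orbit f x)) x = x" "card (orbit f x) > 0"
    "inj_on (\<lambda>n. (f ^^ n) x) {0..<card (orbit f x)}"
    using funpow_dist1_prop[OF assms] inj_on_funpow_dist1[OF assms] by simp_all
qed

lemma funpow_eq_iff_cong:
  assumes "x \<in> orbit f x"
  shows "(f ^^ i) x = (f ^^ j) x \<longleftrightarrow> i mod card (orbit f x) = j mod card (orbit f x)"
proof -
  let ?k = "card (orbit f x)"
  have "(f ^^ i) x = (f ^^ (i mod ?k)) x" for i
    using funpow_mod_eq[OF card_orbit_period(1)[OF assms]] by simp
  then show ?thesis
    using inj_onD[OF card_orbit_period(3)[OF assms], of "i mod ?k" "j mod ?k"]
      card_orbit_period(2)[OF assms] by (metis atLeastLessThan_iff mod_less_divisor zero_le)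
qed

text \<open>
  Fix the minimum of each orbit as base point and send $\<psi>^i$ of the base point to
  $\<phi>^i$ of it; this is well defined as both exponents matter modulo the size of the orbit.
\<close>

lemma same_orbits_conj:
  fixes \<psi> \<phi> :: "nat \<Rightarrow> nat"
  assumes V: "finite V" and p: "\<psi> permutes V" and q: "\<phi> permutes V"
    and orb: "\<And>x. x \<in> V \<Longrightarrow> orbit \<psi> x = orbit \<phi> x"
  shows "\<exists>\<sigma>. \<sigma> permutes V \<and> \<phi> = \<sigma> \<circ> \<psi> \<circ> inv_into UNIV \<sigma>"
proof -
  define r where "r x = Min (orbit \<psi> x)" for x
  have orbV: "orbit \<psi> x \<subseteq> V" "x \<in> orbit \<psi> x" if "x \<in> V" for x
    using permutes_orbit_subset[OF p that] self_in_orbit[OF p V] by auto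
  have r: "r x \<in> orbit \<psi> x" "r x \<in> V" "orbit \<psi> (r x) = orbit \<psi> x" "r (r x) = r x" if "x \<in> V" for x
  proof -
    show 1: "r x \<in> orbit \<psi> x" unfolding r_def
      using orbV[OF that] V by (metis Min_in empty_iff finite_subset)
    then show "r x \<in> V" using orbV[OF that] by blast
    show 2: "orbit \<psi> (r x) = orbit \<psi> x" using orbit_eq_of_mem[OF p V 1] .
    show "r (r x) = r x" using 2 by (simp add: r_def)
  qed
  define ix where "ix x = (SOME i. (\<psi> ^^ i) (r x) = x)" for x
  have ix: "(\<psi> ^^ ix x) (r x) = x" if "x \<in> V" for x
  proof -
    have "x \<in> orbit \<psi> (r x)" using r(3)[OF that] orbV(2)[OF that] by simp
    then have "\<exists>i. (\<psi> ^^ i) (r x) = x"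
      unfolding orbit_altdef mem_Collect_eq by (elim exE conjE) (rule exI, rule sym)
    then show ?thesis unfolding ix_def by (rule someI_ex)
  qed
  define \<sigma> where "\<sigma> x = (if x \<in> V then (\<phi> ^^ ix x) (r x) else x)" for x
  have key: "\<sigma> ((\<psi> ^^ j) y) = (\<phi> ^^ j) y" if "y \<in> V" "r y = y" for y j
  proof -
    let ?x = "(\<psi> ^^ j) y"
    have "?x \<in> orbit \<psi> y" using orbV(2)[OF that(1)] funpow_in_orbit by metis
    then have xV: "?x \<in> V" and ox: "orbit \<psi> ?x = orbit \<psi> y"
      using orbV(1)[OF that(1)] orbit_eq_of_mem[OF p V] by auto
    have rx: "r ?x = y" using ox that(2) by (simp add: r_def)
    have "(\<psi> ^^ ix ?x) y = (\<psi> ^^ j) y" using ix[OF xV] rx by simp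
    then have "ix ?x mod card (orbit \<psi> y) = j mod card (orbit \<psi> y)"
      using funpow_eq_iff_cong orbV(2)[OF that(1)] by metis
    then have "(\<phi> ^^ ix ?x) y = (\<phi> ^^ j) y"
      using funpow_eq_iff_cong[of y \<phi>] orbV(2)[OF that(1)] orb[OF that(1)] by metis
    then show ?thesis using xV rx by (simp add: \<sigma>_def)
  qed
  have comm: "\<sigma> (\<psi> x) = \<phi> (\<sigma> x)" if "x \<in> V" for x
  proof -
    have "\<sigma> ((\<psi> ^^ Suc (ix x)) (r x)) = (\<phi> ^^ Suc (ix x)) (r x)"
      by (rule key[OF r(2)[OF that] r(4)[OF that]])
    then show ?thesis using ix[OF that] that by (simp add: \<sigma>_def)
  qed
  have "V \<subseteq> \<sigma> ` V"
  proof
    fix x assume x: "x \<in> V"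
    have "x \<in> orbit \<phi> (r x)" using r(2,3)[OF x] orb orbV(2)[OF x] by metis
    then obtain i where i: "x = (\<phi> ^^ i) (r x)" by (auto simp: orbit_altdef)
    then have "x = \<sigma> ((\<psi> ^^ i) (r x))" using key[OF r(2)[OF x] r(4)[OF x]] by simp
    moreover have "(\<psi> ^^ i) (r x) \<in> V"
      using funpow_in_orbit[OF orbV(2)[OF r(2)[OF x]]] orbV(1)[OF r(2)[OF x]] by blast
    ultimately show "x \<in> \<sigma> ` V" by blast
  qed
  moreover have "\<sigma> ` V \<subseteq> V"
  proof
    fix y assume "y \<in> \<sigma> ` V"
    then obtain x where x: "x \<in> V" "y = (\<phi> ^^ ix x) (r x)" by (auto simp: \<sigma>_def)
    have "y \<in> orbit \<phi> (r x)"
      unfolding x(2) using orb orbV(2) r(2)[OF x(1)] by (metis funpow_in_orbit)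
    then show "y \<in> V" using permutes_orbit_subset[OF q r(2)[OF x(1)]] by blast
  qed
  ultimately have "\<sigma> ` V = V" by simp
  then have sp: "\<sigma> permutes V"
    using V by (intro bij_imp_permutes) (auto simp: bij_betw_def \<sigma>_def intro: eq_card_imp_inj_on)
  have "\<phi> = \<sigma> \<circ> \<psi> \<circ> inv_into UNIV \<sigma>"
  proof
    fix x
    show "\<phi> x = (\<sigma> \<circ> \<psi> \<circ> inv_into UNIV \<sigma>) x"
    proof (cases "x \<in> V")
      case True
      have "inv_into UNIV \<sigma> x \<in> V" using permutes_in_image[OF permutes_inv[OF sp]] True by blast
      then show ?thesis using comm permutes_inverses(1)[OF sp] by simp
    next
      case False
      then show ?thesis
        using permutes_not_in[OF q] permutes_not_in[OF p] permutes_not_in[OF permutes_inv[OF sp]]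
        by (simp add: \<sigma>_def)
    qed
  qed
  then show ?thesis using sp by blast
qed

lemma orbit_conj:
  assumes "bij \<sigma>"
  shows "orbit (\<sigma> \<circ> \<psi> \<circ> inv_into UNIV \<sigma>) (\<sigma> x) = \<sigma> ` orbit \<psi> x"
proof -
  have pw: "((\<sigma> \<circ> \<psi> \<circ> inv_into UNIV \<sigma>) ^^ n) (\<sigma> x) = \<sigma> ((\<psi> ^^ n) x)" for n
    using bij_is_inj[OF assms] by (induction n) (auto simp: inv_f_f)
  show ?thesis by (auto simp: orbit_altdef pw)
qed

lemma orbits_conj:
  assumes "\<sigma> permutes V"
  shows "orbit (\<sigma> \<circ> \<psi> \<circ> inv_into UNIV \<sigma>) ` V = (`) \<sigma> ` (orbit \<psi> ` V)"
proof -
  have "orbit (\<sigma> \<circ> \<psi> \<circ> inv_into UNIV \<sigma>) ` V = orbit (\<sigma> \<circ> \<psi> \<circ> inv_into UNIV \<sigma>) ` \<sigma> ` V"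
    by (simp only: permutes_image[OF assms])
  also have "\<dots> = (`) \<sigma> ` (orbit \<psi> ` V)"
    by (simp only: image_image orbit_conj[OF permutes_bij[OF assms]])
  finally show ?thesis .
qed

lemma cycle_type_conj:
  assumes "\<sigma> permutes {0..<n}"
  shows "cycle_type n (\<sigma> \<circ> \<psi> \<circ> inv_into UNIV \<sigma>) = cycle_type n \<psi>"
proof -
  have inj: "inj ((`) \<sigma>)" using permutes_inj[OF assms] by (simp add: inj_image_eq_iff inj_def)
  have "image_mset card (mset_set ((`) \<sigma> ` (orbit \<psi> ` {0..<n}))) =
     image_mset card (image_mset ((`) \<sigma>) (mset_set (orbit \<psi> ` {0..<n})))"
    using inj by (simp add: image_mset_mset_set inj_on_subset)
  also have "\<dots> = image_mset card (mset_set (orbit \<psi> ` {0..<n}))"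
    unfolding image_mset.compositionality
    by (intro image_mset_cong) (simp add: card_image permutes_inj_on[OF assms])
  finally show ?thesis unfolding cycle_type_def orbits_conj[OF assms] by simp
qed

lemma card_orbits_conj:
  assumes "\<sigma> permutes V"
  shows "card (orbit (\<sigma> \<circ> \<psi> \<circ> inv_into UNIV \<sigma>) ` V) = card (orbit \<psi> ` V)"
proof -
  have "inj ((`) \<sigma>)" using permutes_inj[OF assms] by (simp add: inj_image_eq_iff inj_def)
  then show ?thesis unfolding orbits_conj[OF assms] by (simp add: card_image inj_on_subset)
qed

lemma class_functions_conj:
  "f \<in> class_functions n \<Longrightarrow> \<sigma> permutes {0..<n} \<Longrightarrow> \<psi> permutes {0..<n} \<Longrightarrow>
    f (\<sigma> \<circ> \<psi> \<circ> inv_into UNIV \<sigma>) = f \<psi>"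
  by (simp add: class_functions_def)

text \<open>
  Linear independence of the power sums. Take \<open>\<psi>0\<close> with the largest number of
  cycles among the permutations where \<open>D\<close> does not vanish, and the content of a
  colouring that gives different colours to different cycles of \<open>\<psi>0\<close>. A
  permutation with at most as many cycles has an invariant colouring of this content only if it
  is conjugate to \<open>\<psi>0\<close>, so the coefficient at this content is a nonzero
  multiple of \<open>D \<psi>0\<close>.
\<close>

lemma class_function_zero_if_frob_ch_zero:
  assumes D: "D \<in> class_functions n"
    and z: "\<And>m. (\<Sum>\<psi> | \<psi> permutes {0..<n}. D \<psi> * psum_sf (cycle_type n \<psi>) m) = 0"
  shows "D \<psi> = 0"
proof (rule ccontr)
  let ?V = "{0..<n}"
  let ?P = "{\<psi>. \<psi> permutes ?V}"
  let ?S = "{\<psi>. \<psi> permutes ?V \<and> D \<psi> \<noteq> 0}"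
  let ?N = "\<lambda>\<psi>. card (orbit \<psi> ` ?V)"
  assume "D \<psi> \<noteq> 0"
  then have "\<psi> \<in> ?S" using D by (auto simp: class_functions_def)
  moreover have fP: "finite ?P" by (simp add: finite_permutations)
  then have fS: "finite ?S" by (rule finite_subset[rotated]) auto
  ultimately have "Max (?N ` ?S) \<in> ?N ` ?S" by (intro Max_in) auto
  then obtain \<psi>0 where "\<psi>0 \<in> ?S" "?N \<psi>0 = Max (?N ` ?S)" by (metis (no_types, lifting) imageE)
  moreover have "?N \<phi> \<le> Max (?N ` ?S)" if "\<phi> \<in> ?S" for \<phi>
    by (rule Max_ge[OF finite_imageI[OF fS] imageI[OF that]])
  ultimately have p0: "\<psi>0 \<in> ?S" "\<And>\<phi>. \<phi> \<in> ?S \<Longrightarrow> ?N \<phi> \<le> ?N \<psi>0" by simp_all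
  have p0p: "\<psi>0 permutes ?V" using p0 by simp
  have fV: "finite ?V" by simp
  \<comment> \<open>distinct cycles of \<open>\<psi>0\<close> get distinct colours\<close>
  define \<kappa>0 where "\<kappa>0 = restrict (\<lambda>x. Min (orbit \<psi>0 x)) ?V"
  define m where "m = profile ?V \<kappa>0"
  have orbMin: "orbit \<psi>0 (\<kappa>0 x) = orbit \<psi>0 x" if "x \<in> ?V" for x
  proof -
    have "Min (orbit \<psi>0 x) \<in> orbit \<psi>0 x"
      using permutes_orbit_subset[OF p0p that] orbit_nonempty fV by (metis Min_in finite_subset)
    then show ?thesis using orbit_eq_of_mem[OF p0p fV] that by (simp add: \<kappa>0_def)
  qed
  have k0: "\<kappa>0 \<in> colourings ?V UNIV \<psi>0"
    using permutes_in_image[OF p0p] orbit_eq_of_mem[OF p0p fV orbit.base]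
    by (auto simp: colourings_def \<kappa>0_def)
  let ?K = "\<lambda>\<psi>. {\<kappa> \<in> colourings ?V UNIV \<psi>. profile ?V \<kappa> = m}"
  have fK: "finite (?K \<phi>)" for \<phi>
  proof -
    have "?K \<phi> \<subseteq> ?V \<rightarrow>\<^sub>E set_mset m"
    proof
      fix \<kappa> assume k: "\<kappa> \<in> ?K \<phi>"
      have "\<kappa> x \<in># profile ?V \<kappa>" if "x \<in> ?V" for x using that by (simp add: profile_def)
      then show "\<kappa> \<in> ?V \<rightarrow>\<^sub>E set_mset m" using k by (auto simp: colourings_def PiE_def)
    qed
    then show ?thesis using finite_PiE[OF fV, of "\<lambda>_. set_mset m"] finite_subset by blast
  qed
  have claim: "D \<phi> = D \<psi>0" if \<phi>: "\<phi> \<in> ?S" and \<kappa>: "\<kappa> \<in> ?K \<phi>" for \<phi> \<kappa>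
  proof -
    have \<phi>p: "\<phi> permutes ?V" using \<phi> by simp
    obtain \<sigma> where s: "\<sigma> permutes ?V" "\<forall>x\<in>?V. \<kappa> x = \<kappa>0 (\<sigma> x)"
      using image_mset_eq_implies_permutes[OF fV, of \<kappa> \<kappa>0] \<kappa> by (auto simp: profile_def m_def)
    define \<phi>' where "\<phi>' = \<sigma> \<circ> \<phi> \<circ> inv_into UNIV \<sigma>"
    have inv_perm: "inv_into UNIV \<sigma> permutes ?V" using permutes_inv[OF s(1)] .
    have \<phi>'p: "\<phi>' permutes ?V" unfolding \<phi>'_def using s \<phi>p inv_perm by (simp add: permutes_compose)
    have k0c: "\<kappa>0 \<in> colourings ?V UNIV \<phi>'"
    proof -
      have "\<kappa>0 (\<phi>' y) = \<kappa>0 y" if y: "y \<in> ?V" for y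
      proof -
        let ?x = "inv_into UNIV \<sigma> y"
        have x: "?x \<in> ?V" "\<sigma> ?x = y" "\<phi> ?x \<in> ?V"
          using permutes_in_image[OF inv_perm] permutes_in_image[OF \<phi>p] y permutes_inverses(1)[OF s(1)] by blast+
        have "\<kappa>0 (\<phi>' y) = \<kappa> (\<phi> ?x)" using s(2) x by (simp add: \<phi>'_def)
        also have "\<dots> = \<kappa> ?x" using \<kappa> x by (simp add: colourings_def)
        also have "\<dots> = \<kappa>0 y" using s(2) x by simp
        finally show ?thesis .
      qed
      then show ?thesis using k0 by (simp add: colourings_def)
    qed
    have sub: "orbit \<phi>' x \<subseteq> orbit \<psi>0 x" if x: "x \<in> ?V" for x
    proof
      fix y assume y: "y \<in> orbit \<phi>' x"
      then have yV: "y \<in> ?V" using permutes_orbit_subset[OF \<phi>'p x] by blast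
      have "\<kappa>0 y = \<kappa>0 x" by (rule orbit_colouring_const[OF \<phi>'p k0c x y])
      then have "orbit \<psi>0 y = orbit \<psi>0 x" using orbMin[OF x] orbMin[OF yV] by simp
      then show "y \<in> orbit \<psi>0 x" using self_in_orbit[OF p0p fV, of y] by simp
    qed
    \<comment> \<open>the cycles of \<open>\<phi>'\<close> refine those of \<open>\<psi>0\<close>; as there are not more of them, they are the same\<close>
    define F where "F Q = orbit \<psi>0 (SOME z. z \<in> Q)" for Q
    have F: "F (orbit \<phi>' x) = orbit \<psi>0 x" if x: "x \<in> ?V" for x
    proof -
      have "(SOME z. z \<in> orbit \<phi>' x) \<in> orbit \<phi>' x" using self_in_orbit[OF \<phi>'p fV, of x] by (rule someI)
      then show ?thesis using sub[OF x] orbit_eq_of_mem[OF p0p fV] by (auto simp: F_def)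
    qed
    have "orbit \<psi>0 ` ?V = F ` (orbit \<phi>' ` ?V)" using F by (simp add: image_image)
    moreover have "card (orbit \<phi>' ` ?V) \<le> card (orbit \<psi>0 ` ?V)"
      using p0(2)[OF \<phi>] card_orbits_conj[OF s(1), of \<phi>] by (simp add: \<phi>'_def)
    ultimately have "card (F ` (orbit \<phi>' ` ?V)) = card (orbit \<phi>' ` ?V)"
      by (metis card_image_le fV finite_imageI le_antisym)
    then have injF: "inj_on F (orbit \<phi>' ` ?V)" by (intro eq_card_imp_inj_on) auto
    have "orbit \<phi>' x = orbit \<psi>0 x" if x: "x \<in> ?V" for x
    proof
      show "orbit \<phi>' x \<subseteq> orbit \<psi>0 x" by (rule sub[OF x])
      show "orbit \<psi>0 x \<subseteq> orbit \<phi>' x"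
      proof
        fix y assume y: "y \<in> orbit \<psi>0 x"
        then have yV: "y \<in> ?V" using permutes_orbit_subset[OF p0p x] by blast
        have "F (orbit \<phi>' y) = F (orbit \<phi>' x)" using F[OF x] F[OF yV] orbit_eq_of_mem[OF p0p fV y] by simp
        then have "orbit \<phi>' y = orbit \<phi>' x" using inj_onD[OF injF] x yV by blast
        then show "y \<in> orbit \<phi>' x" using self_in_orbit[OF \<phi>'p fV, of y] by simp
      qed
    qed
    from same_orbits_conj[OF fV \<phi>'p p0p this] obtain \<rho> where
      "\<rho> permutes ?V" "\<psi>0 = \<rho> \<circ> \<phi>' \<circ> inv_into UNIV \<rho>" by blast
    then have "D \<psi>0 = D \<phi>'" using class_functions_conj[OF D _ \<phi>'p] by simp
    also have "\<dots> = D \<phi>" unfolding \<phi>'_def using class_functions_conj[OF D s(1) \<phi>p] .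
    finally show ?thesis by simp
  qed
  have "D \<phi> * psum_sf (cycle_type n \<phi>) m = D \<psi>0 * of_nat (if D \<phi> = 0 then 0 else card (?K \<phi>))"
    if "\<phi> \<in> ?P" for \<phi>
  proof (cases "D \<phi> = 0 \<or> ?K \<phi> = {}")
    case True
    moreover have "card (?K \<phi>) = 0" if "?K \<phi> = {}" unfolding that by simp
    ultimately show ?thesis using that psum_sf_cycle_type[of \<phi> n] unfolding weight_series_def by fastforce
  next
    case False
    then obtain \<kappa> where "\<kappa> \<in> ?K \<phi>" by blast
    then have "D \<phi> = D \<psi>0" using claim[of \<phi> \<kappa>] that False by blast
    then show ?thesis using that psum_sf_cycle_type[of \<phi> n] False by (simp add: weight_series_def)
  qed
  then have "(\<Sum>\<phi>\<in>?P. D \<phi> * psum_sf (cycle_type n \<phi>) m) =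
    (\<Sum>\<phi>\<in>?P. D \<psi>0 * of_nat (if D \<phi> = 0 then 0 else card (?K \<phi>)))" by (intro sum.cong) auto
  then have "D \<psi>0 * of_nat (\<Sum>\<phi>\<in>?P. if D \<phi> = 0 then 0 else card (?K \<phi>)) = 0"
    using z[of m] by (simp add: sum_distrib_left)
  moreover have "D \<psi>0 \<noteq> 0" using p0(1) by simp
  ultimately have "(\<Sum>\<phi>\<in>?P. if D \<phi> = 0 then 0 else card (?K \<phi>)) = 0"
    unfolding mult_eq_0_iff of_nat_eq_0_iff by blast
  then have "\<forall>\<phi>\<in>?P. (if D \<phi> = 0 then 0 else card (?K \<phi>)) = 0"
    unfolding sum_eq_0_iff[OF fP] .
  then have "card (?K \<psi>0) = 0" using p0(1) by auto
  then show False using fK[of \<psi>0] k0 by (auto simp: m_def)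
qed

lemma frob_ch_inj: "inj_on (frob_ch n) (class_functions n)"
proof (rule inj_onI)
  fix f g assume f: "f \<in> class_functions n" and g: "g \<in> class_functions n" and eq: "frob_ch n f = frob_ch n g"
  let ?D = "\<lambda>\<psi>. f \<psi> - g \<psi>"
  have D: "?D \<in> class_functions n" using f g by (simp add: class_functions_def)
  have "(\<Sum>\<psi> | \<psi> permutes {0..<n}. ?D \<psi> * psum_sf (cycle_type n \<psi>) m) = 0" for m
    using fun_cong[OF eq, of m] by (simp add: frob_ch_def left_diff_distrib sum_subtractf)
  then have "?D \<psi> = 0" for \<psi> by (rule class_function_zero_if_frob_ch_zero[OF D])
  then show "f = g" by (simp add: fun_eq_iff)
qed

text \<open>
  By injectivity the inverse image chosen in \<open>frob_ch_inv\<close> is the expected class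
  function.
\<close>

lemma frob_ch_inv_eqI:
  "f \<in> class_functions n \<Longrightarrow> frob_ch n f = \<tau> \<Longrightarrow> frob_ch_inv n \<tau> = f"
  unfolding frob_ch_inv_def using inv_into_f_f[OF frob_ch_inj] by blast

lemma orbit_eq_on:
  assumes "\<And>y. y \<in> orbit f x \<Longrightarrow> f y = g y" "f x = g x"
  shows "orbit f x = orbit g x"
proof -
  have "(f ^^ Suc n) x = (g ^^ Suc n) x" for n
  proof (induction n)
    case (Suc n)
    have "(f ^^ Suc n) x \<in> orbit f x" unfolding orbit_altdef by blast
    then show ?case using Suc assms(1) by simp
  qed (simp add: assms)
  then show ?thesis unfolding orbit_altdef by (metis Suc_pred)
qed

text \<open>Append one block of length $k$ after the other and rotate it.\<close>

lemma ex_permutation_of_cycle_lengths: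
  "0 \<notin> set ks \<Longrightarrow> \<exists>\<psi>. \<psi> permutes {0..<sum_list ks} \<and>
     image_mset card (mset_set (orbit \<psi> ` {0..<sum_list ks})) = mset ks"
proof (induction ks)
  case Nil
  then show ?case by (auto intro: exI[of _ id] simp: permutes_id)
next
  case (Cons k ks)
  define s where "s = sum_list ks"
  obtain \<psi> where p: "\<psi> permutes {0..<s}" "image_mset card (mset_set (orbit \<psi> ` {0..<s})) = mset ks"
    using Cons by (auto simp: s_def)
  have k: "k > 0" using Cons.prems by simp
  define \<phi> where "\<phi> x = (if s \<le> x \<and> x < s + k then (if Suc x = s + k then s else Suc x) else \<psi> x)" for x
  have psi_s: "\<psi> x < s \<longleftrightarrow> x < s" for x using permutes_in_image[OF p(1), of x] by simp
  have pid: "\<psi> x = x" if "s \<le> x" for x using permutes_not_in[OF p(1)] that by simp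
  have im: "\<phi> ` {0..<s + k} = {0..<s + k}"
  proof -
    have "\<phi> ` {0..<s} = {0..<s}"
    proof -
      have "\<phi> ` {0..<s} = \<psi> ` {0..<s}" by (rule image_cong) (auto simp: \<phi>_def)
      then show ?thesis using permutes_image[OF p(1)] by simp
    qed
    moreover have "\<phi> ` {s..<s + k} = {s..<s + k}"
    proof
      show "\<phi> ` {s..<s + k} \<subseteq> {s..<s + k}" using k by (auto simp: \<phi>_def)
      show "{s..<s + k} \<subseteq> \<phi> ` {s..<s + k}"
      proof
        fix y assume y: "y \<in> {s..<s + k}"
        show "y \<in> \<phi> ` {s..<s + k}"
        proof (cases "y = s")
          case True
          then show ?thesis using k by (intro image_eqI[of _ _ "s + k - 1"]) (auto simp: \<phi>_def)
        next
          case False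
          then show ?thesis using y by (intro image_eqI[of _ _ "y - 1"]) (auto simp: \<phi>_def)
        qed
      qed
    qed
    moreover have "{0..<s + k} = {0..<s} \<union> {s..<s + k}" by auto
    ultimately show ?thesis by (simp add: image_Un)
  qed
  have perm: "\<phi> permutes {0..<s + k}"
  proof (rule bij_imp_permutes)
    show "bij_betw \<phi> {0..<s + k} {0..<s + k}"
      using im by (auto simp: bij_betw_def intro: eq_card_imp_inj_on)
    show "\<And>x. x \<notin> {0..<s + k} \<Longrightarrow> \<phi> x = x" using pid by (auto simp: \<phi>_def)
  qed
  have o1: "orbit \<phi> x = orbit \<psi> x" if "x < s" for x
  proof (rule orbit_eq_on[symmetric])
    show "\<psi> x = \<phi> x" using that by (simp add: \<phi>_def)
    fix y assume "y \<in> orbit \<psi> x"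
    then have "y \<in> {0..<s}" using permutes_orbit_subset[OF p(1)] that by fastforce
    then show "\<psi> y = \<phi> y" by (simp add: \<phi>_def)
  qed
  have os: "orbit \<phi> s = {s..<s + k}"
  proof -
    have step: "\<phi> (s + i) = s + Suc i" if "Suc i < k" for i
      using that by (simp add: \<phi>_def)
    have pw: "(\<phi> ^^ i) s = s + i" if "i < k" for i
      using that by (induction i) (simp_all add: step del: add_Suc_right)
    have "(\<phi> ^^ k) s = s"
    proof -
      obtain j where j: "k = Suc j" using k by (cases k) auto
      have "(\<phi> ^^ k) s = \<phi> (s + j)" using pw[of j] j by simp
      then show ?thesis using j by (simp add: \<phi>_def)
    qed
    then have "orbit \<phi> s = {(\<phi> ^^ i) s | i. i < k}" using k by (rule orbit_altdef_bounded)
    also have "\<dots> = {s + i | i. i < k}" using pw by (metis (no_types, lifting))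
    also have "\<dots> = {s..<s + k}" by (auto simp: le_iff_add)
    finally show ?thesis .
  qed
  have o2: "orbit \<phi> x = {s..<s + k}" if "x \<in> {s..<s + k}" for x
    using orbit_eq_of_mem[OF perm _ that[folded os]] os by simp
  have "orbit \<phi> ` {0..<s + k} = orbit \<phi> ` {0..<s} \<union> orbit \<phi> ` {s..<s + k}"
    by (simp only: image_Un[symmetric] ivl_disj_un_two(3)[OF le0 le_add1])
  also have "orbit \<phi> ` {0..<s} = orbit \<psi> ` {0..<s}" using o1 by (intro image_cong) auto
  also have "orbit \<phi> ` {s..<s + k} = {{s..<s + k}}"
  proof -
    have "s \<in> {s..<s + k}" using k by simp
    then show ?thesis using o2 by blast
  qed
  finally have orbs: "orbit \<phi> ` {0..<s + k} = insert {s..<s + k} (orbit \<psi> ` {0..<s})" by simp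
  have "{s..<s + k} \<notin> orbit \<psi> ` {0..<s}"
  proof
    assume "{s..<s + k} \<in> orbit \<psi> ` {0..<s}"
    then obtain x where "x \<in> {0..<s}" "{s..<s + k} = orbit \<psi> x" by blast
    then have "{s..<s + k} \<subseteq> {0..<s}" using permutes_orbit_subset[OF p(1)] by metis
    then show False using k by auto
  qed
  then have "image_mset card (mset_set (orbit \<phi> ` {0..<s + k})) = mset (k # ks)"
    unfolding orbs using p(2) by simp
  moreover have "sum_list (k # ks) = s + k" by (simp add: s_def)
  ultimately show ?case using perm by metis
qed

lemma ex_permutation_of_cycle_type:
  assumes "is_partition n lam"
  shows "\<exists>\<psi>. \<psi> permutes {0..<n} \<and> cycle_type n \<psi> = lam"
proof -
  obtain \<psi> where p: "\<psi> permutes {0..<n}" "image_mset card (mset_set (orbit \<psi> ` {0..<n})) = mset lam"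
    using ex_permutation_of_cycle_lengths[of lam] assms by (auto simp: is_partition_def)
  have "sorted (rev lam)" using assms by (simp add: is_partition_def sorted_wrt_rev)
  then have "sort lam = rev lam" by (intro properties_for_sort) auto
  then have "cycle_type n \<psi> = lam" unfolding cycle_type_def p(2) by simp
  then show ?thesis using p by blast
qed

text \<open>The indicator of a conjugacy class, scaled by the order of the centralizer.\<close>

definition psum_char :: "nat \<Rightarrow> nat list \<Rightarrow> (nat \<Rightarrow> nat) \<Rightarrow> rat" where
  "psum_char n lam \<psi> = (if \<psi> permutes {0..<n} \<and> cycle_type n \<psi> = lam
     then fact n / of_nat (card {\<psi>. \<psi> permutes {0..<n} \<and> cycle_type n \<psi> = lam}) else 0)"

lemma psum_char_class: "psum_char n lam \<in> class_functions n"
  unfolding class_functions_def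
  by (auto simp: psum_char_def cycle_type_conj permutes_compose permutes_inv)

lemma frob_ch_psum_char:
  assumes "is_partition n lam"
  shows "frob_ch n (psum_char n lam) = psum_sf lam"
proof
  fix m
  let ?P = "{\<psi>. \<psi> permutes {0..<n}}" and ?T = "{\<psi>. \<psi> permutes {0..<n} \<and> cycle_type n \<psi> = lam}"
  have fP: "finite ?P" by (simp add: finite_permutations)
  then have fT: "finite ?T" by (rule finite_subset[rotated]) auto
  have "?T \<noteq> {}" using ex_permutation_of_cycle_type[OF assms] by blast
  then have c: "card ?T \<noteq> 0" using fT by simp
  have "(\<Sum>\<psi>\<in>?P. psum_char n lam \<psi> * psum_sf (cycle_type n \<psi>) m) =
    (\<Sum>\<psi>\<in>?T. fact n / of_nat (card ?T) * psum_sf lam m)"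
    by (rule sum.mono_neutral_cong_right[OF fP]) (auto simp: psum_char_def)
  also have "\<dots> = fact n * psum_sf lam m" using c by simp
  finally show "frob_ch n (psum_char n lam) m = psum_sf lam m" by (simp add: frob_ch_def)
qed

section \<open>Cycle weights of partial functions\<close>

text \<open>
  The permutations each of whose nontrivial cycles is a directed cycle of the partial function
  \<open>g\<close>. Since the directed cycles of \<open>g\<close> are disjoint, these
  permutations correspond to the sets of directed cycles of \<open>g\<close> in
  \<open>V\<close>.
\<close>

definition below :: "'v set \<Rightarrow> ('v \<Rightarrow> 'v option) \<Rightarrow> ('v \<Rightarrow> 'v) set" where
  "below V g = {\<psi>. \<psi> permutes V \<and> (\<forall>x. \<psi> x \<noteq> x \<longrightarrow> g x = Some (\<psi> x))}"

lemma finite_below: "finite V \<Longrightarrow> finite (below V g)"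
  unfolding below_def using finite_permutations by (rule finite_subset[rotated]) auto

text \<open>
  A permutation below \<open>g\<close> that moves a point has to follow \<open>g\<close> through
  the whole cycle of this point.
\<close>

lemma below_agree:
  assumes p: "\<psi> \<in> below V g" and q: "\<phi> \<in> below V g" and x: "\<psi> x \<noteq> x" "\<phi> x \<noteq> x" and y: "y \<in> orbit \<phi> x"
  shows "\<psi> y = \<phi> y" "\<phi> y \<noteq> y"
proof -
  have inj: "\<psi> a = \<psi> b \<longleftrightarrow> a = b" "\<phi> a = \<phi> b \<longleftrightarrow> a = b" for a b
    using p q permutes_inj unfolding below_def by (auto dest: injD)
  have eq: "\<psi> z = \<phi> z" if "\<psi> z \<noteq> z" "\<phi> z \<noteq> z" for z
    using p q that unfolding below_def by force
  from y have "\<psi> y \<noteq> y \<and> \<phi> y \<noteq> y"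
  proof induction
    case base
    show ?case using eq[OF x] inj x by metis
  next
    case (step z)
    then show ?case using eq[of z] inj by metis
  qed
  then show "\<psi> y = \<phi> y" "\<phi> y \<noteq> y" using eq by auto
qed

text \<open>
  Splitting off one directed cycle \<open>\<rho>\<close> of \<open>g\<close>, on the vertex set
  \<open>Z\<close>: it can be used or not, independently of the rest. This is the induction
  scheme for all statements on weights.
\<close>

lemma below_cases:
  assumes V: "finite V"
  obtains "below V g = {id}"
  | Z \<rho> where "Z \<subseteq> V" "Z \<noteq> {}" "cyclic_on \<rho> Z" "\<rho> permutes Z"
      "below V g = below (V - Z) g \<union> (\<lambda>\<psi>. \<rho> \<circ> \<psi>) ` below (V - Z) g"
      "below (V - Z) g \<inter> (\<lambda>\<psi>. \<rho> \<circ> \<psi>) ` below (V - Z) g = {}"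
proof (cases "below V g \<subseteq> {id}")
  case True
  moreover have "id \<in> below V g" by (simp add: below_def permutes_id)
  ultimately show ?thesis using that(1) by blast
next
  case False
  then obtain \<phi> where \<phi>: "\<phi> \<in> below V g" "\<phi> \<noteq> id" by blast
  then obtain x where x: "\<phi> x \<noteq> x" by (auto simp: fun_eq_iff)
  have \<phi>p: "\<phi> permutes V" using \<phi> by (simp add: below_def)
  have xV: "x \<in> V" using x permutes_not_in[OF \<phi>p] by blast
  define Z where "Z = orbit \<phi> x"
  define \<rho> where "\<rho> = perm_restrict \<phi> Z"
  have ZV: "Z \<subseteq> V" unfolding Z_def by (rule permutes_orbit_subset[OF \<phi>p xV])
  have xZ: "x \<in> Z" unfolding Z_def by (rule self_in_orbit[OF \<phi>p V])
  have cyc: "cyclic_on \<phi> Z" unfolding Z_def by (rule cyclic_on_orbit[OF \<phi>p V])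
  have cyc\<rho>: "cyclic_on \<rho> Z" unfolding \<rho>_def using cyc by (simp add: cyclic_on_perm_restrict)
  have \<rho>p: "\<rho> permutes Z"
  proof (rule bij_imp_permutes)
    have "\<phi> ` Z \<subseteq> Z" using cyclic_on_inI[OF cyc] by blast
    moreover have "inj_on \<phi> Z" using permutes_inj_on[OF \<phi>p] .
    ultimately have "\<phi> ` Z = Z" using ZV V by (meson endo_inj_surj finite_subset)
    then have "bij_betw \<phi> Z Z" using \<open>inj_on \<phi> Z\<close> by (simp add: bij_betw_def)
    then show "bij_betw \<rho> Z Z" by (rule bij_betw_cong[THEN iffD1, rotated]) (simp add: \<rho>_def perm_restrict_simps)
    show "\<And>y. y \<notin> Z \<Longrightarrow> \<rho> y = y" by (simp add: \<rho>_def perm_restrict_simps)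
  qed
  have moved: "\<phi> y \<noteq> y" if "y \<in> Z" for y
    using below_agree(2)[OF \<phi>(1) \<phi>(1) x x] that by (simp add: Z_def)
  have id_on_Z: "\<psi> y = y" if "\<psi> \<in> below (V - Z) g" "y \<in> Z" for \<psi> y
    using that permutes_not_in[of \<psi> "V - Z" y] by (auto simp: below_def)
  show ?thesis
  proof (rule that(2)[OF ZV _ cyc\<rho> \<rho>p])
    show "Z \<noteq> {}" using xZ by blast
    show "below V g = below (V - Z) g \<union> (\<lambda>\<psi>. \<rho> \<circ> \<psi>) ` below (V - Z) g" (is "?L = ?R")
    proof
      show "?L \<subseteq> ?R"
      proof
        fix \<psi> assume \<psi>: "\<psi> \<in> ?L"
        have \<psi>p: "\<psi> permutes V" using \<psi> by (simp add: below_def)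
        show "\<psi> \<in> ?R"
        proof (cases "\<psi> x = x")
          case True
          have fixZ: "\<psi> y = y" if y: "y \<in> Z" for y
          proof (rule ccontr)
            assume ny: "\<psi> y \<noteq> y"
            have "x \<in> orbit \<phi> y" using y xZ orbit_eq_of_mem[OF \<phi>p V] unfolding Z_def by blast
            then have "\<psi> x = \<phi> x" by (rule below_agree(1)[OF \<psi> \<phi>(1) ny moved[OF y]])
            then show False using x True by simp
          qed
          have "\<psi> permutes (V - Z)"
            by (rule permutes_superset[OF \<psi>p]) (use fixZ in auto)
          then show ?thesis using \<psi> by (simp add: below_def)
        next
          case False
          have agree: "\<psi> y = \<phi> y" if "y \<in> Z" for y
            using below_agree(1)[OF \<psi> \<phi>(1) False x] that by (simp add: Z_def)
          have cyc\<psi>: "cyclic_on \<psi> Z" using cyc agree by (simp cong: cyclic_cong)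
          let ?\<psi>' = "perm_restrict \<psi> (V - Z)"
          have "?\<psi>' permutes (V - Z)" by (rule perm_restrict_diff_cyclic[OF \<psi>p cyc\<psi>])
          moreover have "g y = Some (?\<psi>' y)" if "?\<psi>' y \<noteq> y" for y
            using \<psi> that by (auto simp: below_def perm_restrict_def split: if_splits)
          ultimately have "?\<psi>' \<in> below (V - Z) g" by (simp add: below_def)
          moreover have "\<psi> = \<rho> \<circ> ?\<psi>'"
          proof
            fix y
            consider "y \<in> Z" | "y \<in> V - Z" | "y \<notin> V" by blast
            then show "\<psi> y = (\<rho> \<circ> ?\<psi>') y"
            proof cases
              case 1
              then show ?thesis using agree by (simp add: perm_restrict_def \<rho>_def)
            next
              case 2
              then have "?\<psi>' y \<in> V - Z" using permutes_in_image[OF \<open>?\<psi>' permutes (V - Z)\<close>] by blast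
              then show ?thesis using 2 by (simp add: perm_restrict_def \<rho>_def)
            next
              case 3
              then show ?thesis using permutes_not_in[OF \<psi>p] ZV by (auto simp: perm_restrict_def \<rho>_def)
            qed
          qed
          ultimately show ?thesis by blast
        qed
      qed
      show "?R \<subseteq> ?L"
      proof
        fix \<psi> assume "\<psi> \<in> ?R"
        then show "\<psi> \<in> ?L"
        proof
          assume "\<psi> \<in> below (V - Z) g"
          then show ?thesis by (auto simp: below_def intro: permutes_subset)
        next
          assume "\<psi> \<in> (\<lambda>\<psi>. \<rho> \<circ> \<psi>) ` below (V - Z) g"
          then obtain \<psi>' where \<psi>': "\<psi> = \<rho> \<circ> \<psi>'" "\<psi>' \<in> below (V - Z) g" by blast
          have p': "\<psi>' permutes (V - Z)" using \<psi>' by (simp add: below_def)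
          have "\<psi> permutes V" unfolding \<psi>'(1)
            using permutes_subset[OF p', of V] permutes_subset[OF \<rho>p ZV] by (simp add: permutes_compose)
          moreover have "g y = Some (\<psi> y)" if "\<psi> y \<noteq> y" for y
          proof (cases "y \<in> Z")
            case True
            then have "\<psi> y = \<phi> y" using id_on_Z[OF \<psi>'(2)] by (simp add: \<psi>'(1) \<rho>_def perm_restrict_def)
            then show ?thesis using \<phi>(1) moved[OF True] by (simp add: below_def)
          next
            case False
            have "\<psi>' y \<notin> Z"
              using permutes_in_image[OF p', of y] permutes_not_in[OF p', of y] False by (cases "y \<in> V - Z") auto
            then have "\<psi> y = \<psi>' y" by (simp add: \<psi>'(1) \<rho>_def perm_restrict_def)
            then show ?thesis using \<psi>'(2) that by (simp add: below_def)
          qed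
          ultimately show ?thesis by (simp add: below_def)
        qed
      qed
    qed
    have "\<rho> \<circ> \<psi> \<notin> below (V - Z) g" if "\<psi> \<in> below (V - Z) g" for \<psi>
    proof
      assume "\<rho> \<circ> \<psi> \<in> below (V - Z) g"
      then have "(\<rho> \<circ> \<psi>) x = x" using id_on_Z xZ by blast
      then show False using id_on_Z[OF that xZ] x xZ by (simp add: \<rho>_def perm_restrict_def)
    qed
    then show "below (V - Z) g \<inter> (\<lambda>\<psi>. \<rho> \<circ> \<psi>) ` below (V - Z) g = {}" by blast
  qed
qed

lemma sum_below_split:
  fixes h :: "('v \<Rightarrow> 'v) \<Rightarrow> rat"
  assumes V: "finite V" and \<rho>: "\<rho> permutes Z"
    and b: "below V g = below (V - Z) g \<union> (\<lambda>\<psi>. \<rho> \<circ> \<psi>) ` below (V - Z) g"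
    and d: "below (V - Z) g \<inter> (\<lambda>\<psi>. \<rho> \<circ> \<psi>) ` below (V - Z) g = {}"
  shows "(\<Sum>\<psi>\<in>below V g. h \<psi>) = (\<Sum>\<psi>\<in>below (V - Z) g. h \<psi> + h (\<rho> \<circ> \<psi>))"
proof -
  have f: "finite (below (V - Z) g)" using V by (simp add: finite_below)
  have inj: "inj_on (\<lambda>\<psi>. \<rho> \<circ> \<psi>) (below (V - Z) g)"
    using permutes_inj[OF \<rho>] by (auto simp: inj_on_def fun_eq_iff dest: injD)
  show ?thesis unfolding b using f d inj
    by (simp add: sum.union_disjoint sum.reindex sum.distrib)
qed

text \<open>
  The sum is the product of $1 + \epsilon(\<rho>)$ over the directed cycles
  \<open>\<rho>\<close>, for the linear character $\epsilon$.
\<close>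

lemma sum_linear_char_below_nonneg:
  assumes "finite V"
  shows "(\<Sum>\<psi>\<in>below V g. linear_char sg \<psi>) \<ge> 0"
  using assms
proof (induction V rule: finite_psubset_induct)
  case (psubset V)
  show ?case
  proof (rule below_cases[OF psubset.hyps, of g])
    assume "below V g = {id}"
    then show ?thesis by (simp add: linear_char_def)
  next
    fix Z \<rho> assume Z: "Z \<subseteq> V" "Z \<noteq> {}" "\<rho> permutes Z"
      "below V g = below (V - Z) g \<union> (\<lambda>\<psi>. \<rho> \<circ> \<psi>) ` below (V - Z) g"
      "below (V - Z) g \<inter> (\<lambda>\<psi>. \<rho> \<circ> \<psi>) ` below (V - Z) g = {}"
    have "linear_char sg (\<rho> \<circ> \<psi>) = linear_char sg \<rho> * linear_char sg \<psi>" if "\<psi> \<in> below (V - Z) g" for \<psi>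
    proof -
      have "permutation \<rho>" "permutation \<psi>"
        using Z(1,3) that psubset.hyps by (auto simp: below_def permutation_permutes intro: finite_subset)
      then show ?thesis by (simp add: linear_char_def sign_compose)
    qed
    then have "(\<Sum>\<psi>\<in>below V g. linear_char sg \<psi>) = (\<Sum>\<psi>\<in>below (V - Z) g. (1 + linear_char sg \<rho>) * linear_char sg \<psi>)"
      unfolding sum_below_split[OF psubset.hyps Z(3-5)]
      by (intro sum.cong) (auto simp: algebra_simps)
    also have "\<dots> = (1 + linear_char sg \<rho>) * (\<Sum>\<psi>\<in>below (V - Z) g. linear_char sg \<psi>)"
      by (simp add: sum_distrib_left)
    also have "\<dots> \<ge> 0"
    proof (rule mult_nonneg_nonneg)
      show "0 \<le> 1 + linear_char sg \<rho>" by (simp add: linear_char_def sign_def)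
      show "0 \<le> (\<Sum>\<psi>\<in>below (V - Z) g. linear_char sg \<psi>)"
        using psubset.IH[of "V - Z"] Z by blast
    qed
    finally show ?thesis .
  qed
qed

definition cycle_weight :: "((nat \<Rightarrow> nat) \<Rightarrow> rat) \<Rightarrow> nat \<Rightarrow> (nat \<Rightarrow> nat option) \<Rightarrow> rat" where
  "cycle_weight f n g = (\<Sum>\<psi>\<in>below {0..<n} g. f \<psi>)"

lemma cycle_weight_nonneg_of_nonneg:
  "(\<And>\<psi>. f \<psi> \<ge> 0) \<Longrightarrow> cycle_weight f n g \<ge> 0"
  by (simp add: cycle_weight_def sum_nonneg)

text \<open>
  For a fixed word, the permutations below \<open>g\<close> that fix the word are those below
  the restriction of \<open>g\<close> to the arcs between equal letters, so the previous lemma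
  applies word by word.
\<close>

lemma cycle_weight_colour_char_nonneg:
  assumes C: "finite C" and \<Phi>: "\<And>M. \<Phi> M \<ge> 0"
  shows "cycle_weight (colour_char sg n C \<Phi>) n g \<ge> 0"
proof -
  let ?V = "{0..<n}"
  let ?B = "below ?V g" and ?W = "?V \<rightarrow>\<^sub>E C"
  have fB: "finite ?B" by (simp add: finite_below)
  have fW: "finite ?W" using C by (intro finite_PiE) auto
  have "cycle_weight (colour_char sg n C \<Phi>) n g =
    (\<Sum>\<psi>\<in>?B. \<Sum>\<kappa> | \<kappa> \<in> ?W \<and> (\<forall>x\<in>?V. \<kappa> (\<psi> x) = \<kappa> x). linear_char sg \<psi> * \<Phi> (profile ?V \<kappa>))"
    unfolding cycle_weight_def
    by (intro sum.cong refl) (simp add: colour_char_def below_def colourings_def sum_distrib_left)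
  also have "\<dots> = (\<Sum>\<kappa>\<in>?W. \<Sum>\<psi> | \<psi> \<in> ?B \<and> (\<forall>x\<in>?V. \<kappa> (\<psi> x) = \<kappa> x). linear_char sg \<psi> * \<Phi> (profile ?V \<kappa>))"
    using fB fW by (rule sum.swap_restrict)
  also have "\<dots> = (\<Sum>\<kappa>\<in>?W. (\<Sum>\<psi> | \<psi> \<in> ?B \<and> (\<forall>x\<in>?V. \<kappa> (\<psi> x) = \<kappa> x). linear_char sg \<psi>) * \<Phi> (profile ?V \<kappa>))"
    by (simp add: sum_distrib_right)
  also have "\<dots> \<ge> 0"
  proof (rule sum_nonneg, rule mult_nonneg_nonneg[OF _ \<Phi>])
    fix \<kappa>
    \<comment> \<open>keep only the arcs between equal letters\<close>
    define g' where "g' x = (case g x of None \<Rightarrow> None | Some y \<Rightarrow> if \<kappa> y = \<kappa> x then Some y else None)" for x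
    have "{\<psi>. \<psi> \<in> ?B \<and> (\<forall>x\<in>?V. \<kappa> (\<psi> x) = \<kappa> x)} = below ?V g'"
    proof (intro equalityI subsetI)
      fix \<psi> assume a: "\<psi> \<in> {\<psi>. \<psi> \<in> ?B \<and> (\<forall>x\<in>?V. \<kappa> (\<psi> x) = \<kappa> x)}"
      then have p: "\<psi> permutes ?V" by (simp add: below_def)
      have "g' x = Some (\<psi> x)" if "\<psi> x \<noteq> x" for x
      proof -
        have "x \<in> ?V" using permutes_not_in[OF p] that by blast
        then show ?thesis using a that by (auto simp: g'_def below_def)
      qed
      then show "\<psi> \<in> below ?V g'" using p by (simp add: below_def)
    next
      fix \<psi> assume a: "\<psi> \<in> below ?V g'"
      have "g x = Some (\<psi> x) \<and> \<kappa> (\<psi> x) = \<kappa> x" if "\<psi> x \<noteq> x" for x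
      proof -
        have "g' x = Some (\<psi> x)" using a that by (simp add: below_def)
        then show ?thesis by (auto simp: g'_def split: option.splits if_splits)
      qed
      then show "\<psi> \<in> {\<psi>. \<psi> \<in> ?B \<and> (\<forall>x\<in>?V. \<kappa> (\<psi> x) = \<kappa> x)}"
        using a by (auto simp: below_def) metis
    qed
    then show "0 \<le> (\<Sum>\<psi> | \<psi> \<in> ?B \<and> (\<forall>x\<in>?V. \<kappa> (\<psi> x) = \<kappa> x). linear_char sg \<psi>)"
      using sum_linear_char_below_nonneg[of ?V sg g'] by simp
  qed
  finally show ?thesis .
qed

section \<open>Positivity of Schur characters on cycle weights\<close>

text \<open>
  Strictly decreasing in the first \<open>N\<close> entries; entries from \<open>N\<close> on
  are never touched.
\<close>

definition strict_desc :: "nat \<Rightarrow> (nat \<Rightarrow> int) \<Rightarrow> bool" where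
  "strict_desc N \<gamma> \<longleftrightarrow> (\<forall>i j. i < j \<and> j < N \<longrightarrow> \<gamma> j < \<gamma> i)"

text \<open>
  Read \<open>c \<gamma>\<close> as the coefficient of $x^\<gamma>$ in an alternating polynomial
  in \<open>N\<close> variables.
\<close>

definition alternating :: "nat \<Rightarrow> ((nat \<Rightarrow> int) \<Rightarrow> rat) \<Rightarrow> bool" where
  "alternating N c \<longleftrightarrow> (\<forall>i j \<gamma>. i < N \<and> j < N \<and> i \<noteq> j \<longrightarrow> c (\<gamma> \<circ> transpose i j) = - c \<gamma>)"

text \<open>
  The polynomials that are nonnegative combinations of the alternants $a_\<gamma>$ with
  \<open>\<gamma>\<close> strictly decreasing. Divided by the Vandermonde determinant they are
  the Schur positive polynomials.
\<close>

definition schur_cone :: "nat \<Rightarrow> ((nat \<Rightarrow> int) \<Rightarrow> rat) \<Rightarrow> bool" where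
  "schur_cone N c \<longleftrightarrow> alternating N c \<and> (\<forall>\<gamma>. strict_desc N \<gamma> \<longrightarrow> c \<gamma> \<ge> 0)"

text \<open>Dividing out the monomial with exponents \<open>M\<close>.\<close>

definition lower :: "(nat \<Rightarrow> int) \<Rightarrow> nat multiset \<Rightarrow> nat \<Rightarrow> int" where
  "lower \<gamma> M = (\<lambda>i. \<gamma> i - int (count M i))"

text \<open>Multiplication by the power sum $p_k$, on the level of coefficients.\<close>

definition psum_op :: "nat \<Rightarrow> nat \<Rightarrow> ((nat \<Rightarrow> int) \<Rightarrow> rat) \<Rightarrow> (nat \<Rightarrow> int) \<Rightarrow> rat" where
  "psum_op N k c \<gamma> = (\<Sum>i<N. c (\<gamma>(i := \<gamma> i - int k)))"

lemma lower_add: "lower \<gamma> (A + B) = lower (lower \<gamma> A) B"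
  by (auto simp: lower_def)

lemma lower_replicate: "lower \<gamma> (replicate_mset k i) = \<gamma>(i := \<gamma> i - int k)"
  by (auto simp: lower_def)

lemma alternating_eq0:
  assumes "alternating N c" "i < N" "j < N" "i \<noteq> j" "\<gamma> i = \<gamma> j"
  shows "c \<gamma> = 0"
proof -
  have "\<gamma> \<circ> transpose i j = \<gamma>" using assms(5) by (auto simp: transpose_def)
  then have "c \<gamma> = - c \<gamma>" using assms unfolding alternating_def by metis
  then show ?thesis by simp
qed

lemma alternating_permutes:
  assumes "alternating N c" "\<pi> permutes {..<N}"
  shows "\<bar>c (\<gamma> \<circ> \<pi>)\<bar> = \<bar>c \<gamma>\<bar>"
  using assms(2) finite_lessThan[of N]
proof (induction \<pi> arbitrary: \<gamma> rule: permutes_induct)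
  case id
  then show ?case by simp
next
  case (swap a b p)
  have "c (\<gamma> \<circ> transpose a b) = - c \<gamma> \<or> a = b"
    using assms(1) swap unfolding alternating_def by auto
  then have "\<bar>c (\<gamma> \<circ> transpose a b)\<bar> = \<bar>c \<gamma>\<bar>" by auto
  then show ?case using swap.IH[of "\<gamma> \<circ> transpose a b"] by (simp only: comp_assoc)
qed

lemma alternating_psum_op:
  assumes "alternating N c"
  shows "alternating N (psum_op N k c)"
  unfolding alternating_def
proof (intro allI impI)
  fix i j \<gamma> assume ij: "i < N \<and> j < N \<and> i \<noteq> j"
  let ?t = "transpose i j"
  have upd: "(\<gamma> \<circ> ?t)(l := (\<gamma> \<circ> ?t) l - int k) = (\<gamma>(?t l := \<gamma> (?t l) - int k)) \<circ> ?t" for l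
    by (rule ext) (auto simp: transpose_eq_iff)
  have "psum_op N k c (\<gamma> \<circ> ?t) = (\<Sum>l<N. - c (\<gamma>(?t l := \<gamma> (?t l) - int k)))"
    unfolding psum_op_def upd using assms ij by (simp add: alternating_def)
  also have "\<dots> = (\<Sum>l<N. - c (\<gamma>(l := \<gamma> l - int k)))"
    using ij by (intro sum.reindex_bij_betw permutes_imp_bij permutes_swap_id) auto
  finally show "psum_op N k c (\<gamma> \<circ> ?t) = - psum_op N k c \<gamma>" by (simp add: psum_op_def sum_negf)
qed

text \<open>
  Lowering one entry by one can only destroy strictness by making it equal to the next entry,
  where alternating functions vanish. Hence $p_1$ preserves the cone.
\<close>

lemma strict_desc_decr:
  assumes "strict_desc N \<gamma>" "i < N" "\<not> strict_desc N (\<gamma>(i := \<gamma> i - 1))"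
  shows "Suc i < N \<and> \<gamma> (Suc i) = \<gamma> i - 1"
proof -
  obtain a b where ab: "a < b" "b < N" "(\<gamma>(i := \<gamma> i - 1)) a \<le> (\<gamma>(i := \<gamma> i - 1)) b"
    using assms(3) by (auto simp: strict_desc_def not_less)
  have d: "\<gamma> b < \<gamma> a" using assms(1) ab by (auto simp: strict_desc_def)
  have "a = i" using ab d by (auto split: if_splits)
  then have eq: "\<gamma> b = \<gamma> i - 1" using ab d by (auto split: if_splits)
  have "b = Suc i"
  proof (rule ccontr)
    assume "b \<noteq> Suc i"
    then have "Suc i < b" using ab \<open>a = i\<close> by simp
    then have "\<gamma> b < \<gamma> (Suc i)" "\<gamma> (Suc i) < \<gamma> i" using assms(1) ab by (auto simp: strict_desc_def)
    then show False using eq by simp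
  qed
  then show ?thesis using ab eq by simp
qed

lemma schur_cone_decr_nonneg:
  assumes c: "schur_cone N c" and \<gamma>: "strict_desc N \<gamma>" and i: "i < N"
  shows "c (\<gamma>(i := \<gamma> i - 1)) \<ge> 0"
proof (cases "strict_desc N (\<gamma>(i := \<gamma> i - 1))")
  case True
  then show ?thesis using c by (simp add: schur_cone_def)
next
  case False
  then have "Suc i < N \<and> \<gamma> (Suc i) = \<gamma> i - 1" using strict_desc_decr \<gamma> i by blast
  then have "c (\<gamma>(i := \<gamma> i - 1)) = 0"
    using c i by (intro alternating_eq0[of N c i "Suc i"]) (auto simp: schur_cone_def)
  then show ?thesis by simp
qed

lemma schur_cone_psum_op_1:
  assumes "schur_cone N c" shows "schur_cone N (psum_op N 1 c)"
  unfolding schur_cone_def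
proof (intro conjI allI impI)
  show "alternating N (psum_op N 1 c)" using assms alternating_psum_op by (simp add: schur_cone_def)
  fix \<gamma> assume "strict_desc N \<gamma>"
  then show "0 \<le> psum_op N 1 c \<gamma>"
    using schur_cone_decr_nonneg[OF assms] by (auto simp: psum_op_def intro!: sum_nonneg)
qed

lemma schur_cone_psum_op_1_pow:
  "schur_cone N c \<Longrightarrow> schur_cone N ((psum_op N 1 ^^ k) c)"
  by (induction k) (auto intro: schur_cone_psum_op_1[simplified])

text \<open>
  Every strict vector \<open>\<delta>\<close> below \<open>\<gamma>\<close> contributes to the
  $k$-th power of $p_1$: starting from \<open>\<gamma>\<close>, lower the last entry that is
  still too large. This stays strict, because the following entry has already its final value.
\<close>

lemma psum_op_1_pow_ge:
  assumes c: "schur_cone N c"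
  shows "strict_desc N \<gamma> \<Longrightarrow> finite U \<Longrightarrow>
    (\<And>\<delta>. \<delta> \<in> U \<Longrightarrow> strict_desc N \<delta> \<and> (\<forall>i<N. \<delta> i \<le> \<gamma> i) \<and> (\<forall>i\<ge>N. \<delta> i = \<gamma> i) \<and>
       (\<Sum>i<N. \<gamma> i - \<delta> i) = int k) \<Longrightarrow>
    (\<Sum>\<delta>\<in>U. c \<delta>) \<le> (psum_op N 1 ^^ k) c \<gamma>"
proof (induction k arbitrary: \<gamma> U)
  case 0
  have "\<delta> = \<gamma>" if "\<delta> \<in> U" for \<delta>
  proof
    fix i
    have "\<forall>i\<in>{..<N}. \<gamma> i - \<delta> i = 0"
      using 0(3)[OF that] by (subst sum_nonneg_eq_0_iff[symmetric]) auto
    then show "\<delta> i = \<gamma> i" using 0(3)[OF that] by (cases "i < N") auto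
  qed
  then have "U \<subseteq> {\<gamma>}" by blast
  then consider "U = {}" | "U = {\<gamma>}" by blast
  then show ?case using c 0(1) by cases (auto simp: schur_cone_def)
next
  case (Suc k)
  let ?d = "\<lambda>i. \<gamma>(i := \<gamma> i - 1)"
  let ?c = "(psum_op N 1 ^^ k) c"
  have ex: "\<exists>i<N. strict_desc N (?d i) \<and> \<delta> i < \<gamma> i" if d: "\<delta> \<in> U" for \<delta>
  proof -
    have D: "strict_desc N \<delta>" "\<forall>i<N. \<delta> i \<le> \<gamma> i" "(\<Sum>i<N. \<gamma> i - \<delta> i) = int (Suc k)"
      using Suc.prems(3)[OF d] by auto
    \<comment> \<open>the last entry that is too large\<close>
    let ?I = "{i. i < N \<and> \<delta> i < \<gamma> i}"
    have "?I \<noteq> {}"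
    proof
      assume "?I = {}"
      then have "\<forall>i\<in>{..<N}. \<gamma> i - \<delta> i = 0" using D(2) by force
      then have "(\<Sum>i<N. \<gamma> i - \<delta> i) = 0" by (rule sum.neutral)
      then show False using D(3) by simp
    qed
    then have m: "Max ?I \<in> ?I" by (intro Max_in) auto
    define i where "i = Max ?I"
    have i: "i < N" "\<delta> i < \<gamma> i" using m by (auto simp: i_def)
    have "strict_desc N (?d i)"
    proof (rule ccontr)
      assume "\<not> strict_desc N (?d i)"
      then have S: "Suc i < N" "\<gamma> (Suc i) = \<gamma> i - 1" using strict_desc_decr Suc.prems(1) i by blast+
      have "Suc i \<notin> ?I"
      proof
        assume "Suc i \<in> ?I"
        then have "Suc i \<le> i" unfolding i_def by (intro Max_ge) auto
        then show False by simp
      qed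
      then have "\<delta> (Suc i) = \<gamma> (Suc i)" using D(2) S by force
      moreover have "\<delta> (Suc i) < \<delta> i" using D(1) S by (simp add: strict_desc_def)
      ultimately show False using S i by simp
    qed
    then show ?thesis using i by blast
  qed
  define ix where "ix \<delta> = (SOME i. i < N \<and> strict_desc N (?d i) \<and> \<delta> i < \<gamma> i)" for \<delta>
  have ix: "ix \<delta> < N" "strict_desc N (?d (ix \<delta>))" "\<delta> (ix \<delta>) < \<gamma> (ix \<delta>)" if "\<delta> \<in> U" for \<delta>
    using someI_ex[OF ex[OF that, folded conj_assoc]] ex[OF that]
    unfolding ix_def by (metis (mono_tags, lifting) someI_ex)+
  have "(\<Sum>\<delta>\<in>U. c \<delta>) = (\<Sum>i<N. \<Sum>\<delta> | \<delta> \<in> U \<and> ix \<delta> = i. c \<delta>)"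
    using Suc.prems(2) ix by (intro sum.group[symmetric]) auto
  also have "\<dots> \<le> (\<Sum>i<N. ?c (?d i))"
  proof (rule sum_mono)
    fix i assume i: "i \<in> {..<N}"
    let ?U = "{\<delta>. \<delta> \<in> U \<and> ix \<delta> = i}"
    show "(\<Sum>\<delta>\<in>?U. c \<delta>) \<le> ?c (?d i)"
    proof (cases "?U = {}")
      case True
      have "?c (?d i) \<ge> 0"
        using schur_cone_decr_nonneg[OF schur_cone_psum_op_1_pow[OF c] Suc.prems(1)] i by simp
      then show ?thesis unfolding True by simp
    next
      case False
      then have sd: "strict_desc N (?d i)" using ix by blast
      show ?thesis
      proof (rule Suc.IH[OF sd])
        show "finite ?U" using Suc.prems(2) by simp
        fix \<delta> assume d: "\<delta> \<in> ?U"
        then have D: "strict_desc N \<delta>" "\<forall>i<N. \<delta> i \<le> \<gamma> i" "\<forall>i\<ge>N. \<delta> i = \<gamma> i"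
            "(\<Sum>i<N. \<gamma> i - \<delta> i) = int (Suc k)" "\<delta> i < \<gamma> i"
          using Suc.prems(3)[of \<delta>] ix(3)[of \<delta>] by auto
        have "(\<Sum>j<N. ?d i j - \<delta> j) = (\<Sum>j<N. (\<gamma> j - \<delta> j) - (if j = i then 1 else 0))"
          by (rule sum.cong) auto
        also have "\<dots> = int k" using i D(4) by (simp add: sum_subtractf)
        finally show "strict_desc N \<delta> \<and> (\<forall>j<N. \<delta> j \<le> ?d i j) \<and> (\<forall>j\<ge>N. \<delta> j = ?d i j) \<and>
            (\<Sum>j<N. ?d i j - \<delta> j) = int k"
          using D i by auto
      qed
    qed
  qed
  also have "\<dots> = (psum_op N 1 ^^ Suc k) c \<gamma>" by (simp add: psum_op_def)
  finally show ?case .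
qed

lemma ex_sorting_permutation:
  fixes \<gamma> :: "nat \<Rightarrow> int"
  assumes "inj_on \<gamma> {..<N}"
  shows "\<exists>\<pi>. \<pi> permutes {..<N} \<and> strict_desc N (\<gamma> \<circ> \<pi>)"
proof -
  define xs where "xs = rev (sorted_list_of_set (\<gamma> ` {..<N}))"
  have len: "length xs = N" using assms by (simp add: xs_def card_image)
  have sd: "sorted_wrt (>) xs"
    unfolding xs_def sorted_wrt_rev using strict_sorted_list_of_set by auto
  have "image_mset (\<lambda>i. xs ! i) (mset_set {..<N}) = mset xs"
    using len by (metis map_nth mset_map mset_set_upto_eq_mset_upto)
  also have "\<dots> = image_mset \<gamma> (mset_set {..<N})"
    using assms mset_set_set[of "sorted_list_of_set (\<gamma> ` {..<N})"]
    by (simp add: xs_def image_mset_mset_set)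
  finally obtain \<pi> where \<pi>: "\<pi> permutes {..<N}" "\<forall>i\<in>{..<N}. xs ! i = \<gamma> (\<pi> i)"
    using image_mset_eq_implies_permutes[of "{..<N}" "\<lambda>i. xs ! i" \<gamma>] by auto
  have "strict_desc N (\<gamma> \<circ> \<pi>)"
    using sd \<pi>(2) len unfolding strict_desc_def sorted_wrt_iff_nth_less
    by (metis comp_apply lessThan_iff less_trans)
  then show ?thesis using \<pi> by blast
qed

text \<open>
  Lowering entries and sorting again lowers the sorted vector: the entry at position
  \<open>k\<close> is at most some entry that comes from a position not before \<open>k\<close>.
\<close>

lemma sorted_dominated:
  assumes \<gamma>: "strict_desc N \<gamma>" and le: "\<forall>i<N. \<delta> i \<le> \<gamma> i"
    and \<pi>: "\<pi> permutes {..<N}" and sd: "strict_desc N (\<delta> \<circ> \<pi>)" and k: "k < N"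
  shows "(\<delta> \<circ> \<pi>) k \<le> \<gamma> k"
proof -
  have "\<exists>l\<le>k. k \<le> \<pi> l"
  proof (rule ccontr)
    assume "\<not> ?thesis"
    then have "\<pi> ` {..k} \<subseteq> {..<k}" by (auto simp: not_le) (meson not_le)
    then have "card (\<pi> ` {..k}) \<le> card {..<k}" by (intro card_mono) auto
    then show False by (simp add: card_image permutes_inj_on[OF \<pi>])
  qed
  then obtain l where l: "l \<le> k" "k \<le> \<pi> l" by blast
  have pl: "\<pi> l < N" using permutes_in_image[OF \<pi>, of l] l k by simp
  have "(\<delta> \<circ> \<pi>) k \<le> (\<delta> \<circ> \<pi>) l" using sd l k unfolding strict_desc_def by (cases "l = k") (force simp: order_le_less)+
  also have "\<dots> \<le> \<gamma> (\<pi> l)" using le pl by simp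
  also have "\<dots> \<le> \<gamma> k" using \<gamma> l pl unfolding strict_desc_def by (cases "\<pi> l = k") (force simp: order_le_less)+
  finally show ?thesis .
qed

text \<open>
  The heart of the positivity for Schur functions. The operator $p_k$ lowers one entry of
  \<open>\<gamma>\<close> by $k$; the result vanishes or becomes, up to sign, the value at a
  sorted vector. Different entries give different sorted vectors, and each of them is also
  counted by $p_1^k$, so that a negative sign is compensated.
\<close>

lemma schur_cone_psum_op_combined:
  assumes c: "schur_cone N c" and k: "k > 0"
  shows "schur_cone N (\<lambda>\<gamma>. (psum_op N 1 ^^ k) c \<gamma> + psum_op N k c \<gamma>)"
  unfolding schur_cone_def
proof (intro conjI allI impI)
  have "alternating N ((psum_op N 1 ^^ k) c)" "alternating N (psum_op N k c)"
    using schur_cone_psum_op_1_pow[OF c] alternating_psum_op c by (auto simp: schur_cone_def)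
  then show "alternating N (\<lambda>\<gamma>. (psum_op N 1 ^^ k) c \<gamma> + psum_op N k c \<gamma>)"
    by (simp add: alternating_def)
  fix \<gamma> assume \<gamma>: "strict_desc N \<gamma>"
  have alt: "alternating N c" using c by (simp add: schur_cone_def)
  have \<gamma>inj: "\<gamma> i \<noteq> \<gamma> j" if "i < N" "j < N" "i \<noteq> j" for i j
    using \<gamma> that unfolding strict_desc_def by (metis linorder_neqE_nat order_less_irrefl)
  let ?d = "\<lambda>j. \<gamma>(j := \<gamma> j - int k)"
  define J where "J = {j. j < N \<and> inj_on (?d j) {..<N}}"
  define \<pi> where "\<pi> j = (SOME p. p permutes {..<N} \<and> strict_desc N (?d j \<circ> p))" for j
  have \<pi>: "\<pi> j permutes {..<N}" "strict_desc N (?d j \<circ> \<pi> j)" if "j \<in> J" for j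
    using someI_ex[OF ex_sorting_permutation[of "?d j" N]] that by (auto simp: \<pi>_def J_def)
  have J: "finite J" "J \<subseteq> {..<N}" by (auto simp: J_def)
  have injU: "inj_on (\<lambda>j. ?d j \<circ> \<pi> j) J"
  proof (rule inj_onI, rule ccontr)
    fix i j assume ij: "i \<in> J" "j \<in> J" "?d i \<circ> \<pi> i = ?d j \<circ> \<pi> j" "i \<noteq> j"
    have "?d l ` {..<N} = (?d l \<circ> \<pi> l) ` {..<N}" if "l \<in> J" for l
      using permutes_image[OF \<pi>(1)[OF that]] by (metis image_comp)
    then have "?d i ` {..<N} = ?d j ` {..<N}" using ij by metis
    moreover have "\<gamma> j \<in> ?d i ` {..<N}" using ij J by (intro image_eqI[of _ _ j]) auto
    ultimately obtain l where "l < N" "\<gamma> j = ?d j l" by auto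
    then show False using \<gamma>inj[of j l] ij J k by (auto split: if_splits)
  qed
  have "(\<Sum>\<delta>\<in>(\<lambda>j. ?d j \<circ> \<pi> j) ` J. c \<delta>) \<le> (psum_op N 1 ^^ k) c \<gamma>"
  proof (rule psum_op_1_pow_ge[OF c \<gamma>])
    show "finite ((\<lambda>j. ?d j \<circ> \<pi> j) ` J)" using J by simp
    fix \<delta> assume "\<delta> \<in> (\<lambda>j. ?d j \<circ> \<pi> j) ` J"
    then obtain j where j: "j \<in> J" "\<delta> = ?d j \<circ> \<pi> j" by blast
    have "\<delta> i \<le> \<gamma> i" if "i < N" for i
      unfolding j(2) by (rule sorted_dominated[OF \<gamma> _ \<pi>[OF j(1)] that]) auto
    moreover have "\<delta> i = \<gamma> i" if "i \<ge> N" for i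
      using permutes_not_in[OF \<pi>(1)[OF j(1)], of i] that j J by auto
    moreover have "(\<Sum>i<N. \<gamma> i - \<delta> i) = int k"
    proof -
      have "(\<Sum>i<N. \<delta> i) = (\<Sum>i<N. ?d j i)"
        unfolding j(2) o_def by (rule sum.reindex_bij_betw[OF permutes_imp_bij[OF \<pi>(1)[OF j(1)]]])
      also have "\<dots> = (\<Sum>i<N. \<gamma> i - (if i = j then int k else 0))" by (rule sum.cong) auto
      also have "\<dots> = (\<Sum>i<N. \<gamma> i) - int k" using j J by (auto simp: sum_subtractf)
      finally show ?thesis by (simp add: sum_subtractf)
    qed
    ultimately show "strict_desc N \<delta> \<and> (\<forall>i<N. \<delta> i \<le> \<gamma> i) \<and> (\<forall>i\<ge>N. \<delta> i = \<gamma> i) \<and> (\<Sum>i<N. \<gamma> i - \<delta> i) = int k"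
      using \<pi>(2)[OF j(1)] j(2) by simp
  qed
  then have 1: "(\<Sum>j\<in>J. c (?d j \<circ> \<pi> j)) \<le> (psum_op N 1 ^^ k) c \<gamma>"
    by (simp add: sum.reindex[OF injU])
  have "psum_op N k c \<gamma> = (\<Sum>j\<in>J. c (?d j))"
    unfolding psum_op_def
  proof (rule sum.mono_neutral_right)
    show "\<forall>j\<in>{..<N} - J. c (?d j) = 0"
    proof
      fix j assume "j \<in> {..<N} - J"
      then obtain a b where "a < N" "b < N" "a \<noteq> b" "?d j a = ?d j b" by (auto simp: J_def inj_on_def)
      then show "c (?d j) = 0" using alternating_eq0[OF alt] by blast
    qed
  qed (use J in auto)
  moreover have "(\<Sum>j\<in>J. c (?d j)) \<ge> (\<Sum>j\<in>J. - c (?d j \<circ> \<pi> j))"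
  proof (rule sum_mono)
    fix j assume j: "j \<in> J"
    have "c (?d j \<circ> \<pi> j) \<ge> 0" using c \<pi>(2)[OF j] by (simp add: schur_cone_def)
    then show "- c (?d j \<circ> \<pi> j) \<le> c (?d j)"
      using alternating_permutes[OF alt \<pi>(1)[OF j], of "?d j"] by linarith
  qed
  ultimately show "0 \<le> (psum_op N 1 ^^ k) c \<gamma> + psum_op N k c \<gamma>" using 1 by (simp add: sum_negf)
qed

text \<open>
  Here \<open>\<rho>\<close> and \<open>\<psi>\<close> live on disjoint vertex sets, so an
  invariant colouring of the union is a pair of invariant colourings.
\<close>

lemma colourings_disjoint_union:
  assumes Z: "\<rho> permutes Z" and V: "\<psi> permutes V" and d: "Z \<inter> V = {}" and f: "finite Z" "finite V"
  shows "bij_betw (\<lambda>\<kappa>. (restrict \<kappa> Z, restrict \<kappa> V)) (colourings (Z \<union> V) C (\<rho> \<circ> \<psi>))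
    (colourings Z C \<rho> \<times> colourings V C \<psi>)"
    and "profile (Z \<union> V) \<kappa> = profile Z (restrict \<kappa> Z) + profile V (restrict \<kappa> V)"
proof -
  have memZ: "\<rho> x \<in> Z \<longleftrightarrow> x \<in> Z" and memV: "\<psi> x \<in> V \<longleftrightarrow> x \<in> V" for x
    using permutes_in_image[OF Z] permutes_in_image[OF V] by blast+
  have eqZ: "(\<rho> \<circ> \<psi>) x = \<rho> x" if "x \<in> Z" for x
  proof -
    have "x \<notin> V" using d that by blast
    then show ?thesis using permutes_not_in[OF V] by simp
  qed
  have eqV: "(\<rho> \<circ> \<psi>) x = \<psi> x" if "x \<in> V" for x
    using permutes_not_in[OF Z, of "\<psi> x"] d that memV by auto
  show "bij_betw (\<lambda>\<kappa>. (restrict \<kappa> Z, restrict \<kappa> V)) (colourings (Z \<union> V) C (\<rho> \<circ> \<psi>))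
    (colourings Z C \<rho> \<times> colourings V C \<psi>)"
  proof (rule bij_betwI[where g = "\<lambda>(\<kappa>, \<kappa>'). \<lambda>x. if x \<in> Z then \<kappa> x else \<kappa>' x"])
    show "(\<lambda>\<kappa>. (restrict \<kappa> Z, restrict \<kappa> V)) \<in> colourings (Z \<union> V) C (\<rho> \<circ> \<psi>) \<rightarrow> colourings Z C \<rho> \<times> colourings V C \<psi>"
    proof
      fix \<kappa> assume k: "\<kappa> \<in> colourings (Z \<union> V) C (\<rho> \<circ> \<psi>)"
      then have a: "\<And>x. x \<in> Z \<union> V \<Longrightarrow> \<kappa> x \<in> C" "\<And>x. x \<in> Z \<union> V \<Longrightarrow> \<kappa> ((\<rho> \<circ> \<psi>) x) = \<kappa> x"
        unfolding colourings_def by blast+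
      have "\<kappa> (\<rho> x) = \<kappa> x" if "x \<in> Z" for x using a(2)[of x] eqZ that by simp
      moreover have "\<kappa> (\<psi> x) = \<kappa> x" if "x \<in> V" for x using a(2)[of x] eqV that by simp
      ultimately show "(restrict \<kappa> Z, restrict \<kappa> V) \<in> colourings Z C \<rho> \<times> colourings V C \<psi>"
        using a(1) memZ memV by (auto simp: colourings_def)
    qed
    show "(\<lambda>(\<kappa>, \<kappa>'). \<lambda>x. if x \<in> Z then \<kappa> x else \<kappa>' x) \<in> colourings Z C \<rho> \<times> colourings V C \<psi> \<rightarrow> colourings (Z \<union> V) C (\<rho> \<circ> \<psi>)"
    proof (clarify)
      fix \<kappa> \<kappa>' assume k: "\<kappa> \<in> colourings Z C \<rho>" "\<kappa>' \<in> colourings V C \<psi>"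
      let ?k = "\<lambda>x. if x \<in> Z then \<kappa> x else \<kappa>' x"
      have "?k \<in> (Z \<union> V) \<rightarrow>\<^sub>E C" using k by (auto simp: colourings_def PiE_def extensional_def)
      moreover have "?k ((\<rho> \<circ> \<psi>) x) = ?k x" if "x \<in> Z \<union> V" for x
      proof (cases "x \<in> Z")
        case True
        then show ?thesis unfolding eqZ[OF True] using k memZ by (simp add: colourings_def)
      next
        case False
        then have xV: "x \<in> V" using that by blast
        then have "\<psi> x \<notin> Z" using memV d by blast
        then show ?thesis unfolding eqV[OF xV] using k xV False by (simp add: colourings_def)
      qed
      ultimately show "?k \<in> colourings (Z \<union> V) C (\<rho> \<circ> \<psi>)" unfolding colourings_def by blast
    qed
    fix \<kappa> assume "\<kappa> \<in> colourings (Z \<union> V) C (\<rho> \<circ> \<psi>)"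
    then have "\<kappa> \<in> extensional (Z \<union> V)" by (auto simp: colourings_def PiE_def)
    then show "(case (restrict \<kappa> Z, restrict \<kappa> V) of (\<kappa>, \<kappa>') \<Rightarrow> \<lambda>x. if x \<in> Z then \<kappa> x else \<kappa>' x) = \<kappa>"
      by (auto simp: extensional_def)
  next
    fix q assume q: "q \<in> colourings Z C \<rho> \<times> colourings V C \<psi>"
    obtain \<kappa> \<kappa>' where qq: "q = (\<kappa>, \<kappa>')" by (cases q)
    have "\<kappa> \<in> extensional Z" "\<kappa>' \<in> extensional V" using q qq by (auto simp: colourings_def PiE_def)
    moreover have "x \<in> V \<Longrightarrow> x \<notin> Z" for x using d by blast
    ultimately show "(\<lambda>\<kappa>. (restrict \<kappa> Z, restrict \<kappa> V)) (case q of (\<kappa>, \<kappa>') \<Rightarrow> \<lambda>x. if x \<in> Z then \<kappa> x else \<kappa>' x) = q"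
      unfolding qq by (auto simp: fun_eq_iff extensional_def restrict_def)
  qed
  have "image_mset (restrict \<kappa> Z) (mset_set Z) = image_mset \<kappa> (mset_set Z)"
    "image_mset (restrict \<kappa> V) (mset_set V) = image_mset \<kappa> (mset_set V)"
    using f by (auto intro!: image_mset_cong)
  then show "profile (Z \<union> V) \<kappa> = profile Z (restrict \<kappa> Z) + profile V (restrict \<kappa> V)"
    using f d by (simp add: profile_def mset_set_Union)
qed

text \<open>
  For fixed \<open>\<psi>\<close> this is multiplication by the power sum of its cycle type.
\<close>

definition colour_sum :: "nat \<Rightarrow> 'v set \<Rightarrow> ('v \<Rightarrow> 'v) \<Rightarrow> ((nat \<Rightarrow> int) \<Rightarrow> rat) \<Rightarrow> (nat \<Rightarrow> int) \<Rightarrow> rat" where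
  "colour_sum N V \<psi> c \<gamma> = (\<Sum>\<kappa>\<in>colourings V {..<N} \<psi>. c (lower \<gamma> (profile V \<kappa>)))"

lemma colour_sum_disjoint_union:
  assumes Z: "\<rho> permutes Z" and V: "\<psi> permutes V" and d: "Z \<inter> V = {}" and f: "finite Z" "finite V"
  shows "colour_sum N (Z \<union> V) (\<rho> \<circ> \<psi>) c = colour_sum N Z \<rho> (colour_sum N V \<psi> c)"
proof
  fix \<gamma>
  have "colour_sum N (Z \<union> V) (\<rho> \<circ> \<psi>) c \<gamma> =
    (\<Sum>q\<in>colourings Z {..<N} \<rho> \<times> colourings V {..<N} \<psi>. c (lower (lower \<gamma> (profile Z (fst q))) (profile V (snd q))))"
    unfolding colour_sum_def
    by (subst sum.reindex_bij_betw[OF colourings_disjoint_union(1)[OF assms], symmetric])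
      (simp add: colourings_disjoint_union(2)[OF assms] lower_add)
  also have "\<dots> = colour_sum N Z \<rho> (colour_sum N V \<psi> c) \<gamma>"
    unfolding colour_sum_def by (simp add: sum.cartesian_product case_prod_unfold)
  finally show "colour_sum N (Z \<union> V) (\<rho> \<circ> \<psi>) c \<gamma> = colour_sum N Z \<rho> (colour_sum N V \<psi> c) \<gamma>" .
qed

lemma colour_sum_cyclic:
  assumes cyc: "cyclic_on \<rho> Z" and Z: "\<rho> permutes Z" "finite Z"
  shows "colour_sum N Z \<rho> c = psum_op N (card Z) c"
proof
  fix \<gamma>
  obtain z where z: "z \<in> Z" "Z = orbit \<rho> z" using cyc by (auto simp: cyclic_on_def)
  have bij: "bij_betw (\<lambda>i. restrict (\<lambda>_. i) Z) {..<N} (colourings Z {..<N} \<rho>)"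
  proof (rule bij_betwI[where g = "\<lambda>\<kappa>. \<kappa> z"])
    show "(\<lambda>i. restrict (\<lambda>_. i) Z) \<in> {..<N} \<rightarrow> colourings Z {..<N} \<rho>"
      using permutes_in_image[OF Z(1)] by (auto simp: colourings_def)
    show "(\<lambda>\<kappa>. \<kappa> z) \<in> colourings Z {..<N} \<rho> \<rightarrow> {..<N}"
      using z(1) by (auto simp: colourings_def)
    show "\<And>i. restrict (\<lambda>_. i) Z z = i" using z by simp
    fix \<kappa> assume k: "\<kappa> \<in> colourings Z {..<N} \<rho>"
    have "\<kappa> x = \<kappa> z" if "x \<in> Z" for x
      using orbit_colouring_const[OF Z(1) k z(1)] that z(2) by blast
    moreover have "\<kappa> \<in> extensional Z" using k by (auto simp: colourings_def PiE_def)
    ultimately show "restrict (\<lambda>_. \<kappa> z) Z = \<kappa>" by (auto simp: extensional_def)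
  qed
  have prof: "profile Z (restrict (\<lambda>_. i) Z) = replicate_mset (card Z) i" for i :: nat
    unfolding profile_def using Z(2) by (intro image_mset_const) auto
  show "colour_sum N Z \<rho> c \<gamma> = psum_op N (card Z) c \<gamma>"
    unfolding colour_sum_def psum_op_def
    by (subst sum.reindex_bij_betw[OF bij, symmetric]) (simp add: prof lower_replicate)
qed

lemma colour_sum_id:
  "finite V \<Longrightarrow> colour_sum N V id c = (psum_op N 1 ^^ card V) c"
proof (induction V rule: finite_induct)
  case empty
  show ?case by (rule ext) (simp add: colour_sum_def colourings_def profile_def lower_def)
next
  case (insert v V)
  have "colour_sum N ({v} \<union> V) (id \<circ> id) c = colour_sum N {v} id (colour_sum N V id c)"
    using insert by (intro colour_sum_disjoint_union) (auto simp: permutes_id)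
  also have "\<dots> = psum_op N (card {v}) (colour_sum N V id c)"
    by (rule colour_sum_cyclic) (auto simp: permutes_id cyclic_on_def orbit_eq_singleton_iff[THEN iffD2])
  finally show ?case using insert by (simp add: id_def o_def)
qed

text \<open>
  By induction over the directed cycles of \<open>g\<close>: a cycle on $k$ vertices multiplies
  by $p_1^k + p_k$, depending on whether the permutation uses it.
\<close>

lemma schur_cone_sum_below:
  assumes "finite V" "schur_cone N c"
  shows "schur_cone N (\<lambda>\<gamma>. \<Sum>\<psi>\<in>below V g. colour_sum N V \<psi> c \<gamma>)"
  using assms(1)
proof (induction V rule: finite_psubset_induct)
  case (psubset V)
  show ?case
  proof (rule below_cases[OF psubset.hyps, of g])
    assume "below V g = {id}"
    then show ?thesis
      using schur_cone_psum_op_1_pow[OF assms(2)] colour_sum_id[OF psubset.hyps, of N c]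
      by (simp add: id_def)
  next
    fix Z \<rho> assume Z: "Z \<subseteq> V" "Z \<noteq> {}" "cyclic_on \<rho> Z" "\<rho> permutes Z"
      "below V g = below (V - Z) g \<union> (\<lambda>\<psi>. \<rho> \<circ> \<psi>) ` below (V - Z) g"
      "below (V - Z) g \<inter> (\<lambda>\<psi>. \<rho> \<circ> \<psi>) ` below (V - Z) g = {}"
    let ?F = "\<lambda>\<gamma>. \<Sum>\<psi>\<in>below (V - Z) g. colour_sum N (V - Z) \<psi> c \<gamma>"
    have fin: "finite Z" "finite (V - Z)" using finite_subset[OF Z(1)] psubset.hyps by auto
    have VZ: "Z \<union> (V - Z) = V" using Z by blast
    have F: "schur_cone N ?F" using psubset.IH[of "V - Z"] Z by blast
    have lin: "colour_sum N Z \<phi> ?F \<gamma> = (\<Sum>\<psi>\<in>below (V - Z) g. colour_sum N Z \<phi> (colour_sum N (V - Z) \<psi> c) \<gamma>)" for \<phi> \<gamma>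
      unfolding colour_sum_def by (rule sum.swap)
    have "(\<Sum>\<psi>\<in>below V g. colour_sum N V \<psi> c \<gamma>) = (psum_op N 1 ^^ card Z) ?F \<gamma> + psum_op N (card Z) ?F \<gamma>" for \<gamma>
    proof -
      have "(\<Sum>\<psi>\<in>below V g. colour_sum N V \<psi> c \<gamma>) =
        (\<Sum>\<psi>\<in>below (V - Z) g. colour_sum N V \<psi> c \<gamma> + colour_sum N V (\<rho> \<circ> \<psi>) c \<gamma>)"
        by (rule sum_below_split[OF psubset.hyps Z(4-6)])
      also have "\<dots> = (\<Sum>\<psi>\<in>below (V - Z) g. colour_sum N Z id (colour_sum N (V - Z) \<psi> c) \<gamma> +
          colour_sum N Z \<rho> (colour_sum N (V - Z) \<psi> c) \<gamma>)"
      proof (rule sum.cong[OF refl])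
        fix \<psi> assume "\<psi> \<in> below (V - Z) g"
        then have p: "\<psi> permutes (V - Z)" by (simp add: below_def)
        show "colour_sum N V \<psi> c \<gamma> + colour_sum N V (\<rho> \<circ> \<psi>) c \<gamma> =
          colour_sum N Z id (colour_sum N (V - Z) \<psi> c) \<gamma> + colour_sum N Z \<rho> (colour_sum N (V - Z) \<psi> c) \<gamma>"
          using colour_sum_disjoint_union[OF permutes_id p _ fin, of N c]
            colour_sum_disjoint_union[OF Z(4) p _ fin, of N c] unfolding VZ id_comp by (metis Diff_disjoint)
      qed
      also have "\<dots> = colour_sum N Z id ?F \<gamma> + colour_sum N Z \<rho> ?F \<gamma>" by (simp add: sum.distrib lin)
      finally show ?thesis using colour_sum_id[OF fin(1), of N ?F] colour_sum_cyclic[OF Z(3,4) fin(1), of N ?F] by simp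
    qed
    moreover have "card Z > 0" using fin(1) Z(2) by (simp add: card_gt_0_iff)
    ultimately show ?thesis using schur_cone_psum_op_combined[OF F] by presburger
  qed
qed

lemma cycle_weight_schur_nonneg:
  assumes "schur_cone N c" "strict_desc N \<gamma>"
  shows "cycle_weight (colour_char False n {..<N} (\<lambda>M. c (lower \<gamma> M))) n g \<ge> 0"
proof -
  have "cycle_weight (colour_char False n {..<N} (\<lambda>M. c (lower \<gamma> M))) n g =
    (\<Sum>\<psi>\<in>below {0..<n} g. colour_sum N {0..<n} \<psi> c \<gamma>)"
    unfolding cycle_weight_def
    by (intro sum.cong refl) (simp add: colour_char_def below_def linear_char_def colour_sum_def)
  then show ?thesis using schur_cone_sum_below[of "{0..<n}" N c g] assms by (simp add: schur_cone_def)
qed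

section \<open>Elementary and complete homogeneous functions\<close>

lemma image_mset_sum_family:
  "finite I \<Longrightarrow> image_mset f (\<Sum>i\<in>I. A i) = (\<Sum>i\<in>I. image_mset f (A i))"
  by (induction I rule: finite_induct) auto

text \<open>
  The matrix whose rows are the given multisets; entry $(i, a)$ is the multiplicity of $a$ in
  the row $i$.
\<close>

definition assemble :: "nat multiset list \<Rightarrow> (nat \<times> nat) multiset" where
  "assemble Ms = (\<Sum>i<length Ms. image_mset (Pair i) (Ms ! i))"

lemma count_image_Pair: "count (image_mset (Pair i) A) (j, a) = (if i = j then count A a else 0)"
  by (induction A) auto

lemma count_assemble: "count (assemble Ms) (i, a) = (if i < length Ms then count (Ms ! i) a else 0)"
  by (simp add: assemble_def count_sum count_image_Pair)

lemma fst_assemble: "count (image_mset fst (assemble Ms)) i = (if i < length Ms then size (Ms ! i) else 0)"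
proof -
  have "image_mset fst (assemble Ms) = (\<Sum>i<length Ms. replicate_mset (size (Ms ! i)) i)"
    unfolding assemble_def
    by (simp add: image_mset_sum_family image_mset.compositionality o_def image_mset_const_eq)
  then show ?thesis by (simp add: count_sum)
qed

lemma snd_assemble: "image_mset snd (assemble Ms) = sum_list Ms"
proof -
  have "image_mset snd (assemble Ms) = (\<Sum>i<length Ms. Ms ! i)"
    unfolding assemble_def by (simp add: image_mset_sum_family image_mset.compositionality o_def)
  then show ?thesis by (simp add: sum_list_sum_nth atLeast0LessThan)
qed

lemma count_row: "count (image_mset snd (filter_mset (\<lambda>p. fst p = i) M)) a = count M (i, a)"
  by (induction M) auto

text \<open>
  Both sides are matrices with row sums \<open>lam\<close> and column sums \<open>m\<close>,
  with entries 0 and 1 only if the sign is present: on the left they are given by rows.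
\<close>

lemma bij_assemble:
  assumes lam: "length lam = N" "sum_list lam = n"
  shows "bij_betw assemble {Ms. list_all2 (\<lambda>k a. size a = k \<and> admissible sg a) lam Ms \<and> sum_list Ms = m}
    {M. set_mset M \<subseteq> {..<N} \<times> set_mset m \<and> size M = n \<and> admissible sg M \<and> image_mset snd M = m \<and>
      (\<forall>i<N. count (image_mset fst M) i = lam ! i)}" (is "bij_betw _ ?S ?T")
  unfolding bij_betw_def
proof
  show "inj_on assemble ?S"
  proof (rule inj_onI)
    fix Ms Ns assume a: "Ms \<in> ?S" "Ns \<in> ?S" "assemble Ms = assemble Ns"
    have len: "length Ms = N" "length Ns = N" using a lam by (auto dest: list_all2_lengthD)
    show "Ms = Ns"
    proof (rule nth_equalityI)
      show "length Ms = length Ns" using len by simp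
      fix i assume "i < length Ms"
      then show "Ms ! i = Ns ! i"
        using count_assemble[of Ms i] count_assemble[of Ns i] a(3) len by (intro multiset_eqI) simp
    qed
  qed
  show "assemble ` ?S = ?T"
  proof
    show "assemble ` ?S \<subseteq> ?T"
    proof
      fix M assume "M \<in> assemble ` ?S"
      then obtain Ms where Ms: "M = assemble Ms" "list_all2 (\<lambda>k a. size a = k \<and> admissible sg a) lam Ms" "sum_list Ms = m"
        by blast
      have len: "length Ms = N" using Ms lam by (auto dest: list_all2_lengthD)
      have nth: "size (Ms ! i) = lam ! i" "admissible sg (Ms ! i)" if "i < N" for i
        using Ms(2) that lam by (auto simp: list_all2_conv_all_nth)
      have snd: "image_mset snd M = m" using Ms by (simp add: snd_assemble)
      have "p \<in> {..<N} \<times> set_mset m" if "p \<in># M" for p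
      proof -
        obtain i a where p: "p = (i, a)" by (cases p)
        have "count M (i, a) > 0" using that p by simp
        then have "i < N" using len by (auto simp: Ms(1) count_assemble split: if_splits)
        moreover have "a \<in># image_mset snd M" using that p by force
        ultimately show ?thesis using p snd by simp
      qed
      moreover have cnt: "\<forall>i<N. count (image_mset fst M) i = lam ! i"
        using nth len by (simp add: Ms(1) fst_assemble)
      moreover have "size M = n"
      proof -
        have "size M = size (sum_list Ms)" using snd Ms(3) by (metis size_image_mset)
        also have "\<dots> = (\<Sum>i<N. size (Ms ! i))"
          by (simp add: sum_list_sum_nth len atLeast0LessThan size_multiset_sum)
        also have "\<dots> = sum_list lam" using nth lam by (simp add: sum_list_sum_nth atLeast0LessThan)
        finally show ?thesis using lam by simp
      qed
      moreover have "admissible sg M"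
      proof -
        have "count M p \<le> 1" if sg for p
          using nth(2) that len by (cases p) (auto simp: Ms(1) count_assemble admissible_def)
        then show ?thesis by (auto simp: admissible_def)
      qed
      ultimately show "M \<in> ?T" using snd by blast
    qed
    show "?T \<subseteq> assemble ` ?S"
    proof
      fix M assume M: "M \<in> ?T"
      define Ms where "Ms = map (\<lambda>i. image_mset snd (filter_mset (\<lambda>p. fst p = i) M)) [0..<N]"
      have asm: "assemble Ms = M"
      proof (rule multiset_eqI)
        fix p :: "nat \<times> nat"
        obtain i a where p: "p = (i, a)" by (cases p)
        have "count M (i, a) = 0" if "\<not> i < N" using M that by (auto simp: count_eq_zero_iff)
        then show "count (assemble Ms) p = count M p"
          by (simp add: p count_assemble Ms_def count_row)
      qed
      have "Ms \<in> ?S"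
      proof (intro CollectI conjI)
        show "sum_list Ms = m" using snd_assemble[of Ms] asm M by simp
        show "list_all2 (\<lambda>k a. size a = k \<and> admissible sg a) lam Ms"
          unfolding list_all2_conv_all_nth
        proof (intro conjI allI impI)
          show "length lam = length Ms" using lam by (simp add: Ms_def)
          fix i assume i: "i < length lam"
          have "count (image_mset fst M) i = size (Ms ! i)"
            using fst_assemble[of Ms i] asm i lam by (simp add: Ms_def)
          then show "size (Ms ! i) = lam ! i" using M i lam by simp
          show "admissible sg (Ms ! i)"
            using M i lam by (auto simp: admissible_def Ms_def count_row)
        qed
      qed
      then show "M \<in> assemble ` ?S" using asm by blast
    qed
  qed
qed

text \<open>
  The permutation character on words of content \<open>lam\<close>, twisted by the sign if
  \<open>sg\<close> holds.
\<close>

definition content_char :: "bool \<Rightarrow> nat \<Rightarrow> nat list \<Rightarrow> (nat \<Rightarrow> nat) \<Rightarrow> rat" where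
  "content_char sg n lam = colour_char sg n {..<length lam}
     (\<lambda>M. if \<forall>i<length lam. count M i = lam ! i then 1 else 0)"

lemma frob_ch_content_char:
  assumes "sum_list lam = n"
  shows "frob_ch n (content_char sg n lam) =
    sf_prod_list (map (\<lambda>k. weight_series {a. size a = k \<and> admissible sg a} (\<lambda>a. a)) lam)"
proof
  fix m :: "nat multiset"
  let ?N = "length lam"
  let ?T = "{M. set_mset M \<subseteq> {..<?N} \<times> set_mset m \<and> size M = n \<and> admissible sg M \<and> image_mset snd M = m}"
  let ?S = "{Ms. list_all2 (\<lambda>k a. size a = k \<and> admissible sg a) lam Ms}"
  have fT: "finite ?T"
    by (rule finite_subset[OF _ finite_msets[of "{..<?N} \<times> set_mset m" n]]) auto
  have "frob_ch n (content_char sg n lam) m = (\<Sum>M\<in>?T. if \<forall>i<?N. count (image_mset fst M) i = lam ! i then 1 else 0)"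
    unfolding content_char_def by (rule frob_ch_colour_char) simp
  also have "\<dots> = of_nat (card {M. M \<in> ?T \<and> (\<forall>i<?N. count (image_mset fst M) i = lam ! i)})"
    using fT by (simp add: sum.If_cases Int_def)
  also have "{M. M \<in> ?T \<and> (\<forall>i<?N. count (image_mset fst M) i = lam ! i)} =
    {M. set_mset M \<subseteq> {..<?N} \<times> set_mset m \<and> size M = n \<and> admissible sg M \<and> image_mset snd M = m \<and>
      (\<forall>i<?N. count (image_mset fst M) i = lam ! i)}" by auto
  also have "card \<dots> = card {Ms. list_all2 (\<lambda>k a. size a = k \<and> admissible sg a) lam Ms \<and> sum_list Ms = m}"
    using bij_betw_same_card[OF bij_assemble[OF refl assms, of sg m]] by simp
  also have "{Ms. list_all2 (\<lambda>k a. size a = k \<and> admissible sg a) lam Ms \<and> sum_list Ms = m} =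
    {Ms \<in> ?S. sum_list (map2 (\<lambda>_ a. a) lam Ms) = m}"
  proof -
    have "map2 (\<lambda>_ a. a) lam Ms = Ms" if "length lam = length Ms" for Ms :: "nat multiset list"
      using that by (induction lam Ms rule: list_induct2) auto
    then show ?thesis by (auto dest: list_all2_lengthD)
  qed
  also have "of_nat (card \<dots>) = weight_series ?S (\<lambda>xs. sum_list (map2 (\<lambda>_ a. a) lam xs)) m"
    by (simp add: weight_series_def)
  also have "weight_series ?S (\<lambda>xs. sum_list (map2 (\<lambda>_ a. a) lam xs)) =
    sf_prod_list (map (\<lambda>k. weight_series {a. size a = k \<and> admissible sg a} (\<lambda>a. a)) lam)"
    using sf_prod_list_weight_series(1)[of lam "\<lambda>k. {a. size a = k \<and> admissible sg a}" "\<lambda>_ a. a"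
        "\<lambda>k. weight_series {a. size a = k \<and> admissible sg a} (\<lambda>a. a)"] by simp
  finally show "frob_ch n (content_char sg n lam) m =
    sf_prod_list (map (\<lambda>k. weight_series {a. size a = k \<and> admissible sg a} (\<lambda>a. a)) lam) m" .
qed

lemma weight_series_id: "weight_series X (\<lambda>a. a) m = (if m \<in> X then 1 else 0)"
proof -
  have "{x \<in> X. x = m} = (if m \<in> X then {m} else {})" by auto
  then show ?thesis by (simp add: weight_series_def)
qed

lemma homog_weight_series: "homog k = weight_series {a. size a = k \<and> admissible False a} (\<lambda>a. a)"
  by (auto simp: fun_eq_iff homog_def weight_series_id admissible_def)

lemma elem_weight_series: "elem k = weight_series {a. size a = k \<and> admissible True a} (\<lambda>a. a)"
  by (auto simp: fun_eq_iff elem_def weight_series_id admissible_def)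

lemma frob_ch_homog: "sum_list lam = n \<Longrightarrow> frob_ch n (content_char False n lam) = homog_sf lam"
  by (simp add: frob_ch_content_char homog_sf_def homog_weight_series[abs_def])

lemma frob_ch_elem: "sum_list lam = n \<Longrightarrow> frob_ch n (content_char True n lam) = elem_sf lam"
  by (simp add: frob_ch_content_char elem_sf_def elem_weight_series[abs_def])

lemma cycle_weight_content_char_nonneg: "cycle_weight (content_char sg n lam) n g \<ge> 0"
  unfolding content_char_def by (rule cycle_weight_colour_char_nonneg) auto

section \<open>Alternating functions and the Pieri rule\<close>

text \<open>The coefficients of the alternant of $\delta = (N - 1, \dots, 1, 0)$.\<close>

definition vandermonde_coeff :: "nat \<Rightarrow> (nat \<Rightarrow> int) \<Rightarrow> rat" where
  "vandermonde_coeff N \<gamma> =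
     (\<Sum>\<pi> | \<pi> permutes {..<N}. if \<forall>i<N. \<gamma> i = int N - 1 - int (\<pi> i) then of_int (sign \<pi>) else 0)"

lemma vandermonde_coeff_alternating: "alternating N (vandermonde_coeff N)"
  unfolding alternating_def
proof (intro allI impI)
  fix i j \<gamma> assume ij: "i < N \<and> j < N \<and> i \<noteq> j"
  let ?t = "transpose i j"
  let ?P = "{\<pi>. \<pi> permutes {..<N}}"
  let ?g = "\<lambda>\<gamma> \<pi>. if \<forall>i<N. \<gamma> i = int N - 1 - int (\<pi> i) then of_int (sign \<pi>) else (0 :: rat)"
  have tp: "?t permutes {..<N}" using ij by (simp add: permutes_swap_id)
  have bij: "bij_betw (\<lambda>\<pi>. \<pi> \<circ> ?t) ?P ?P"
  proof (rule bij_betwI[where g = "\<lambda>\<pi>. \<pi> \<circ> ?t"])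
    show "(\<lambda>\<pi>. \<pi> \<circ> ?t) \<in> ?P \<rightarrow> ?P" using tp by (auto intro: permutes_compose)
    then show "(\<lambda>\<pi>. \<pi> \<circ> ?t) \<in> ?P \<rightarrow> ?P" .
  qed (auto simp: fun_eq_iff)
  have "?g (\<gamma> \<circ> ?t) (\<pi> \<circ> ?t) = - ?g \<gamma> \<pi>" if "\<pi> \<in> ?P" for \<pi>
  proof -
    have "permutation \<pi>" using that by (auto simp: permutation_permutes)
    then have s: "sign (\<pi> \<circ> ?t) = - sign \<pi>" using ij by (simp add: sign_compose permutation_swap_id sign_swap_id)
    have mem: "?t l < N \<longleftrightarrow> l < N" for l using permutes_in_image[OF tp, of l] by simp
    have "(\<forall>l<N. (\<gamma> \<circ> ?t) l = int N - 1 - int ((\<pi> \<circ> ?t) l)) \<longleftrightarrow> (\<forall>l<N. \<gamma> l = int N - 1 - int (\<pi> l))"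
      using mem by (metis comp_apply transpose_involutory)
    then show ?thesis using s by simp
  qed
  then have eq: "(\<Sum>\<pi>\<in>?P. ?g (\<gamma> \<circ> ?t) (\<pi> \<circ> ?t)) = (\<Sum>\<pi>\<in>?P. - ?g \<gamma> \<pi>)"
    by (intro sum.cong) auto
  have "vandermonde_coeff N (\<gamma> \<circ> ?t) = (\<Sum>\<pi>\<in>?P. ?g (\<gamma> \<circ> ?t) (\<pi> \<circ> ?t))"
    unfolding vandermonde_coeff_def by (rule sum.reindex_bij_betw[OF bij, symmetric])
  also have "\<dots> = - vandermonde_coeff N \<gamma>"
    unfolding eq vandermonde_coeff_def by (rule sum_negf)
  finally show "vandermonde_coeff N (\<gamma> \<circ> ?t) = - vandermonde_coeff N \<gamma>" .
qed

lemma strict_permutes_id: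
  assumes \<pi>: "\<pi> permutes {..<N}" and mono: "\<And>i j. i < j \<Longrightarrow> j < N \<Longrightarrow> \<pi> i < (\<pi> j :: nat)"
  shows "\<pi> = id"
proof (rule permutes_natset_ge[OF \<pi>], rule ballI)
  fix i assume "i \<in> {..<N}"
  then have "i < N" by simp
  then show "i \<le> \<pi> i"
  proof (induction i)
    case (Suc i)
    then show ?case using mono[of i "Suc i"] by simp
  qed simp
qed

lemma vandermonde_coeff_strict:
  assumes "strict_desc N \<gamma>"
  shows "vandermonde_coeff N \<gamma> = (if \<forall>i<N. \<gamma> i = int N - 1 - int i then 1 else 0)"
proof -
  let ?g = "\<lambda>\<pi>. if \<forall>i<N. \<gamma> i = int N - 1 - int (\<pi> i) then of_int (sign \<pi>) else (0 :: rat)"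
  have "?g \<pi> = 0" if "\<pi> \<in> {\<pi>. \<pi> permutes {..<N}} - {id}" for \<pi>
  proof (rule ccontr)
    assume "?g \<pi> \<noteq> 0"
    then have g: "\<forall>i<N. \<gamma> i = int N - 1 - int (\<pi> i)" by argo
    have "\<pi> i < \<pi> j" if ij: "i < j" "j < N" for i j
    proof -
      have "\<gamma> j < \<gamma> i" using assms ij by (simp add: strict_desc_def)
      then show ?thesis using g ij by simp
    qed
    then have "\<pi> = id" using that by (intro strict_permutes_id) auto
    then show False using that by simp
  qed
  then have "vandermonde_coeff N \<gamma> = (\<Sum>\<pi>\<in>{id}. ?g \<pi>)"
    unfolding vandermonde_coeff_def
    by (intro sum.mono_neutral_right finite_permutations) (auto simp: permutes_id)
  then show ?thesis by simp
qed

lemma schur_cone_vandermonde_coeff: "schur_cone N (vandermonde_coeff N)"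
  by (simp add: schur_cone_def vandermonde_coeff_alternating vandermonde_coeff_strict)

lemma vandermonde_coeff_negative: "i < N \<Longrightarrow> \<gamma> i < 0 \<Longrightarrow> vandermonde_coeff N \<gamma> = 0"
  unfolding vandermonde_coeff_def
proof (rule sum.neutral, rule ballI)
  fix \<pi> assume i: "i < N" "\<gamma> i < 0" and "\<pi> \<in> {\<pi>. \<pi> permutes {..<N}}"
  then have "\<pi> i < N" using permutes_in_image[of \<pi> "{..<N}" i] by simp
  then have "\<gamma> i \<noteq> int N - 1 - int (\<pi> i)" using i by linarith
  then show "(if \<forall>i<N. \<gamma> i = int N - 1 - int (\<pi> i) then of_int (sign \<pi>) else (0 :: rat)) = 0" using i by auto
qed

text \<open>
  Multiplication by $h_k$. Call \<open>t\<close> bad at \<open>i\<close> if the lowered entry at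
  \<open>i\<close> does not exceed the old entry at \<open>Suc i\<close>. Exchanging the lowered
  entries at \<open>i\<close> and \<open>Suc i\<close>, for the least bad \<open>i\<close>, is
  an involution on the bad vectors that changes the sign; so only the horizontal strips remain.
\<close>

lemma pieri:
  assumes alt: "alternating N c" and \<gamma>: "strict_desc N \<gamma>"
  shows "(\<Sum>t | set_mset t \<subseteq> {..<N} \<and> size t = k. c (lower \<gamma> t)) =
    (\<Sum>t | set_mset t \<subseteq> {..<N} \<and> size t = k \<and> (\<forall>i. Suc i < N \<longrightarrow> \<gamma> (Suc i) < lower \<gamma> t i). c (lower \<gamma> t))"
proof -
  let ?A = "{t. set_mset t \<subseteq> {..<N} \<and> size t = k}"
  let ?bad = "\<lambda>t i. Suc i < N \<and> lower \<gamma> t i \<le> \<gamma> (Suc i)"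
  let ?B = "{t. set_mset t \<subseteq> {..<N} \<and> size t = k \<and> (\<exists>i. ?bad t i)}"
  let ?G = "{t. set_mset t \<subseteq> {..<N} \<and> size t = k \<and> (\<forall>i. Suc i < N \<longrightarrow> \<gamma> (Suc i) < lower \<gamma> t i)}"
  have fA: "finite ?A" by (rule finite_msets) simp
  define ix where "ix t = (LEAST i. ?bad t i)" for t
  define d where "d i = nat (\<gamma> i - \<gamma> (Suc i))" for i
  define swp where "swp t = filter_mset (\<lambda>x. x \<noteq> ix t \<and> x \<noteq> Suc (ix t)) t +
    replicate_mset (d (ix t) + count t (Suc (ix t))) (ix t) +
    replicate_mset (count t (ix t) - d (ix t)) (Suc (ix t))" for t
  have I: "swp t \<in> ?B" "lower \<gamma> (swp t) = lower \<gamma> t \<circ> transpose (ix t) (Suc (ix t))" "ix (swp t) = ix t"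
    "Suc (ix t) < N" if t: "t \<in> ?B" for t
  proof -
    define i where "i = ix t"
    have bad: "?bad t i" unfolding i_def ix_def by (rule LeastI_ex) (use t in blast)
    then show S: "Suc (ix t) < N" by (simp add: i_def)
    have "\<gamma> (Suc i) < \<gamma> i" using \<gamma> bad unfolding strict_desc_def by blast
    then have di: "int (d i) = \<gamma> i - \<gamma> (Suc i)" by (simp add: d_def)
    have le: "d i \<le> count t i" using bad di by (simp add: lower_def)
    have cnt: "count (swp t) x = (if x = i then d i + count t (Suc i) else if x = Suc i then count t i - d i else count t x)" for x
      by (simp add: swp_def i_def)
    show low: "lower \<gamma> (swp t) = lower \<gamma> t \<circ> transpose (ix t) (Suc (ix t))"
      unfolding i_def[symmetric] using di le
      by (auto simp: lower_def cnt transpose_def of_nat_diff fun_eq_iff)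
    have t_eq: "t = filter_mset (\<lambda>x. x \<noteq> i \<and> x \<noteq> Suc i) t + replicate_mset (count t i) i + replicate_mset (count t (Suc i)) (Suc i)"
      by (rule multiset_eqI) auto
    have "size (swp t) = size (filter_mset (\<lambda>x. x \<noteq> i \<and> x \<noteq> Suc i) t) + (d i + count t (Suc i)) + (count t i - d i)"
      by (simp add: swp_def i_def)
    also have "\<dots> = size t" using le arg_cong[OF t_eq, of size] by simp
    finally have sz: "size (swp t) = k" using t by simp
    have low_lt: "lower \<gamma> (swp t) l = lower \<gamma> t l" if "l < i" for l
      using that low by (simp add: i_def)
    have low_i: "lower \<gamma> (swp t) i = lower \<gamma> t (Suc i)" using low by (simp add: i_def)
    have "lower \<gamma> t (Suc i) \<le> \<gamma> (Suc i)" by (simp add: lower_def)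
    then have bad': "?bad (swp t) i" using bad low_i by simp
    have "set_mset (swp t) \<subseteq> {..<N}" using t bad by (auto simp: swp_def i_def split: if_splits)
    then show "swp t \<in> ?B" using sz bad' by blast
    have "ix (swp t) = i" unfolding ix_def
    proof (rule Least_equality[where P = "?bad (swp t)", OF bad'])
      fix l assume l: "?bad (swp t) l"
      show "i \<le> l"
      proof (rule ccontr)
        assume "\<not> i \<le> l"
        then have "?bad t l" using l low_lt by simp
        moreover have "\<not> ?bad t l" using \<open>\<not> i \<le> l\<close> not_less_Least[of l "?bad t"] by (simp add: i_def ix_def)
        ultimately show False by blast
      qed
    qed
    then show "ix (swp t) = ix t" by (simp add: i_def)
  qed
  have invol: "swp (swp t) = t" if t: "t \<in> ?B" for t
  proof -
    have "lower \<gamma> (swp (swp t)) = lower \<gamma> (swp t) \<circ> transpose (ix t) (Suc (ix t))"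
      using I(2)[OF I(1)[OF t]] I(3)[OF t] by simp
    also have "\<dots> = lower \<gamma> t" unfolding I(2)[OF t] by (simp add: fun_eq_iff)
    finally show ?thesis by (intro multiset_eqI) (simp add: lower_def fun_eq_iff)
  qed
  have "bij_betw swp ?B ?B" by (rule bij_betwI[where g = swp]) (use I(1) invol in blast)+
  from sum.reindex_bij_betw[OF this, of "\<lambda>t. c (lower \<gamma> t)"]
  have "(\<Sum>t\<in>?B. c (lower \<gamma> t)) = (\<Sum>t\<in>?B. c (lower \<gamma> (swp t)))" by simp
  also have "\<dots> = (\<Sum>t\<in>?B. - c (lower \<gamma> t))"
  proof (rule sum.cong[OF refl])
    fix t assume t: "t \<in> ?B"
    have "c (lower \<gamma> t \<circ> transpose (ix t) (Suc (ix t))) = - c (lower \<gamma> t)"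
      using alt I(4)[OF t] by (simp add: alternating_def)
    then show "c (lower \<gamma> (swp t)) = - c (lower \<gamma> t)" unfolding I(2)[OF t] .
  qed
  finally have zero: "(\<Sum>t\<in>?B. c (lower \<gamma> t)) = 0" by (simp add: sum_negf)
  have "?A = ?B \<union> ?G" by (auto simp: not_less)
  moreover have "?B \<inter> ?G = {}" by (auto simp: not_less)
  ultimately have "(\<Sum>t\<in>?A. c (lower \<gamma> t)) = (\<Sum>t\<in>?B. c (lower \<gamma> t)) + (\<Sum>t\<in>?G. c (lower \<gamma> t))"
    using fA by (simp only: finite_Un sum.union_disjoint)
  then show ?thesis using zero by simp
qed

text \<open>
  Multiplication by the product of the $h_{m_j}$ over the multiplicities $m_j$ of
  \<open>m\<close>.
\<close>

definition content_sum :: "nat \<Rightarrow> ((nat \<Rightarrow> int) \<Rightarrow> rat) \<Rightarrow> nat multiset \<Rightarrow> (nat \<Rightarrow> int) \<Rightarrow> rat" where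
  "content_sum N c m \<gamma> =
     (\<Sum>M | set_mset M \<subseteq> {..<N} \<times> set_mset m \<and> image_mset snd M = m. c (lower \<gamma> (image_mset fst M)))"

lemma size_content: "image_mset snd M = m \<Longrightarrow> size M = size m"
  by (metis size_image_mset)

text \<open>Splitting off the column of the colour \<open>j\<close>.\<close>

lemma content_sum_split:
  fixes m :: "nat multiset"
  assumes "j \<notin># m"
  shows "content_sum N c (m + replicate_mset k j) \<gamma> =
    (\<Sum>t | set_mset t \<subseteq> {..<N} \<and> size t = k. content_sum N c m (lower \<gamma> t))"
proof -
  let ?T = "{t. set_mset t \<subseteq> {..<N} \<and> size t = k}"
  let ?S = "\<lambda>m. {M. set_mset M \<subseteq> {..<N} \<times> set_mset m \<and> image_mset snd M = m}"
  let ?m = "m + replicate_mset k j"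
  \<comment> \<open>\<open>t\<close> is the column \<open>j\<close>, and \<open>M\<close> consists of the other columns\<close>
  have bij: "bij_betw (\<lambda>(t, M). M + image_mset (\<lambda>i. (i, j)) t) (?T \<times> ?S m) (?S ?m)"
  proof (rule bij_betwI[where g = "\<lambda>M. (image_mset fst (filter_mset (\<lambda>p. snd p = j) M), filter_mset (\<lambda>p. snd p \<noteq> j) M)"])
    show "(\<lambda>(t, M). M + image_mset (\<lambda>i. (i, j)) t) \<in> ?T \<times> ?S m \<rightarrow> ?S ?m"
      by (auto simp: image_mset.compositionality o_def image_mset_const_eq dest: multi_member_split)
    have split: "filter_mset (\<lambda>p. snd p \<noteq> j) M + image_mset (\<lambda>i. (i, j)) (image_mset fst (filter_mset (\<lambda>p. snd p = j) M)) = M"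
      for M :: "(nat \<times> nat) multiset"
      by (induction M) auto
    show "(\<lambda>M. (image_mset fst (filter_mset (\<lambda>p. snd p = j) M), filter_mset (\<lambda>p. snd p \<noteq> j) M)) \<in> ?S ?m \<rightarrow> ?T \<times> ?S m"
    proof
      fix M assume M: "M \<in> ?S ?m"
      have fs: "image_mset snd (filter_mset (\<lambda>p. P (snd p)) M) = filter_mset P (image_mset snd M)" for P
        by (induction M) auto
      have "image_mset snd (filter_mset (\<lambda>p. snd p \<noteq> j) M) = filter_mset (\<lambda>x. x \<noteq> j) ?m"
        using fs[of "\<lambda>x. x \<noteq> j"] M by simp
      also have "\<dots> = m" using assms by (intro multiset_eqI) (auto simp: not_in_iff)
      finally have 1: "image_mset snd (filter_mset (\<lambda>p. snd p \<noteq> j) M) = m" .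
      have "image_mset snd (filter_mset (\<lambda>p. snd p = j) M) = filter_mset (\<lambda>x. x = j) ?m"
        using fs[of "\<lambda>x. x = j"] M by simp
      then have "size (filter_mset (\<lambda>p. snd p = j) M) = size (filter_mset (\<lambda>x. x = j) ?m)" by (metis size_image_mset)
      also have "\<dots> = k" using assms by (simp add: filter_eq_replicate_mset count_eq_zero_iff[symmetric] del: count_eq_zero_iff)
      finally have 2: "size (filter_mset (\<lambda>p. snd p = j) M) = k" .
      have "set_mset (filter_mset (\<lambda>p. snd p \<noteq> j) M) \<subseteq> {..<N} \<times> set_mset m"
        using M by (auto split: if_splits)
      moreover have "set_mset (image_mset fst (filter_mset (\<lambda>p. snd p = j) M)) \<subseteq> {..<N}"
        using M by auto
      ultimately show "(image_mset fst (filter_mset (\<lambda>p. snd p = j) M), filter_mset (\<lambda>p. snd p \<noteq> j) M) \<in> ?T \<times> ?S m"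
        using 1 2 by simp
    qed
    fix q assume q: "q \<in> ?T \<times> ?S m"
    obtain t M where qq: "q = (t, M)" by (cases q)
    have "snd p \<noteq> j" if "p \<in># M" for p using q qq that assms by auto
    then have "filter_mset (\<lambda>p. snd p = j) M = {#}" "filter_mset (\<lambda>p. snd p \<noteq> j) M = M"
      by (auto intro!: multiset_eqI simp: count_eq_zero_iff) blast
    moreover have "filter_mset (\<lambda>p. snd p = j) (image_mset (\<lambda>i. (i, j)) t) = image_mset (\<lambda>i. (i, j)) t"
      "filter_mset (\<lambda>p. snd p \<noteq> j) (image_mset (\<lambda>i. (i, j)) t) = {#}"
      by (induction t) auto
    ultimately show "(image_mset fst (filter_mset (\<lambda>p. snd p = j) (case q of (t, M) \<Rightarrow> M + image_mset (\<lambda>i. (i, j)) t)),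
        filter_mset (\<lambda>p. snd p \<noteq> j) (case q of (t, M) \<Rightarrow> M + image_mset (\<lambda>i. (i, j)) t)) = q"
      by (simp add: qq image_mset.compositionality o_def)
  next
    fix M :: "(nat \<times> nat) multiset"
    show "(case (image_mset fst (filter_mset (\<lambda>p. snd p = j) M), filter_mset (\<lambda>p. snd p \<noteq> j) M) of (t, M) \<Rightarrow>
      M + image_mset (\<lambda>i. (i, j)) t) = M"
      by (induction M) auto
  qed
  have "content_sum N c ?m \<gamma> =
    (\<Sum>q\<in>?T \<times> ?S m. c (lower (lower \<gamma> (fst q)) (image_mset fst (snd q))))"
    unfolding content_sum_def
    by (subst sum.reindex_bij_betw[OF bij, symmetric])
      (simp add: case_prod_unfold image_mset.compositionality o_def lower_add[symmetric] add.commute)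
  also have "\<dots> = (\<Sum>t\<in>?T. content_sum N c m (lower \<gamma> t))"
    unfolding content_sum_def by (simp add: sum.cartesian_product case_prod_unfold)
  finally show ?thesis .
qed

lemma content_sum_alternating:
  assumes "alternating N c" shows "alternating N (content_sum N c m)"
proof (induction "card (set_mset m)" arbitrary: m rule: less_induct)
  case less
  show ?case
  proof (cases "m = {#}")
    case True
    then have "content_sum N c m = c" by (auto simp: content_sum_def lower_def fun_eq_iff)
    then show ?thesis using assms by simp
  next
    case False
    then obtain j where j: "j \<in># m" by blast
    define m' where "m' = filter_mset (\<lambda>x. x \<noteq> j) m"
    have m: "m = m' + replicate_mset (count m j) j" by (rule multiset_eqI) (auto simp: m'_def)
    have nj: "j \<notin># m'" by (simp add: m'_def)
    have "set_mset m' \<subset> set_mset m" using j by (auto simp: m'_def)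
    then have alt: "alternating N (content_sum N c m')" using less by (simp add: psubset_card_mono)
    show ?thesis unfolding alternating_def
    proof (intro allI impI)
      fix a b \<gamma> assume ab: "a < N \<and> b < N \<and> a \<noteq> b"
      let ?T = "{t. set_mset t \<subseteq> {..<N} \<and> size t = count m j}"
      let ?p = "transpose a b"
      have tp: "?p permutes {..<N}" using ab by (simp add: permutes_swap_id)
      have mem: "?p l < N \<longleftrightarrow> l < N" for l using permutes_in_image[OF tp, of l] by simp
      have bij: "bij_betw (image_mset ?p) ?T ?T"
        by (rule bij_betwI[where g = "image_mset ?p"]) (auto simp: mem image_mset.compositionality o_def subset_iff)
      have cnt: "count (image_mset ?p t) l = count t (?p l)" for t l
        by (induction t) (auto simp: transpose_def split: if_splits)
      have low: "lower (\<gamma> \<circ> ?p) (image_mset ?p t) = lower \<gamma> t \<circ> ?p" for t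
        by (simp add: lower_def cnt fun_eq_iff)
      have "content_sum N c m (\<gamma> \<circ> ?p) = (\<Sum>t\<in>?T. content_sum N c m' (lower (\<gamma> \<circ> ?p) (image_mset ?p t)))"
        by (subst m, subst content_sum_split[OF nj], rule sum.reindex_bij_betw[OF bij, symmetric])
      also have "\<dots> = (\<Sum>t\<in>?T. - content_sum N c m' (lower \<gamma> t))"
        unfolding low using alt ab by (simp add: alternating_def)
      also have "\<dots> = - content_sum N c m \<gamma>"
        by (subst (2) m, subst content_sum_split[OF nj]) (rule sum_negf)
      finally show "content_sum N c m (\<gamma> \<circ> ?p) = - content_sum N c m \<gamma>" .
    qed
  qed
qed

text \<open>
  Lowering never makes a negative exponent nonnegative again, and the alternant has no negative
  exponents.
\<close>

lemma content_sum_vandermonde_negative: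
  assumes "i < N" "\<gamma> i < 0"
  shows "content_sum N (vandermonde_coeff N) m \<gamma> = 0"
  unfolding content_sum_def
proof (rule sum.neutral, rule ballI)
  fix M
  have "lower \<gamma> (image_mset fst M) i < 0" using assms by (simp add: lower_def)
  then show "vandermonde_coeff N (lower \<gamma> (image_mset fst M)) = 0"
    by (rule vandermonde_coeff_negative[OF assms(1)])
qed

section \<open>Semistandard tableaux and Schur functions\<close>

definition diagram :: "nat \<Rightarrow> (nat \<Rightarrow> nat) \<Rightarrow> (nat \<times> nat) set" where
  "diagram N l = (SIGMA i:{..<N}. {..<l i})"

definition tableaux :: "(nat \<times> nat) set \<Rightarrow> (nat \<times> nat \<Rightarrow> nat) set" where
  "tableaux D = {T \<in> extensional D.
     (\<forall>i j. (i, j) \<in> D \<and> (i, Suc j) \<in> D \<longrightarrow> T (i, j) \<le> T (i, Suc j)) \<and>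
     (\<forall>i j. (i, j) \<in> D \<and> (Suc i, j) \<in> D \<longrightarrow> T (i, j) < T (Suc i, j))}"

lemma mem_diagram [simp]: "(i, j) \<in> diagram N l \<longleftrightarrow> i < N \<and> j < l i"
  by (simp add: diagram_def)

lemma finite_diagram [simp]: "finite (diagram N l)"
  by (simp add: diagram_def)

lemma tableaux_row_mono:
  assumes "T \<in> tableaux (diagram N l)" "i < N" "j \<le> j'" "j' < l i"
  shows "T (i, j) \<le> T (i, j')"
  using assms(3,4)
proof (induction j' rule: dec_induct)
  case (step k)
  have "T (i, k) \<le> T (i, Suc k)" using assms(1,2) step by (simp add: tableaux_def)
  then show ?case using step by simp
qed simp

lemma initial_segment:
  assumes "A \<subseteq> {..<n :: nat}" "\<And>i j. j \<in> A \<Longrightarrow> i \<le> j \<Longrightarrow> i \<in> A"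
  shows "A = {..<card A}"
proof -
  have fA: "finite A" using assms(1) finite_subset by blast
  show ?thesis
  proof (cases "A = {}")
    case False
    have "A = {..Max A}"
    proof
      show "A \<subseteq> {..Max A}" using fA by auto
      show "{..Max A} \<subseteq> A" using assms(2)[OF Max_in[OF fA False]] by auto
    qed
    then have "card A = Suc (Max A)" by (metis card_atMost)
    then show ?thesis using \<open>A = {..Max A}\<close> by (simp add: lessThan_Suc_atMost)
  qed simp
qed

text \<open>
  Horizontal strips of size \<open>k\<close> in the diagram with row lengths \<open>l\<close>,
  given by the number of cells removed from each row.
\<close>

definition strips :: "nat \<Rightarrow> (nat \<Rightarrow> nat) \<Rightarrow> nat \<Rightarrow> nat multiset set" where
  "strips N l k = {t. set_mset t \<subseteq> {..<N} \<and> size t = k \<and>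
     (\<forall>i<N. count t i \<le> l i \<and> (Suc i < N \<longrightarrow> l (Suc i) \<le> l i - count t i))}"

definition remove_strip :: "(nat \<Rightarrow> nat) \<Rightarrow> nat multiset \<Rightarrow> nat \<Rightarrow> nat" where
  "remove_strip l t i = l i - count t i"

definition last_strip :: "nat \<Rightarrow> (nat \<Rightarrow> nat) \<Rightarrow> nat \<Rightarrow> (nat \<times> nat \<Rightarrow> nat) \<Rightarrow> nat multiset" where
  "last_strip N l s T = image_mset fst (mset_set {c \<in> diagram N l. T c = s})"

lemma count_last_strip: "count (last_strip N l s T) i = (if i < N then card {j. j < l i \<and> T (i, j) = s} else 0)"
proof -
  have "count (last_strip N l s T) i = card {c \<in> {c \<in> diagram N l. T c = s}. fst c = i}"
    unfolding last_strip_def by (rule count_image_mset_eq_card_vimage) simp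
  also have "{c \<in> {c \<in> diagram N l. T c = s}. fst c = i} = (if i < N then Pair i ` {j. j < l i \<and> T (i, j) = s} else {})"
    by auto
  also have "card \<dots> = (if i < N then card {j. j < l i \<and> T (i, j) = s} else 0)"
    by (simp add: card_image inj_on_def)
  finally show ?thesis .
qed

text \<open>
  Rows increase weakly, so the cells with largest possible entry \<open>s\<close> are at the end
  of each row.
\<close>

lemma remaining_diagram:
  assumes T: "T \<in> tableaux (diagram N l)" and le: "\<And>c. c \<in> diagram N l \<Longrightarrow> T c \<le> s" and i: "i < N"
  shows "{j. j < l i \<and> T (i, j) < s} = {..<remove_strip l (last_strip N l s T) i}"
    and "count (last_strip N l s T) i \<le> l i"
proof -
  let ?A = "{j. j < l i \<and> T (i, j) < s}" and ?B = "{j. j < l i \<and> T (i, j) = s}"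
  have A: "?A = {..<card ?A}"
  proof (rule initial_segment[of _ "l i"])
    fix a b assume b: "b \<in> ?A" and ab: "a \<le> b"
    then have "T (i, a) \<le> T (i, b)" using tableaux_row_mono[OF T i ab] by simp
    then show "a \<in> ?A" using b ab by simp
  qed auto
  have "T (i, j) \<le> s" if "j < l i" for j using le[of "(i, j)"] i that by simp
  then have "{..<l i} = ?A \<union> ?B" by (auto simp: order_le_less)
  then have "l i = card (?A \<union> ?B)" by (metis card_lessThan)
  also have "\<dots> = card ?A + card ?B" by (rule card_Un_disjoint) auto
  finally have "l i = card ?A + card ?B" .
  then have "card ?A = remove_strip l (last_strip N l s T) i" "count (last_strip N l s T) i \<le> l i"
    using i by (simp_all add: remove_strip_def count_last_strip)
  then show "?A = {..<remove_strip l (last_strip N l s T) i}" "count (last_strip N l s T) i \<le> l i"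
    using A by simp_all
qed

lemma remaining_cells:
  assumes "T \<in> tableaux (diagram N l)" "\<And>c. c \<in> diagram N l \<Longrightarrow> T c \<le> s"
  shows "{c \<in> diagram N l. T c < s} = diagram N (remove_strip l (last_strip N l s T))"
  using remaining_diagram(1)[OF assms] by (fastforce simp: diagram_def)

text \<open>
  Removing the cells with the largest entry \<open>s\<close> from a tableau leaves a smaller
  tableau, and as columns increase strictly, these cells form a horizontal strip.
\<close>

lemma tableaux_split:
  assumes l: "\<And>i. Suc i < N \<Longrightarrow> l (Suc i) \<le> l i" and m: "\<And>x. x \<in># m \<Longrightarrow> x < s"
  shows "card {T \<in> tableaux (diagram N l). profile (diagram N l) T = m + replicate_mset k s} =
    (\<Sum>t\<in>strips N l k. card {T \<in> tableaux (diagram N (remove_strip l t)). profile (diagram N (remove_strip l t)) T = m})"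
proof -
  let ?D = "diagram N l"
  let ?m = "m + replicate_mset k s"
  let ?L = "{T \<in> tableaux ?D. profile ?D T = ?m}"
  let ?D' = "\<lambda>t. diagram N (remove_strip l t)"
  let ?R = "\<lambda>t. {T \<in> tableaux (?D' t). profile (?D' t) T = m}"
  have sub: "?D' t \<subseteq> ?D" for t by (auto simp: diagram_def remove_strip_def)
  have memprof: "T c \<in># profile D T" if "c \<in> D" "finite D" for T :: "nat \<times> nat \<Rightarrow> nat" and c D
    using that by (simp add: profile_def)
  have finR: "finite (?R t)" for t
  proof (rule finite_subset)
    show "?R t \<subseteq> ?D' t \<rightarrow>\<^sub>E set_mset m"
    proof
      fix T assume T: "T \<in> ?R t"
      then have "T \<in> extensional (?D' t)" by (simp add: tableaux_def)
      moreover have "T c \<in># m" if "c \<in> ?D' t" for c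
        using memprof[OF that finite_diagram, of T] T by simp
      ultimately show "T \<in> ?D' t \<rightarrow>\<^sub>E set_mset m" by (auto simp: PiE_def)
    qed
    show "finite (?D' t \<rightarrow>\<^sub>E set_mset m)" by (intro finite_PiE) auto
  qed
  have finS: "finite (strips N l k)"
    by (rule finite_subset[OF _ finite_msets[of "{..<N}" k]]) (auto simp: strips_def)
  have cardS: "card {c \<in> ?D. T c = s} = k" and le: "c \<in> ?D \<Longrightarrow> T c \<le> s"
    and prof': "image_mset T (mset_set {c \<in> ?D. T c < s}) = m" if T: "T \<in> ?L" for T c
  proof -
    have pr: "profile ?D T = ?m" using T by simp
    show les: "T c \<le> s" if "c \<in> ?D" for c
      using memprof[OF that finite_diagram, of T] m by (auto simp: pr order_le_less split: if_splits)
    have "count (profile ?D T) s = k" using m by (auto simp: pr not_in_iff[symmetric])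
    then show "card {c \<in> ?D. T c = s} = k" by (simp add: count_profile)
    have "count m x = 0" if "\<not> x < s" for x using m that by (auto simp: not_in_iff[symmetric])
    then have "m = filter_mset (\<lambda>x. x < s) ?m" by (intro multiset_eqI) auto
    also have "\<dots> = image_mset T (filter_mset (\<lambda>c. T c < s) (mset_set ?D))"
      unfolding pr[symmetric] profile_def by (simp add: filter_mset_image_mset)
    finally show "image_mset T (mset_set {c \<in> ?D. T c < s}) = m" by simp
  qed
  have bij: "bij_betw (\<lambda>T. (last_strip N l s T, restrict T (?D' (last_strip N l s T)))) ?L (SIGMA t:strips N l k. ?R t)"
  proof (rule bij_betwI[where g = "\<lambda>(t, T) c. if c \<in> ?D' t then T c else if c \<in> ?D then s else undefined"])
    show "(\<lambda>T. (last_strip N l s T, restrict T (?D' (last_strip N l s T)))) \<in> ?L \<rightarrow> (SIGMA t:strips N l k. ?R t)"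
    proof
      fix T assume T: "T \<in> ?L"
      then have Tt: "T \<in> tableaux ?D" by simp
      let ?t = "last_strip N l s T"
      have cells: "{c \<in> ?D. T c < s} = ?D' ?t" by (rule remaining_cells[OF Tt le[OF T]])
      have "l (Suc i) \<le> l i - count ?t i" if i: "Suc i < N" for i
      proof (rule ccontr)
        assume "\<not> ?thesis"
        then have a: "remove_strip l ?t i < l (Suc i)" by (simp add: remove_strip_def)
        let ?c = "remove_strip l ?t i"
        have c: "(i, ?c) \<in> ?D" "(Suc i, ?c) \<in> ?D" using a i l[OF i] by auto
        then have "T (i, ?c) < T (Suc i, ?c)" using Tt by (simp add: tableaux_def)
        moreover have "T (Suc i, ?c) \<le> s" using le[OF T] c by blast
        ultimately have "(i, ?c) \<in> {c \<in> ?D. T c < s}" using c by simp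
        then show False unfolding cells by simp
      qed
      moreover have "set_mset ?t \<subseteq> {..<N}" by (auto simp: last_strip_def)
      moreover have "size ?t = k" using cardS[OF T] by (simp add: last_strip_def)
      ultimately have "?t \<in> strips N l k"
        using remaining_diagram(2)[OF Tt le[OF T]] by (simp add: strips_def)
      moreover have "restrict T (?D' ?t) \<in> tableaux (?D' ?t)"
      proof -
        have "(i, j) \<in> ?D" if "(i, j) \<in> ?D' ?t" for i j using sub[of ?t] that by blast
        then show ?thesis using Tt unfolding tableaux_def by (auto simp del: mem_diagram)
      qed
      moreover have "profile (?D' ?t) (restrict T (?D' ?t)) = m"
      proof -
        have "profile (?D' ?t) (restrict T (?D' ?t)) = image_mset T (mset_set (?D' ?t))"
          unfolding profile_def by (intro image_mset_cong) auto
        then show ?thesis using prof'[OF T] unfolding cells by simp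
      qed
      ultimately show "(?t, restrict T (?D' ?t)) \<in> (SIGMA t:strips N l k. ?R t)" by simp
    qed
    show "(\<lambda>(t, T) c. if c \<in> ?D' t then T c else if c \<in> ?D then s else undefined) \<in> (SIGMA t:strips N l k. ?R t) \<rightarrow> ?L"
    proof clarify
      fix t T assume t: "t \<in> strips N l k" and T: "T \<in> tableaux (?D' t)" and mm: "m = profile (?D' t) T"
      let ?T = "\<lambda>c. if c \<in> ?D' t then T c else if c \<in> ?D then s else undefined"
      have Ts: "T c < s" if "c \<in> ?D' t" for c using memprof[OF that finite_diagram, of T] m mm by simp
      have tl: "\<And>i. i < N \<Longrightarrow> count t i \<le> l i" "\<And>i. Suc i < N \<Longrightarrow> l (Suc i) \<le> l i - count t i"
        using t by (auto simp: strips_def)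
      have "?T \<in> tableaux ?D"
        unfolding tableaux_def
      proof (intro CollectI conjI allI impI)
        show "?T \<in> extensional ?D" using sub[of t] by (auto simp: extensional_def simp del: mem_diagram)
        fix i j assume ij: "(i, j) \<in> ?D \<and> (i, Suc j) \<in> ?D"
        show "?T (i, j) \<le> ?T (i, Suc j)"
        proof (cases "(i, Suc j) \<in> ?D' t")
          case True
          then have "(i, j) \<in> ?D' t" by simp
          then show ?thesis using True T by (simp add: tableaux_def)
        next
          case False
          then show ?thesis using ij Ts[of "(i, j)"] by (auto simp: order_le_less)
        qed
      next
        fix i j assume ij: "(i, j) \<in> ?D \<and> (Suc i, j) \<in> ?D"
        then have "(i, j) \<in> ?D' t" using tl(2)[of i] by (auto simp: remove_strip_def)
        then show "?T (i, j) < ?T (Suc i, j)"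
          using ij T Ts[of "(i, j)"] by (auto simp: tableaux_def)
      qed
      moreover have "profile ?D ?T = m + replicate_mset k s"
      proof -
        have D: "?D = ?D' t \<union> (?D - ?D' t)" using sub[of t] by blast
        have "mset_set ?D = mset_set (?D' t) + mset_set (?D - ?D' t)"
          by (subst D, rule mset_set_Union) auto
        then have "profile ?D ?T = image_mset ?T (mset_set (?D' t)) + image_mset ?T (mset_set (?D - ?D' t))"
          by (simp add: profile_def)
        also have "image_mset ?T (mset_set (?D' t)) = m"
          unfolding mm profile_def by (intro image_mset_cong) auto
        also have "image_mset ?T (mset_set (?D - ?D' t)) = replicate_mset (card (?D - ?D' t)) s"
          by (rule image_mset_const) auto
        also have "card (?D - ?D' t) = k"
        proof -
          have "?D - ?D' t = (SIGMA i:{..<N}. {l i - count t i..<l i})"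
            by (auto simp: diagram_def remove_strip_def)
          then have "card (?D - ?D' t) = (\<Sum>i<N. count t i)" using tl by simp
          also have "\<dots> = size t"
            using t by (intro size_multiset_overloaded_eq[THEN trans, symmetric] sum.mono_neutral_left)
              (auto simp: strips_def not_in_iff)
          finally show ?thesis using t by (simp add: strips_def)
        qed
        finally show ?thesis .
      qed
      ultimately show "?T \<in> tableaux ?D \<and> profile ?D ?T = profile (?D' t) T + replicate_mset k s"
        unfolding mm[symmetric] by blast
    qed
    fix T assume T: "T \<in> ?L"
    then have Tt: "T \<in> tableaux ?D" by simp
    let ?t = "last_strip N l s T"
    have cells: "{c \<in> ?D. T c < s} = ?D' ?t" by (rule remaining_cells[OF Tt le[OF T]])
    show "(case (?t, restrict T (?D' ?t)) of (t, T) \<Rightarrow> \<lambda>c. if c \<in> ?D' t then T c else if c \<in> ?D then s else undefined) = T"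
    proof
      fix c
      have "T c = s" if "c \<in> ?D" "c \<notin> ?D' ?t" using that le[OF T] cells by fastforce
      moreover have "T c = undefined" if "c \<notin> ?D" using Tt that extensional_arb[of T ?D c] by (simp add: tableaux_def)
      ultimately show "(case (?t, restrict T (?D' ?t)) of (t, T) \<Rightarrow> \<lambda>c. if c \<in> ?D' t then T c else if c \<in> ?D then s else undefined) c = T c"
        by auto
    qed
  next
    fix q assume q: "q \<in> (SIGMA t:strips N l k. ?R t)"
    obtain t T where qq: "q = (t, T)" by (cases q)
    have t: "t \<in> strips N l k" and T: "T \<in> tableaux (?D' t)" and mm: "profile (?D' t) T = m"
      using q qq by auto
    let ?T = "\<lambda>c. if c \<in> ?D' t then T c else if c \<in> ?D then s else undefined"
    have Ts: "T c < s" if "c \<in> ?D' t" for c using memprof[OF that finite_diagram, of T] m mm by simp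
    have "last_strip N l s ?T = t"
    proof (rule multiset_eqI)
      fix i
      show "count (last_strip N l s ?T) i = count t i"
      proof (cases "i < N")
        case True
        have "{j. j < l i \<and> ?T (i, j) = s} = {l i - count t i..<l i}"
        proof -
          have "T (i, j) < s" if "j < l i - count t i" for j
            using True Ts[of "(i, j)"] that by (simp add: remove_strip_def)
          then have "(j < l i \<and> ?T (i, j) = s) \<longleftrightarrow> j \<in> {l i - count t i..<l i}" for j
            using True by (cases "j < l i - count t i") (auto simp: remove_strip_def)
          then show ?thesis by blast
        qed
        then show ?thesis using True t by (simp add: count_last_strip strips_def)
      next
        case False
        then have "i \<notin># t" using t by (auto simp: strips_def)
        then show ?thesis using False by (simp add: count_last_strip not_in_iff)
      qed
    qed
    moreover have "restrict ?T (?D' t) = T" using T by (auto simp: tableaux_def extensional_def fun_eq_iff)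
    ultimately show "(\<lambda>T. (last_strip N l s T, restrict T (?D' (last_strip N l s T))))
        (case q of (t, T) \<Rightarrow> \<lambda>c. if c \<in> ?D' t then T c else if c \<in> ?D then s else undefined) = q"
      by (simp add: qq)
  qed
  show ?thesis using bij_betw_same_card[OF bij] finS finR by (simp add: card_SigmaI)
qed

text \<open>The exponent vector $l + \delta$.\<close>

definition shape_vector :: "nat \<Rightarrow> (nat \<Rightarrow> nat) \<Rightarrow> nat \<Rightarrow> int" where
  "shape_vector N l i = int (l i) + int N - 1 - int i"

lemma shape_vector_strict:
  assumes "\<And>i. Suc i < N \<Longrightarrow> l (Suc i) \<le> l i"
  shows "strict_desc N (shape_vector N l)"
proof -
  have "l j \<le> l i" if "i \<le> j" "j < N" for i j
    using that
  proof (induction j rule: dec_induct)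
    case (step k)
    then show ?case using assms[of k] by simp
  qed simp
  then show ?thesis by (auto simp: strict_desc_def shape_vector_def) (smt (verit) less_imp_le of_nat_le_iff of_nat_less_iff)
qed

text \<open>
  Both sides satisfy the same recursion in the largest colour: on the left by the Pieri rule, on
  the right by removing the largest entries. Strips that reach beyond the end of the last row
  occur on the left only and contribute 0.
\<close>

lemma content_sum_tableaux:
  assumes "\<And>i. Suc i < N \<Longrightarrow> l (Suc i) \<le> l i" "\<And>x. x \<in># m \<Longrightarrow> x < s"
  shows "content_sum N (vandermonde_coeff N) m (shape_vector N l) =
    of_nat (card {T \<in> tableaux (diagram N l). profile (diagram N l) T = m})"
  using assms
proof (induction s arbitrary: l m)
  case 0
  have sd: "strict_desc N (shape_vector N l)" by (rule shape_vector_strict) (rule 0(1))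
  from 0 have m: "m = {#}" by (metis all_not_in_conv not_less_zero set_mset_eq_empty_iff)
  have "content_sum N (vandermonde_coeff N) m (shape_vector N l) = vandermonde_coeff N (shape_vector N l)"
    by (simp add: content_sum_def m lower_def)
  also have "\<dots> = (if \<forall>i<N. l i = 0 then 1 else 0)"
    by (simp add: vandermonde_coeff_strict[OF sd] shape_vector_def)
  also have "\<dots> = of_nat (card {T \<in> tableaux (diagram N l). profile (diagram N l) T = {#}})"
  proof (cases "diagram N l = {}")
    case True
    then have "\<forall>i<N. l i = 0" by (auto simp: diagram_def)
    moreover have "{T \<in> tableaux (diagram N l). profile (diagram N l) T = {#}} = {\<lambda>_. undefined}"
      unfolding True by (auto simp: tableaux_def profile_def extensional_def)
    ultimately show ?thesis by simp
  next
    case False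
    then have "\<not> (\<forall>i<N. l i = 0)" by (auto simp: diagram_def)
    moreover have "mset_set (diagram N l) \<noteq> {#}" using False by (simp add: mset_set_empty_iff)
    then have "{T \<in> tableaux (diagram N l). profile (diagram N l) T = {#}} = {}" by (auto simp: profile_def)
    ultimately show ?thesis by (simp only: if_False card.empty of_nat_0)
  qed
  finally show ?case by (simp add: m)
next
  case (Suc s)
  define m' where "m' = filter_mset (\<lambda>x. x \<noteq> s) m"
  define k where "k = count m s"
  have m: "m = m' + replicate_mset k s" by (rule multiset_eqI) (auto simp: m'_def k_def)
  have m's: "x < s" if "x \<in># m'" for x using Suc.prems(2)[of x] that by (auto simp: m'_def)
  have ns: "s \<notin># m'" using m's by blast
  let ?\<gamma> = "shape_vector N l" and ?c = "content_sum N (vandermonde_coeff N) m'"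
  have alt: "alternating N ?c" by (rule content_sum_alternating[OF vandermonde_coeff_alternating])
  let ?G = "{t. set_mset t \<subseteq> {..<N} \<and> size t = k \<and> (\<forall>i. Suc i < N \<longrightarrow> ?\<gamma> (Suc i) < lower ?\<gamma> t i)}"
  have fG: "finite ?G" by (rule finite_subset[OF _ finite_msets[of "{..<N}" k]]) auto
  have "content_sum N (vandermonde_coeff N) m ?\<gamma> = (\<Sum>t | set_mset t \<subseteq> {..<N} \<and> size t = k. ?c (lower ?\<gamma> t))"
    unfolding m by (rule content_sum_split[OF ns])
  also have "\<dots> = (\<Sum>t\<in>?G. ?c (lower ?\<gamma> t))"
    by (rule pieri[OF alt shape_vector_strict]) (rule Suc.prems(1))
  also have "\<dots> = (\<Sum>t\<in>strips N l k. ?c (lower ?\<gamma> t))"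
  proof (rule sum.mono_neutral_right[OF fG])
    show "strips N l k \<subseteq> ?G"
    proof
      fix t assume t: "t \<in> strips N l k"
      have "?\<gamma> (Suc i) < lower ?\<gamma> t i" if "Suc i < N" for i
      proof -
        have "l (Suc i) \<le> l i - count t i" "count t i \<le> l i" using t that by (auto simp: strips_def)
        then show ?thesis by (simp add: shape_vector_def lower_def)
      qed
      then show "t \<in> ?G" using t by (simp add: strips_def)
    qed
    show "\<forall>t\<in>?G - strips N l k. ?c (lower ?\<gamma> t) = 0"
    proof
      fix t assume t: "t \<in> ?G - strips N l k"
      have step: "l (Suc i) \<le> l i - count t i \<and> count t i \<le> l i" if "Suc i < N" for i
      proof -
        have "?\<gamma> (Suc i) < lower ?\<gamma> t i" using t that by blast
        then show ?thesis by (simp add: shape_vector_def lower_def)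
      qed
      have "\<exists>i<N. \<not> count t i \<le> l i"
      proof (rule ccontr)
        assume "\<not> ?thesis"
        then have "t \<in> strips N l k" using t step by (simp add: strips_def)
        then show False using t by blast
      qed
      then obtain i where i: "i < N" "l i < count t i" by (auto simp: not_le)
      then have "\<not> Suc i < N" using step[of i] by auto
      then have "lower ?\<gamma> t i < 0" using i by (simp add: shape_vector_def lower_def)
      then show "?c (lower ?\<gamma> t) = 0" by (rule content_sum_vandermonde_negative[OF i(1)])
    qed
  qed
  also have "\<dots> = (\<Sum>t\<in>strips N l k. of_nat (card {T \<in> tableaux (diagram N (remove_strip l t)).
      profile (diagram N (remove_strip l t)) T = m'}))"
  proof (rule sum.cong[OF refl])
    fix t assume t: "t \<in> strips N l k"
    have low: "lower ?\<gamma> t = shape_vector N (remove_strip l t)"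
    proof
      fix i
      have "count t i \<le> l i"
      proof (cases "i < N")
        case False
        then have "i \<notin># t" using t by (auto simp: strips_def)
        then show ?thesis by (simp add: not_in_iff)
      qed (use t in \<open>simp add: strips_def\<close>)
      then show "lower ?\<gamma> t i = shape_vector N (remove_strip l t) i"
        by (simp add: lower_def shape_vector_def remove_strip_def)
    qed
    have "remove_strip l t (Suc i) \<le> remove_strip l t i" if i: "Suc i < N" for i
    proof -
      have "l (Suc i) \<le> l i - count t i" using t i by (simp add: strips_def)
      then show ?thesis by (simp add: remove_strip_def)
    qed
    then show "?c (lower ?\<gamma> t) = of_nat (card {T \<in> tableaux (diagram N (remove_strip l t)).
      profile (diagram N (remove_strip l t)) T = m'})"
      unfolding low using Suc.IH m's by blast
  qed
  also have "\<dots> = of_nat (card {T \<in> tableaux (diagram N l). profile (diagram N l) T = m})"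
    unfolding m using tableaux_split[of N l m' s k] Suc.prems(1) m's by simp
  finally show ?case .
qed

text \<open>
  The coefficient of $x^{\<lambda> + \delta}$ in $a_\delta p_{type(\<psi>)}$, which is
  Frobenius' formula for the irreducible character.
\<close>

definition schur_char :: "nat \<Rightarrow> nat list \<Rightarrow> (nat \<Rightarrow> nat) \<Rightarrow> rat" where
  "schur_char n lam = colour_char False n {..<length lam}
     (\<lambda>M. vandermonde_coeff (length lam) (lower (shape_vector (length lam) (\<lambda>i. lam ! i)) M))"

lemma frob_ch_schur_char:
  assumes "is_partition n lam"
  shows "frob_ch n (schur_char n lam) = schur_sf lam"
proof
  fix m
  let ?N = "length lam" and ?l = "\<lambda>i. lam ! i"
  have D: "cells lam = diagram ?N ?l" by (simp add: cells_def diagram_def)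
  have l: "Suc i < ?N \<Longrightarrow> ?l (Suc i) \<le> ?l i" for i
    using assms by (simp add: is_partition_def sorted_wrt_iff_nth_less)
  have cardD: "card (diagram ?N ?l) = n"
    using assms by (simp add: diagram_def is_partition_def sum_list_sum_nth atLeast0LessThan)
  have schur: "schur_sf lam m = of_nat (card {T \<in> tableaux (diagram ?N ?l). profile (diagram ?N ?l) T = m})"
    unfolding schur_sf_def ssyt_def D tableaux_def profile_def by simp
  have "frob_ch n (schur_char n lam) m =
    (\<Sum>M | set_mset M \<subseteq> {..<?N} \<times> set_mset m \<and> size M = n \<and> admissible False M \<and> image_mset snd M = m.
      vandermonde_coeff ?N (lower (shape_vector ?N ?l) (image_mset fst M)))"
    unfolding schur_char_def by (rule frob_ch_colour_char) simp
  also have "\<dots> = schur_sf lam m"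
  proof (cases "size m = n")
    case True
    have "{M. set_mset M \<subseteq> {..<?N} \<times> set_mset m \<and> size M = n \<and> admissible False M \<and> image_mset snd M = m} =
      {M. set_mset M \<subseteq> {..<?N} \<times> set_mset m \<and> image_mset snd M = m}"
      using True size_content by (auto simp: admissible_def)
    then have "(\<Sum>M | set_mset M \<subseteq> {..<?N} \<times> set_mset m \<and> size M = n \<and> admissible False M \<and> image_mset snd M = m.
      vandermonde_coeff ?N (lower (shape_vector ?N ?l) (image_mset fst M))) =
      content_sum ?N (vandermonde_coeff ?N) m (shape_vector ?N ?l)" by (simp add: content_sum_def)
    also have "\<dots> = schur_sf lam m"
      unfolding schur
    proof (rule content_sum_tableaux)
      show "Suc i < ?N \<Longrightarrow> ?l (Suc i) \<le> ?l i" for i by (rule l)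
      show "x \<in># m \<Longrightarrow> x < Suc (Max (set_mset m))" for x by (simp add: less_Suc_eq_le)
    qed
    finally show ?thesis .
  next
    case False
    have "{M. set_mset M \<subseteq> {..<?N} \<times> set_mset m \<and> size M = n \<and> admissible False M \<and> image_mset snd M = m} = {}"
      using False by (auto dest: size_content)
    moreover have "size (profile (diagram ?N ?l) T) = n" for T :: "nat \<times> nat \<Rightarrow> nat" by (simp add: profile_def cardD)
    then have "{T \<in> tableaux (diagram ?N ?l). profile (diagram ?N ?l) T = m} = {}" using False by blast
    ultimately show ?thesis unfolding schur by (simp only: sum.empty card.empty of_nat_0)
  qed
  finally show "frob_ch n (schur_char n lam) m = schur_sf lam m" .
qed

lemma cycle_weight_schur_char_nonneg:
  assumes "is_partition n lam"
  shows "cycle_weight (schur_char n lam) n g \<ge> 0"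
  unfolding schur_char_def
proof (rule cycle_weight_schur_nonneg[OF schur_cone_vandermonde_coeff shape_vector_strict])
  fix i assume "Suc i < length lam"
  then show "lam ! Suc i \<le> lam ! i"
    using assms by (simp add: is_partition_def sorted_wrt_iff_nth_less)
qed

text \<open>
  In each case the class function with characteristic \<open>\<tau>\<close> is known explicitly,
  and its weights are nonnegative.
\<close>

lemma frob_ch_inv_cycle_weight_nonneg:
  assumes lam: "is_partition n lam" and \<tau>: "\<tau> \<in> {schur_sf lam, elem_sf lam, psum_sf lam, homog_sf lam}"
  shows "frob_ch_inv n \<tau> \<in> class_functions n" "cycle_weight (frob_ch_inv n \<tau>) n g \<ge> 0"
proof -
  have sum: "sum_list lam = n" using lam by (simp add: is_partition_def)
  have "\<exists>f \<in> class_functions n. frob_ch n f = \<tau> \<and> cycle_weight f n g \<ge> 0"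
    using \<tau>
  proof (elim insertE)
    assume "\<tau> = schur_sf lam"
    then show ?thesis using frob_ch_schur_char[OF lam] cycle_weight_schur_char_nonneg[OF lam]
      by (intro bexI[of _ "schur_char n lam"]) (auto simp: schur_char_def colour_char_class)
  next
    assume "\<tau> = elem_sf lam"
    then show ?thesis using frob_ch_elem[OF sum] cycle_weight_content_char_nonneg
      by (intro bexI[of _ "content_char True n lam"]) (auto simp: content_char_def colour_char_class)
  next
    assume "\<tau> = psum_sf lam"
    then show ?thesis using frob_ch_psum_char[OF lam] psum_char_class
      by (intro bexI[of _ "psum_char n lam"]) (auto intro: cycle_weight_nonneg_of_nonneg simp: psum_char_def)
  next
    assume "\<tau> = homog_sf lam"
    then show ?thesis using frob_ch_homog[OF sum] cycle_weight_content_char_nonneg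
      by (intro bexI[of _ "content_char False n lam"]) (auto simp: content_char_def colour_char_class)
  qed simp
  then obtain f where f: "f \<in> class_functions n" "frob_ch n f = \<tau>" "cycle_weight f n g \<ge> 0" by blast
  then have "frob_ch_inv n \<tau> = f" by (intro frob_ch_inv_eqI)
  then show "frob_ch_inv n \<tau> \<in> class_functions n" "cycle_weight (frob_ch_inv n \<tau>) n g \<ge> 0" using f by auto
qed

section \<open>The gluing inequality for partial orientations\<close>

text \<open>
  Both endpoints of an edge may point to each other; this directed cycle of length 2 corresponds
  to a transposition below \<open>g\<close>.
\<close>

definition partial_orientations :: "nat \<Rightarrow> (nat \<times> nat) set \<Rightarrow> nat \<Rightarrow> (nat \<Rightarrow> nat option) set" where
  "partial_orientations n E r =
     {g. dom g \<subseteq> {0..<n} \<and> (\<forall>x y. g x = Some y \<longrightarrow> (x, y) \<in> E) \<and> card (dom g) = r}"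

definition orientation_sum :: "((nat \<Rightarrow> nat) \<Rightarrow> rat) \<Rightarrow> nat \<Rightarrow> (nat \<times> nat) set \<Rightarrow> nat \<Rightarrow> rat" where
  "orientation_sum f n E r = (\<Sum>g\<in>partial_orientations n E r. cycle_weight f n g)"

lemma finite_partial_orientations:
  assumes "E \<subseteq> {0..<n} \<times> {0..<n}"
  shows "finite (partial_orientations n E r)"
proof (rule finite_subset)
  show "partial_orientations n E r \<subseteq> (\<Union>A\<in>Pow {0..<n}. {g. dom g = A \<and> ran g \<subseteq> {0..<n}})"
    using assms by (fastforce simp: partial_orientations_def ran_def)
  have "finite {g. dom g = A \<and> ran g \<subseteq> {0..<n}}" if "A \<in> Pow {0..<n}" for A
    using that finite_subset[of A "{0..<n}"] by (intro finite_set_of_finite_maps) auto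
  then show "finite (\<Union>A\<in>Pow {0..<n}. {g. dom g = A \<and> ran g \<subseteq> {0..<n}})" by blast
qed

text \<open>
  The partial function \<open>g\<close> after renaming the vertices by \<open>\<sigma>\<close>.
\<close>

definition conj_map :: "(nat \<Rightarrow> nat) \<Rightarrow> (nat \<Rightarrow> nat option) \<Rightarrow> nat \<Rightarrow> nat option" where
  "conj_map \<sigma> g x = map_option \<sigma> (g (inv_into UNIV \<sigma> x))"

lemma conj_map_inv:
  assumes "\<sigma> permutes V"
  shows "conj_map (inv_into UNIV \<sigma>) (conj_map \<sigma> g) = g"
  using permutes_inverses[OF assms] permutes_inv_inv[OF assms]
  by (simp add: conj_map_def fun_eq_iff option.map_comp o_def option.map_ident)

lemma dom_conj_map:
  assumes "\<sigma> permutes V"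
  shows "dom (conj_map \<sigma> g) = \<sigma> ` dom g"
proof -
  have "x \<in> \<sigma> ` dom g \<longleftrightarrow> inv_into UNIV \<sigma> x \<in> dom g" for x
    using permutes_inverses[OF assms] by (metis imageE image_eqI)
  moreover have "x \<in> dom (conj_map \<sigma> g) \<longleftrightarrow> inv_into UNIV \<sigma> x \<in> dom g" for x
    by (simp add: conj_map_def dom_def)
  ultimately show ?thesis by blast
qed

lemma card_dom_conj_map: "\<sigma> permutes V \<Longrightarrow> card (dom (conj_map \<sigma> g)) = card (dom g)"
  by (simp add: dom_conj_map card_image permutes_inj_on)

lemma below_conj_map_subset:
  assumes s: "\<sigma> permutes V" and p: "\<psi> \<in> below V g"
  shows "\<sigma> \<circ> \<psi> \<circ> inv_into UNIV \<sigma> \<in> below V (conj_map \<sigma> g)"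
proof -
  have "\<sigma> \<circ> \<psi> \<circ> inv_into UNIV \<sigma> permutes V"
    using s p permutes_inv[OF s] by (simp add: below_def permutes_compose)
  moreover have "conj_map \<sigma> g x = Some (\<sigma> (\<psi> (inv_into UNIV \<sigma> x)))"
    if "\<sigma> (\<psi> (inv_into UNIV \<sigma> x)) \<noteq> x" for x
  proof -
    have "\<psi> (inv_into UNIV \<sigma> x) \<noteq> inv_into UNIV \<sigma> x" using that permutes_inverses(1)[OF s] by metis
    then show ?thesis using p by (simp add: below_def conj_map_def)
  qed
  ultimately show ?thesis by (simp add: below_def)
qed

lemma cycle_weight_conj_map:
  assumes f: "f \<in> class_functions n" and s: "\<sigma> permutes {0..<n}"
  shows "cycle_weight f n (conj_map \<sigma> g) = cycle_weight f n g"
proof -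
  let ?V = "{0..<n}" and ?i = "inv_into UNIV \<sigma>"
  have inv_perm: "?i permutes ?V" using permutes_inv[OF s] .
  have ii: "inv_into UNIV ?i = \<sigma>" using permutes_inv_inv[OF s] .
  have inv: "?i (\<sigma> x) = x" "\<sigma> (?i x) = x" for x using permutes_inverses[OF s] by auto
  have "bij_betw (\<lambda>\<psi>. \<sigma> \<circ> \<psi> \<circ> ?i) (below ?V g) (below ?V (conj_map \<sigma> g))"
  proof (rule bij_betwI[where g = "\<lambda>\<psi>. ?i \<circ> \<psi> \<circ> \<sigma>"])
    show "(\<lambda>\<psi>. \<sigma> \<circ> \<psi> \<circ> ?i) \<in> below ?V g \<rightarrow> below ?V (conj_map \<sigma> g)"
      using below_conj_map_subset[OF s] by blast
    show "(\<lambda>\<psi>. ?i \<circ> \<psi> \<circ> \<sigma>) \<in> below ?V (conj_map \<sigma> g) \<rightarrow> below ?V g"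
      using below_conj_map_subset[OF inv_perm, of _ "conj_map \<sigma> g"] conj_map_inv[OF s] ii by auto
  qed (simp_all add: fun_eq_iff inv)
  from sum.reindex_bij_betw[OF this, of f]
  have "cycle_weight f n (conj_map \<sigma> g) = (\<Sum>\<psi>\<in>below ?V g. f (\<sigma> \<circ> \<psi> \<circ> ?i))"
    by (simp add: cycle_weight_def)
  also have "\<dots> = cycle_weight f n g"
    unfolding cycle_weight_def using class_functions_conj[OF f s] by (intro sum.cong) (auto simp: below_def)
  finally show ?thesis .
qed

lemma orientation_sum_relabel:
  assumes f: "f \<in> class_functions n" and s: "\<sigma> permutes {0..<n}"
  shows "orientation_sum f n ((\<lambda>(x, y). (\<sigma> x, \<sigma> y)) ` E) r = orientation_sum f n E r"
proof -
  let ?i = "inv_into UNIV \<sigma>" and ?E = "(\<lambda>(x, y). (\<sigma> x, \<sigma> y)) ` E"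
  have inv_perm: "?i permutes {0..<n}" using permutes_inv[OF s] .
  have ii: "inv_into UNIV ?i = \<sigma>" using permutes_inv_inv[OF s] .
  have inv: "?i (\<sigma> x) = x" "\<sigma> (?i x) = x" for x using permutes_inverses[OF s] by auto
  have memE: "(\<sigma> x, \<sigma> y) \<in> ?E \<longleftrightarrow> (x, y) \<in> E" for x y
  proof
    assume "(\<sigma> x, \<sigma> y) \<in> ?E"
    then obtain a b where "(a, b) \<in> E" "\<sigma> x = \<sigma> a" "\<sigma> y = \<sigma> b" by auto
    then show "(x, y) \<in> E" using inv by metis
  qed (rule image_eqI[of _ _ "(x, y)"], simp_all)
  have "bij_betw (conj_map \<sigma>) (partial_orientations n E r) (partial_orientations n ?E r)"
  proof (rule bij_betwI[where g = "conj_map ?i"])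
    show "conj_map \<sigma> \<in> partial_orientations n E r \<rightarrow> partial_orientations n ?E r"
    proof
      fix g assume g: "g \<in> partial_orientations n E r"
      have "dom (conj_map \<sigma> g) \<subseteq> {0..<n}"
        using g permutes_image[OF s] unfolding dom_conj_map[OF s] partial_orientations_def by blast
      moreover have "(x, y) \<in> ?E" if "conj_map \<sigma> g x = Some y" for x y
      proof -
        obtain z where z: "g (?i x) = Some z" "y = \<sigma> z"
          using \<open>conj_map \<sigma> g x = Some y\<close> by (auto simp: conj_map_def)
        then have "(?i x, z) \<in> E" using g by (simp add: partial_orientations_def)
        then show ?thesis using memE[of "?i x" z] z inv by simp
      qed
      ultimately show "conj_map \<sigma> g \<in> partial_orientations n ?E r"
        using g by (simp add: partial_orientations_def card_dom_conj_map[OF s])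
    qed
    show "conj_map ?i \<in> partial_orientations n ?E r \<rightarrow> partial_orientations n E r"
    proof
      fix g assume g: "g \<in> partial_orientations n ?E r"
      have "dom (conj_map ?i g) \<subseteq> {0..<n}"
        using g permutes_image[OF inv_perm] unfolding dom_conj_map[OF inv_perm] partial_orientations_def by blast
      moreover have "(x, y) \<in> E" if "conj_map ?i g x = Some y" for x y
      proof -
        obtain z where z: "g (\<sigma> x) = Some z" "y = ?i z"
          using \<open>conj_map ?i g x = Some y\<close> by (auto simp: conj_map_def ii)
        then have "(\<sigma> x, z) \<in> ?E" using g unfolding partial_orientations_def by blast
        then show ?thesis using memE[of x y] z inv by simp
      qed
      ultimately show "conj_map ?i g \<in> partial_orientations n E r"
        using g by (simp add: partial_orientations_def card_dom_conj_map[OF inv_perm])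
    qed
    show "conj_map ?i (conj_map \<sigma> g) = g" for g by (rule conj_map_inv[OF s])
    show "conj_map \<sigma> (conj_map ?i g) = g" for g using conj_map_inv[OF inv_perm] ii by simp
  qed
  from sum.reindex_bij_betw[OF this, of "cycle_weight f n"] show ?thesis
    by (simp add: orientation_sum_def cycle_weight_conj_map[OF f s])
qed

text \<open>
  If no arc of \<open>g\<close> enters \<open>S\<close> from outside, then no directed cycle
  leaves \<open>S\<close>, and the arcs from \<open>S\<close> to the outside can be changed
  without effect on directed cycles.
\<close>

lemma below_redirect_subset:
  assumes S: "finite S"
    and out: "\<And>x. x \<notin> S \<Longrightarrow> g' x = g x"
    and ins: "\<And>x y. x \<in> S \<Longrightarrow> y \<in> S \<Longrightarrow> g x = Some y \<Longrightarrow> g' x = Some y"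
    and enter: "\<And>x y. x \<notin> S \<Longrightarrow> y \<in> S \<Longrightarrow> g x \<noteq> Some y"
  shows "below V g \<subseteq> below V g'"
proof
  fix \<psi> assume p: "\<psi> \<in> below V g"
  then have inj: "inj \<psi>" and surj: "surj \<psi>" 
    using permutes_inj[of \<psi> V] permutes_surj[of \<psi> V] by (simp_all add: below_def)
  have noenter: "\<psi> x \<notin> S" if "x \<notin> S" for x
    using p enter[OF that, of "\<psi> x"] that by (cases "\<psi> x = x") (auto simp: below_def)
  have "S \<subseteq> \<psi> ` S"
  proof
    fix y assume y: "y \<in> S"
    obtain x where "y = \<psi> x" using surj by blast
    then show "y \<in> \<psi> ` S" using noenter y by blast
  qed
  then have "\<psi> ` S = S" using S inj by (metis card_image card_subset_eq finite_imageI inj_on_subset subset_UNIV)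
  then have stay: "\<psi> x \<in> S" if "x \<in> S" for x using that by blast
  have "g' x = Some (\<psi> x)" if "\<psi> x \<noteq> x" for x
  proof -
    have "g x = Some (\<psi> x)" using p that by (simp add: below_def)
    then show ?thesis using out ins stay by (cases "x \<in> S") auto
  qed
  then show "\<psi> \<in> below V g'" using p by (simp add: below_def)
qed

lemma cycle_weight_redirect:
  assumes S: "finite S"
    and out: "\<And>x. x \<notin> S \<Longrightarrow> g' x = g x"
    and ins: "\<And>x y. x \<in> S \<Longrightarrow> y \<in> S \<Longrightarrow> g x = Some y \<longleftrightarrow> g' x = Some y"
    and enter: "\<And>x y. x \<notin> S \<Longrightarrow> y \<in> S \<Longrightarrow> g x \<noteq> Some y"
  shows "cycle_weight f n g' = cycle_weight f n g"
proof -
  have "below {0..<n} g \<subseteq> below {0..<n} g'"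
    by (rule below_redirect_subset[OF S]) (use out ins enter in auto)
  moreover have "below {0..<n} g' \<subseteq> below {0..<n} g"
    by (rule below_redirect_subset[OF S]) (use out ins enter in auto)
  ultimately show ?thesis by (simp add: cycle_weight_def)
qed

text \<open>
  The middle part, outside of \<open>A\<close> and \<open>B\<close>, has a symmetry
  \<open>\<sigma>\<close> that exchanges \<open>u\<close> and \<open>w\<close>; in
  \<open>E1\<close> the part \<open>A\<close> is attached at \<open>u\<close> and
  \<open>B\<close> at \<open>w\<close>, and in \<open>E2\<close> both at \<open>u\<close>. The
  map \<open>\<Phi>\<close> from the orientations of \<open>E2\<close> to those of
  \<open>E1\<close> preserves weights and is injective with the left inverse
  \<open>\<Psi>\<close>. The orientations of \<open>E1\<close> that are missed are those in
  which \<open>u\<close> points into \<open>A\<close> and \<open>w\<close> into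
  \<open>B\<close>.
\<close>

lemma orientation_sum_shift_le:
  assumes f: "f \<in> class_functions n" and W: "\<And>g. cycle_weight f n g \<ge> 0"
    and E1: "E1 \<subseteq> {0..<n} \<times> {0..<n}" and sym: "sym E1"
    and AB: "A \<subseteq> {0..<n}" "B \<subseteq> {0..<n}" "A \<inter> B = {}"
    and uw: "u \<notin> A \<union> B" "w \<notin> A \<union> B" "u \<noteq> w" "u < n"
    and s: "\<sigma> permutes {0..<n}" "\<And>x. \<sigma> (\<sigma> x) = x" "\<sigma> u = w" "\<And>x. x \<in> A \<union> B \<Longrightarrow> \<sigma> x = x"
    and hA: "\<And>x y. (x, y) \<in> E1 \<Longrightarrow> x \<in> A \<Longrightarrow> y \<in> A \<union> {u}"
    and hB: "\<And>x y. (x, y) \<in> E1 \<Longrightarrow> x \<in> B \<Longrightarrow> y \<in> B \<union> {w}"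
    and hM: "\<And>x y. (x, y) \<in> E1 \<Longrightarrow> x \<notin> A \<union> B \<Longrightarrow> y \<notin> A \<union> B \<Longrightarrow> (\<sigma> x, \<sigma> y) \<in> E1"
    and Z: "Z = {z \<in> B. (w, z) \<in> E1}"
    and E2: "E2 = (E1 - ({w} \<times> Z \<union> Z \<times> {w})) \<union> ({u} \<times> Z \<union> Z \<times> {u})"
  shows "orientation_sum f n E2 r \<le> orientation_sum f n E1 r"
proof -
  let ?O = "\<lambda>E. partial_orientations n E r"
  have inv\<sigma>: "inv_into UNIV \<sigma> = \<sigma>"
    using s(2) by (metis (no_types, opaque_lifting) ext permutes_inverses(2)[OF s(1)])
  have conj: "conj_map \<sigma> g x = map_option \<sigma> (g (\<sigma> x))" for g x by (simp add: conj_map_def inv\<sigma>)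
  have \<sigma>w: "\<sigma> w = u" using s(2,3) by metis
  have \<sigma>eq: "\<sigma> x = y \<longleftrightarrow> x = \<sigma> y" for x y using s(2) by metis
  have \<sigma>AB: "\<sigma> x \<in> A \<longleftrightarrow> x \<in> A" "\<sigma> x \<in> B \<longleftrightarrow> x \<in> B" for x using s(2,4) by (metis UnI1, metis UnI2)
  have symD: "(y, x) \<in> E1" if "(x, y) \<in> E1" for x y using sym that by (rule symD)
  have fin: "finite A" "finite B" using finite_subset[OF AB(1)] finite_subset[OF AB(2)] by auto
  define \<Phi>1 where "\<Phi>1 g x = (if x \<in> B \<and> g x = Some u then Some w else g x)" for g :: "nat \<Rightarrow> nat option" and x
  define \<Phi>2 where "\<Phi>2 g x = (if x \<in> A \<and> conj_map \<sigma> g x = Some w then Some u else conj_map \<sigma> g x)" for g x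
  define \<Phi> where "\<Phi> g = (if \<exists>z\<in>B. g u = Some z then \<Phi>2 g else \<Phi>1 g)" for g
  \<comment> \<open>the left inverse recognizes the case by whether \<open>w\<close> points into \<open>B\<close>\<close>
  define \<Psi>1 where "\<Psi>1 h x = (if x \<in> B \<and> h x = Some w then Some u else h x)" for h :: "nat \<Rightarrow> nat option" and x
  define \<Psi>2 where "\<Psi>2 h x = (if x \<in> A \<and> h x = Some u then Some w else h x)" for h :: "nat \<Rightarrow> nat option" and x
  define \<Psi> where "\<Psi> h = (if \<exists>z\<in>B. h w = Some z then conj_map \<sigma> (\<Psi>2 h) else \<Psi>1 h)" for h
  have E2cases: "((x, y) \<in> E1 \<and> \<not> (x = w \<and> y \<in> B) \<and> \<not> (x \<in> B \<and> y = w)) \<or> (x = u \<and> y \<in> B \<and> (w, y) \<in> E1) \<or>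
      (x \<in> B \<and> y = u \<and> (x, w) \<in> E1)" if "(x, y) \<in> E2" for x y
    using that symD unfolding E2 Z by blast
  have gE: "(x, y) \<in> E2" if "g \<in> ?O E2" "g x = Some y" for g x y
    using that by (simp add: partial_orientations_def)
  have OE2: "E2 \<subseteq> {0..<n} \<times> {0..<n}" using E1 AB uw(4) unfolding E2 Z by auto
  \<comment> \<open>\<open>B\<close> is moved back to \<open>w\<close>: no arc enters \<open>B\<close>, so the arcs from \<open>B\<close> to \<open>u\<close> are on no directed cycle\<close>
  have c1: "\<Phi>1 g \<in> ?O E1 \<and> cycle_weight f n (\<Phi>1 g) = cycle_weight f n g \<and> \<Psi> (\<Phi>1 g) = g"
    if g: "g \<in> ?O E2" and nB: "\<And>z. z \<in> B \<Longrightarrow> g u \<noteq> Some z" for g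
  proof (intro conjI)
    have dom: "dom (\<Phi>1 g) = dom g" by (auto simp: \<Phi>1_def dom_def)
    have edge: "(x, y) \<in> E1" if h: "\<Phi>1 g x = Some y" for x y
    proof (cases "x \<in> B \<and> g x = Some u")
      case True
      then have "(x, u) \<in> E2" using gE[OF g] by blast
      then have "(x, w) \<in> E1" using E2cases[of x u] True hB[of x u] uw by auto
      then show ?thesis using h True by (simp add: \<Phi>1_def)
    next
      case False
      then have gx: "g x = Some y" using h by (auto simp: \<Phi>1_def)
      then show ?thesis using E2cases[OF gE[OF g gx]] nB False by auto
    qed
    then show "\<Phi>1 g \<in> ?O E1" using g dom by (auto simp: partial_orientations_def)
    show "cycle_weight f n (\<Phi>1 g) = cycle_weight f n g"
    proof (rule cycle_weight_redirect[OF fin(2)])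
      show "\<And>x. x \<notin> B \<Longrightarrow> \<Phi>1 g x = g x" by (simp add: \<Phi>1_def)
      show "\<And>x y. x \<in> B \<Longrightarrow> y \<in> B \<Longrightarrow> g x = Some y \<longleftrightarrow> \<Phi>1 g x = Some y"
        using uw by (auto simp: \<Phi>1_def)
      fix x y assume xy: "x \<notin> B" "y \<in> B"
      show "g x \<noteq> Some y"
      proof
        assume gx: "g x = Some y"
        show False using E2cases[OF gE[OF g gx]] xy nB gx hB[OF symD, of x y] uw by auto
      qed
    qed
    have nw: "\<not> (\<exists>z\<in>B. \<Phi>1 g w = Some z)"
    proof
      assume "\<exists>z\<in>B. \<Phi>1 g w = Some z"
      then obtain z where z: "z \<in> B" "g w = Some z" using uw by (auto simp: \<Phi>1_def)
      then show False using E2cases[OF gE[OF g z(2)]] uw by auto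
    qed
    have "g x \<noteq> Some w" if "x \<in> B" for x
      using E2cases[OF gE[OF g, of x w]] that uw by auto
    then show "\<Psi> (\<Phi>1 g) = g" using nw by (auto simp: \<Psi>_def \<Psi>1_def \<Phi>1_def fun_eq_iff)
  qed
  \<comment> \<open>the middle is reflected, which carries \<open>A\<close> and \<open>B\<close> to \<open>w\<close>; then \<open>A\<close> is moved back to \<open>u\<close>, and no arc enters \<open>A\<close>\<close>
  have c2: "\<Phi>2 g \<in> ?O E1 \<and> cycle_weight f n (\<Phi>2 g) = cycle_weight f n g \<and> \<Psi> (\<Phi>2 g) = g"
    if g: "g \<in> ?O E2" and z0: "z0 \<in> B" "g u = Some z0" for g z0
  proof (intro conjI)
    have dom: "dom (\<Phi>2 g) = dom (conj_map \<sigma> g)" by (auto simp: \<Phi>2_def dom_def)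
    have gA: "conj_map \<sigma> g x \<noteq> Some u" if "x \<in> A" for x
    proof
      assume "conj_map \<sigma> g x = Some u"
      then have "g x = Some w" using s(3) s(4)[of x] that \<sigma>eq[of _ u] by (auto simp: conj)
      then show False using E2cases[OF gE[OF g]] hA[of x w] that uw AB by blast
    qed
    have edge: "(x, y) \<in> E1" if h: "\<Phi>2 g x = Some y" for x y
    proof (cases "x \<in> A \<and> conj_map \<sigma> g x = Some w")
      case True
      then have "g x = Some u" using s(4)[of x] \<sigma>eq \<sigma>w by (auto simp: conj)
      then have "(x, u) \<in> E1" using E2cases[OF gE[OF g]] True AB uw by blast
      then show ?thesis using h True by (simp add: \<Phi>2_def)
    next
      case False
      then have "conj_map \<sigma> g x = Some y" using h by (auto simp: \<Phi>2_def)
      then have gx: "g (\<sigma> x) = Some (\<sigma> y)" using s(2) by (auto simp: conj)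
      note e = E2cases[OF gE[OF g gx]]
      consider "x \<in> A" | "x \<in> B" | "x \<notin> A \<union> B" by blast
      then show ?thesis
      proof cases
        case 1
        then have \<sigma>x: "\<sigma> x = x" using s(4) by blast
        have e1: "(x, \<sigma> y) \<in> E1" using e 1 AB uw unfolding \<sigma>x by blast
        then have "\<sigma> y \<in> A \<union> {u}" using hA 1 by blast
        moreover have "\<sigma> y \<noteq> u" using False 1 gx \<sigma>x \<sigma>eq[of y u] s(3) by (auto simp: conj)
        ultimately have "\<sigma> y = y" using s(4) \<sigma>AB by blast
        then show ?thesis using e1 by simp
      next
        case 2
        then have \<sigma>x: "\<sigma> x = x" using s(4) by blast
        have "(x, \<sigma> y) \<in> E1 \<and> \<sigma> y \<in> B \<or> \<sigma> y = u \<and> (x, w) \<in> E1"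
          using e 2 hB[of x "\<sigma> y"] uw unfolding \<sigma>x by blast
        then show ?thesis using s(4) \<sigma>AB \<sigma>eq[of y u] s(3) by auto
      next
        case 3
        show ?thesis
        proof (cases "\<sigma> x = u")
          case True
          then have "\<sigma> y = z0" using gx z0 by simp
          then have yz: "y = z0" using z0 s(4) \<sigma>eq by (metis UnI2)
          have xw: "x = w" using True \<sigma>eq s(3) by metis
          have "(w, z0) \<in> E1" using E2cases[OF gE[OF g z0(2)]] z0 hB[OF symD, of u z0] uw by blast
          then show ?thesis using yz xw by simp
        next
          case False
          have nAB: "\<sigma> x \<notin> A \<union> B" using 3 \<sigma>AB by blast
          have e1: "(\<sigma> x, \<sigma> y) \<in> E1" "\<not> (\<sigma> x = w \<and> \<sigma> y \<in> B)" using e False nAB by blast+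
          have "\<sigma> y \<notin> A \<union> B" using e1 hA[OF symD[OF e1(1)]] hB[OF symD[OF e1(1)]] False nAB by blast
          then show ?thesis using hM[OF e1(1) nAB] s(2) by simp
        qed
      qed
    qed
    have "dom (conj_map \<sigma> g) \<subseteq> {0..<n}"
      using g permutes_image[OF s(1)] unfolding dom_conj_map[OF s(1)] partial_orientations_def by blast
    then show "\<Phi>2 g \<in> ?O E1"
      using g dom edge card_dom_conj_map[OF s(1)] by (auto simp: partial_orientations_def)
    have "cycle_weight f n (\<Phi>2 g) = cycle_weight f n (conj_map \<sigma> g)"
    proof (rule cycle_weight_redirect[OF fin(1)])
      show "\<And>x. x \<notin> A \<Longrightarrow> \<Phi>2 g x = conj_map \<sigma> g x" by (simp add: \<Phi>2_def)
      show "\<And>x y. x \<in> A \<Longrightarrow> y \<in> A \<Longrightarrow> conj_map \<sigma> g x = Some y \<longleftrightarrow> \<Phi>2 g x = Some y"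
        using uw by (auto simp: \<Phi>2_def)
      fix x y assume xy: "x \<notin> A" "y \<in> A"
      show "conj_map \<sigma> g x \<noteq> Some y"
      proof
        assume "conj_map \<sigma> g x = Some y"
        then have gx: "g (\<sigma> x) = Some y" using s(2,4) xy by (auto simp: conj) (metis UnI1)
        have nx: "\<sigma> x \<notin> A" using xy \<sigma>AB by blast
        have "(\<sigma> x, y) \<in> E1" using E2cases[OF gE[OF g gx]] xy AB uw by blast
        then have "\<sigma> x = u" using hA[OF symD] xy nx by blast
        then show False using gx z0 xy AB by auto
      qed
    qed
    then show "cycle_weight f n (\<Phi>2 g) = cycle_weight f n g" by (simp add: cycle_weight_conj_map[OF f s(1)])
    have "\<Phi>2 g w = Some z0" using z0 \<sigma>w s(4)[of z0] uw by (auto simp: \<Phi>2_def conj)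
    then have "\<Psi> (\<Phi>2 g) = conj_map \<sigma> (\<Psi>2 (\<Phi>2 g))" using z0 by (auto simp: \<Psi>_def)
    also have "\<Psi>2 (\<Phi>2 g) = conj_map \<sigma> g" using gA by (auto simp: \<Psi>2_def \<Phi>2_def fun_eq_iff)
    also have "conj_map \<sigma> (conj_map \<sigma> g) = g" using conj_map_inv[OF s(1), of g] by (simp only: inv\<sigma>)
    finally show "\<Psi> (\<Phi>2 g) = g" .
  qed
  have \<Phi>: "\<Phi> g \<in> ?O E1 \<and> cycle_weight f n (\<Phi> g) = cycle_weight f n g \<and> \<Psi> (\<Phi> g) = g" if "g \<in> ?O E2" for g
    using c1[OF that] c2[OF that] by (auto simp: \<Phi>_def)
  have inj: "inj_on \<Phi> (?O E2)" using \<Phi> by (intro inj_on_inverseI[of _ \<Psi>]) blast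
  have "orientation_sum f n E2 r = (\<Sum>g\<in>?O E2. cycle_weight f n (\<Phi> g))"
    unfolding orientation_sum_def using \<Phi> by (intro sum.cong) auto
  also have "\<dots> = (\<Sum>g\<in>\<Phi> ` ?O E2. cycle_weight f n g)" by (simp add: sum.reindex[OF inj])
  also have "\<dots> \<le> orientation_sum f n E1 r"
    unfolding orientation_sum_def
    by (rule sum_mono2[OF finite_partial_orientations[OF E1]]) (use \<Phi> W in auto)
  finally show ?thesis .
qed

section \<open>Coefficients of the generalized matrix function\<close>

text \<open>The set \<open>S\<close> collects the factors from which the variable is taken.\<close>

lemma coeff_prod_linear:
  fixes a :: "'i \<Rightarrow> rat"
  assumes "finite F"
  shows "Polynomial.coeff (\<Prod>i\<in>F. [:a i, 1:]) k = (\<Sum>S | S \<subseteq> F \<and> card S = k. \<Prod>i\<in>F - S. a i)"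
proof -
  have "(\<Prod>i\<in>F. [:a i, 1:]) = (\<Prod>i\<in>F. [:0, 1:] + [:a i:])" by simp
  also have "\<dots> = (\<Sum>S\<in>Pow F. (\<Prod>i\<in>S. [:0, 1:]) * (\<Prod>i\<in>F - S. [:a i:]))"
    by (rule prod_add[OF assms])
  also have "\<dots> = (\<Sum>S\<in>Pow F. Polynomial.monom (\<Prod>i\<in>F - S. a i) (card S))"
  proof (rule sum.cong[OF refl])
    fix S assume "S \<in> Pow F"
    have "(\<Prod>i\<in>A. [:a i:]) = [:\<Prod>i\<in>A. a i:]" for A
      by (induction A rule: infinite_finite_induct) auto
    then show "(\<Prod>i\<in>S. [:0, 1:]) * (\<Prod>i\<in>F - S. [:a i:]) = Polynomial.monom (\<Prod>i\<in>F - S. a i) (card S)"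
      by (simp add: monom_altdef mult.commute)
  qed
  finally have "Polynomial.coeff (\<Prod>i\<in>F. [:a i, 1:]) k = (\<Sum>S\<in>Pow F. if card S = k then \<Prod>i\<in>F - S. a i else 0)"
    by (simp add: coeff_sum)
  also have "\<dots> = (\<Sum>S | S \<in> Pow F \<and> card S = k. \<Prod>i\<in>F - S. a i)"
    using assms by (intro sum.inter_filter[symmetric]) simp
  finally show ?thesis by simp
qed

definition nbrs :: "(nat \<times> nat) set \<Rightarrow> nat \<Rightarrow> nat set" where
  "nbrs E x = {y. (x, y) \<in> E}"

text \<open>
  An orientation above \<open>\<psi>\<close> is determined on the points moved by
  \<open>\<psi>\<close>; the set \<open>S\<close> consists of the fixed points that are left
  without orientation, and each of the other fixed points chooses a neighbour.
\<close>

lemma card_orientations_above: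
  assumes E: "E \<subseteq> {0..<n} \<times> {0..<n}" and p: "\<psi> permutes {0..<n}" and r: "r \<le> n"
    and edges: "\<And>i. \<psi> i \<noteq> i \<Longrightarrow> (i, \<psi> i) \<in> E"
  defines "F \<equiv> {i \<in> {0..<n}. \<psi> i = i}"
  shows "card {g \<in> partial_orientations n E r. \<psi> \<in> below {0..<n} g} =
    (\<Sum>S | S \<subseteq> F \<and> card S = n - r. \<Prod>i\<in>F - S. card (nbrs E i))"
proof -
  let ?V = "{0..<n}"
  let ?Q = "\<lambda>S. {g. dom g = ?V - S \<and> (\<forall>x y. g x = Some y \<longrightarrow> (x, y) \<in> E) \<and> (\<forall>x. \<psi> x \<noteq> x \<longrightarrow> g x = Some (\<psi> x))}"
  let ?I = "{S. S \<subseteq> F \<and> card S = n - r}"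
  have FV: "F \<subseteq> ?V" and fF: "finite F" by (auto simp: F_def)
  have fnb: "finite (nbrs E i)" for i
    using E finite_subset[of "nbrs E i" ?V] by (auto simp: nbrs_def)
  have mv: "i \<in> ?V" if "\<psi> i \<noteq> i" for i using permutes_not_in[OF p] that by blast
  have card_Q: "card (?Q S) = (\<Prod>i\<in>F - S. card (nbrs E i)) \<and> finite (?Q S)" if S: "S \<subseteq> F" for S
  proof -
    let ?h = "\<lambda>h x. if \<psi> x \<noteq> x then Some (\<psi> x) else if x \<in> F - S then Some (h x) else None"
    have bij: "bij_betw ?h (PiE (F - S) (nbrs E)) (?Q S)"
    proof (rule bij_betwI[where g = "\<lambda>g. restrict (\<lambda>x. the (g x)) (F - S)"])
      show "?h \<in> PiE (F - S) (nbrs E) \<rightarrow> ?Q S"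
      proof
        fix h assume h: "h \<in> PiE (F - S) (nbrs E)"
        have "dom (?h h) = ?V - S" using S mv by (auto simp: F_def dom_def split: if_splits)
        moreover have "(x, y) \<in> E" if "?h h x = Some y" for x y
          using that h edges by (auto simp: PiE_def nbrs_def split: if_splits)
        ultimately show "?h h \<in> ?Q S" by auto
      qed
      show "(\<lambda>g. restrict (\<lambda>x. the (g x)) (F - S)) \<in> ?Q S \<rightarrow> PiE (F - S) (nbrs E)"
      proof
        fix g assume g: "g \<in> ?Q S"
        have "the (g x) \<in> nbrs E x" if "x \<in> F - S" for x
        proof -
          have "x \<in> dom g" using g that FV by blast
          then obtain y where "g x = Some y" by blast
          then show ?thesis using g by (simp add: nbrs_def)
        qed
        then show "restrict (\<lambda>x. the (g x)) (F - S) \<in> PiE (F - S) (nbrs E)" by auto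
      qed
      fix h assume h: "h \<in> PiE (F - S) (nbrs E)"
      have "\<psi> x = x" if "x \<in> F" for x using that by (simp add: F_def)
      then show "restrict (\<lambda>x. the (?h h x)) (F - S) = h"
        using h by (auto simp: fun_eq_iff PiE_def extensional_def restrict_def)
    next
      fix g assume g: "g \<in> ?Q S"
      show "?h (restrict (\<lambda>x. the (g x)) (F - S)) = g"
      proof
        fix x
        consider "\<psi> x \<noteq> x" | "\<psi> x = x" "x \<in> F - S" | "\<psi> x = x" "x \<notin> F - S" by blast
        then show "?h (restrict (\<lambda>x. the (g x)) (F - S)) x = g x"
        proof cases
          case 1
          then show ?thesis using g by auto
        next
          case 2
          then have "x \<in> dom g" using g FV by blast
          then show ?thesis using 2 by auto
        next
          case 3
          then have "x \<notin> dom g" using g by (auto simp: F_def)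
          then show ?thesis using 3 by (auto simp: dom_def)
        qed
      qed
    qed
    have "finite (PiE (F - S) (nbrs E))" using fF fnb by (intro finite_PiE) auto
    then have "finite (?Q S)" using bij_betw_finite[OF bij] by blast
    then show ?thesis using fF bij_betw_same_card[OF bij] by (simp add: card_PiE)
  qed
  have eq: "{g \<in> partial_orientations n E r. \<psi> \<in> below ?V g} = (\<Union>S\<in>?I. ?Q S)"
  proof
    show "{g \<in> partial_orientations n E r. \<psi> \<in> below ?V g} \<subseteq> (\<Union>S\<in>?I. ?Q S)"
    proof
      fix g assume g: "g \<in> {g \<in> partial_orientations n E r. \<psi> \<in> below ?V g}"
      then have d: "dom g \<subseteq> ?V" "card (dom g) = r" by (auto simp: partial_orientations_def)
      have gm: "g x = Some (\<psi> x)" if "\<psi> x \<noteq> x" for x using g that by (simp add: below_def)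
      have "?V - dom g \<subseteq> F" using gm by (auto simp: F_def)
      moreover have "card (?V - dom g) = n - r" using d by (simp add: card_Diff_subset finite_subset)
      moreover have "dom g = ?V - (?V - dom g)" using d by blast
      ultimately show "g \<in> (\<Union>S\<in>?I. ?Q S)"
        using g gm by (intro UN_I[of "?V - dom g"]) (auto simp: partial_orientations_def)
    qed
    show "(\<Union>S\<in>?I. ?Q S) \<subseteq> {g \<in> partial_orientations n E r. \<psi> \<in> below ?V g}"
    proof
      fix g assume "g \<in> (\<Union>S\<in>?I. ?Q S)"
      then obtain S where S: "S \<subseteq> F" "card S = n - r" and g: "g \<in> ?Q S" by blast
      have "finite S" "S \<subseteq> ?V" using S FV fF finite_subset by auto
      then have "card (?V - S) = r" using S r by (simp add: card_Diff_subset)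
      then show "g \<in> {g \<in> partial_orientations n E r. \<psi> \<in> below ?V g}"
        using g p by (auto simp: partial_orientations_def below_def)
    qed
  qed
  have "card (\<Union>S\<in>?I. ?Q S) = (\<Sum>S\<in>?I. card (?Q S))"
  proof (rule card_UN_disjoint)
    show "finite ?I" using fF by simp
    show "\<forall>S\<in>?I. finite (?Q S)" using card_Q by blast
    show "\<forall>S\<in>?I. \<forall>S'\<in>?I. S \<noteq> S' \<longrightarrow> ?Q S \<inter> ?Q S' = {}"
    proof (intro ballI impI)
      fix S S' assume S: "S \<in> ?I" "S' \<in> ?I" "S \<noteq> S'"
      then have "?V - S \<noteq> ?V - S'" using FV by auto
      then show "?Q S \<inter> ?Q S' = {}" by (intro equals0I) (elim IntE CollectE conjE, simp)
    qed
  qed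
  also have "\<dots> = (\<Sum>S\<in>?I. \<Prod>i\<in>F - S. card (nbrs E i))" using card_Q by (intro sum.cong) auto
  finally show ?thesis unfolding eq .
qed

text \<open>
  The permutation exchanges the moved points in \<open>A\<close> with those outside of
  \<open>A\<close>.
\<close>

lemma even_moved_bipartite:
  assumes p: "\<psi> permutes {0..<n :: nat}" and edges: "\<And>i. \<psi> i \<noteq> i \<Longrightarrow> (i, \<psi> i) \<in> E"
    and A: "\<And>x y. (x, y) \<in> E \<Longrightarrow> x \<in> A \<longleftrightarrow> y \<notin> A"
  shows "even (card {i \<in> {0..<n}. \<psi> i \<noteq> i})"
proof -
  let ?M = "{i \<in> {0..<n}. \<psi> i \<noteq> i}"
  have inj: "inj \<psi>" using permutes_inj[OF p] .
  have mv: "\<psi> i \<in> ?M" if "i \<in> ?M" for i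
    using that permutes_in_image[OF p] injD[OF inj] by auto
  have "\<psi> ` (?M \<inter> A) \<subseteq> ?M - A" using mv A edges by blast
  then have 1: "card (?M \<inter> A) \<le> card (?M - A)"
    by (rule card_inj_on_le[rotated]) (auto intro: inj_on_subset[OF inj])
  have "\<psi> ` (?M - A) \<subseteq> ?M \<inter> A" using mv A edges by blast
  then have "card (?M - A) \<le> card (?M \<inter> A)"
    by (rule card_inj_on_le[rotated]) (auto intro: inj_on_subset[OF inj])
  then have "card (?M - A) = card (?M \<inter> A)" using 1 by simp
  moreover have "card ?M = card (?M \<inter> A) + card (?M - A)"
    by (rule card_Int_Diff) simp
  ultimately show ?thesis by simp
qed

lemma simple_graph_onD:
  assumes "simple_graph_on n G"
  shows "parcs G \<subseteq> {0..<n} \<times> {0..<n}" "sym (parcs G)" "(x, x) \<notin> parcs G"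
proof -
  interpret pair_graph G using assms by (simp add: simple_graph_on_def)
  have "pverts G = {0..<n}" using assms by (simp add: simple_graph_on_def)
  then show "parcs G \<subseteq> {0..<n} \<times> {0..<n}" using in_arcsD1 in_arcsD2 by fastforce
  show "sym (parcs G)" using arcs_symmetric by (auto simp: sym_def)
  show "(x, x) \<notin> parcs G" using no_loops' by blast
qed

lemma out_degree_nbrs: "out_degree (with_proj G) i = card (nbrs (parcs G) i)"
proof -
  have "out_arcs (with_proj G) i = Pair i ` nbrs (parcs G) i"
    by (auto simp: out_arcs_def nbrs_def)
  then show ?thesis by (simp add: out_degree_def card_image inj_on_def)
qed

text \<open>
  Off the diagonal $xI - L$ has the entries of the adjacency matrix, so only permutations along
  edges contribute. The sign $(-1)^r$ cancels the signs of the $d_i$ taken from the diagonal,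
  since their number differs from $r$ by the even number of moved points.
\<close>

lemma b_coeff_eq_orientation_sum:
  assumes G: "simple_graph_on n G" and bip: "bipartite G" and r: "r \<le> n"
  shows "b_coeff \<tau> r (laplacian n G) = orientation_sum (frob_ch_inv n \<tau>) n (parcs G) r"
proof -
  let ?V = "{0..<n}" and ?E = "parcs G" and ?f = "frob_ch_inv n \<tau>"
  let ?P = "{\<psi>. \<psi> permutes ?V}"
  note E = simple_graph_onD[OF G]
  obtain A where "\<forall>(x, y) \<in> ?E. x \<in> A \<longleftrightarrow> y \<notin> A" using bip unfolding bipartite_def by blast
  then have A: "x \<in> A \<longleftrightarrow> y \<notin> A" if "(x, y) \<in> ?E" for x y using that by fast
  let ?O = "partial_orientations n ?E r"
  let ?L = "char_poly_matrix (laplacian n G)"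
  have dim: "dim_row (laplacian n G) = n" "dim_row ?L = n" by (simp_all add: laplacian_def adjacency_matrix_def char_poly_matrix_def)
  have ent: "?L $$ (i, j) = (if i = j then [:- of_nat (card (nbrs ?E i)), 1:] else if (i, j) \<in> ?E then 1 else 0)"
    if "i < n" "j < n" for i j
    using that E(3)[of i] by (auto simp: char_poly_matrix_def laplacian_def degree_matrix_def adjacency_matrix_def
      out_degree_nbrs one_pCons)
  have term_eq: "(- 1) ^ r * Polynomial.coeff (\<Prod>i = 0..<n. ?L $$ (i, \<psi> i)) (n - r) =
    of_nat (card {g \<in> ?O. \<psi> \<in> below ?V g})" if p: "\<psi> permutes ?V" for \<psi>
  proof -
    let ?F = "{i \<in> ?V. \<psi> i = i}" and ?M = "{i \<in> ?V. \<psi> i \<noteq> i}"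
    have pi: "\<psi> i < n \<longleftrightarrow> i < n" for i using permutes_in_image[OF p, of i] by simp
    have split: "?V = ?F \<union> ?M" "?F \<inter> ?M = {}" by auto
    have "(\<Prod>i = 0..<n. ?L $$ (i, \<psi> i)) = (\<Prod>i\<in>?F. ?L $$ (i, \<psi> i)) * (\<Prod>i\<in>?M. ?L $$ (i, \<psi> i))"
      by (subst split(1), rule prod.union_disjoint) auto
    also have "(\<Prod>i\<in>?F. ?L $$ (i, \<psi> i)) = (\<Prod>i\<in>?F. [:- of_nat (card (nbrs ?E i)), 1:])"
      using ent by (intro prod.cong) auto
    also have "(\<Prod>i\<in>?M. ?L $$ (i, \<psi> i)) = (\<Prod>i\<in>?M. if (i, \<psi> i) \<in> ?E then 1 else 0)"
      using ent pi by (intro prod.cong) auto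
    also have "\<dots> = (if \<forall>i\<in>?M. (i, \<psi> i) \<in> ?E then 1 else 0)"
      by (auto intro!: prod.neutral)
    finally have prod: "(\<Prod>i = 0..<n. ?L $$ (i, \<psi> i)) =
      (\<Prod>i\<in>?F. [:- of_nat (card (nbrs ?E i)), 1:]) * (if \<forall>i\<in>?M. (i, \<psi> i) \<in> ?E then 1 else 0)" .
    show ?thesis
    proof (cases "\<forall>i\<in>?M. (i, \<psi> i) \<in> ?E")
      case False
      then obtain i where i: "i \<in> ?M" "(i, \<psi> i) \<notin> ?E" by blast
      have "\<psi> \<notin> below ?V g" if "g \<in> ?O" for g
        using that i by (auto simp: below_def partial_orientations_def)
      then have "{g \<in> ?O. \<psi> \<in> below ?V g} = {}" by blast
      then have "card {g \<in> ?O. \<psi> \<in> below ?V g} = 0" by (simp only: card.empty)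
      then show ?thesis unfolding prod if_not_P[OF False] by simp
    next
      case True
      have edges: "(i, \<psi> i) \<in> ?E" if "\<psi> i \<noteq> i" for i
        using True that permutes_not_in[OF p, of i] by auto
      have sign: "(- 1) ^ r * (\<Prod>i\<in>?F - S. - of_nat (card (nbrs ?E i)) :: rat) = (\<Prod>i\<in>?F - S. of_nat (card (nbrs ?E i)))"
        if S: "S \<subseteq> ?F" "card S = n - r" for S
      proof -
        have ev: "even (card ?M)" by (rule even_moved_bipartite[OF p edges A])
        have "card (?F \<union> ?M) = card ?F + card ?M" by (rule card_Un_disjoint) auto
        then have "card ?F + card ?M = n" unfolding split(1)[symmetric] by simp
        moreover have "card (?F - S) = card ?F - (n - r)" using S by (simp add: card_Diff_subset finite_subset)
        moreover have "n - r \<le> card ?F" using S card_mono[of ?F S] by simp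
        ultimately have "card (?F - S) + card ?M = r" using r by simp
        then have "even (r + card (?F - S))" using ev by auto
        then have "(- 1 :: rat) ^ r * (- 1) ^ card (?F - S) = 1" by (simp flip: power_add)
        moreover have "(\<Prod>i\<in>?F - S. - of_nat (card (nbrs ?E i)) :: rat) =
          (- 1) ^ card (?F - S) * (\<Prod>i\<in>?F - S. of_nat (card (nbrs ?E i)))"
          by (subst prod_uminus) simp
        ultimately show ?thesis by (simp flip: mult.assoc)
      qed
      have "(- 1) ^ r * Polynomial.coeff (\<Prod>i\<in>?F. [:- of_nat (card (nbrs ?E i)), 1:]) (n - r) =
        (\<Sum>S | S \<subseteq> ?F \<and> card S = n - r. (- 1) ^ r * (\<Prod>i\<in>?F - S. - of_nat (card (nbrs ?E i)) :: rat))"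
        by (subst coeff_prod_linear) (simp_all add: sum_distrib_left)
      also have "\<dots> = (\<Sum>S | S \<subseteq> ?F \<and> card S = n - r. \<Prod>i\<in>?F - S. of_nat (card (nbrs ?E i)))"
        using sign by (intro sum.cong) auto
      also have "\<dots> = of_nat (card {g \<in> ?O. \<psi> \<in> below ?V g})"
        by (subst card_orientations_above[OF E(1) p r edges]) simp_all
      finally show ?thesis unfolding prod using True by simp
    qed
  qed
  have fP: "finite ?P" by (simp add: finite_permutations)
  have fO: "finite ?O" by (rule finite_partial_orientations[OF E(1)])
  have "b_coeff \<tau> r (laplacian n G) =
    (\<Sum>\<psi>\<in>?P. ?f \<psi> * ((- 1) ^ r * Polynomial.coeff (\<Prod>i = 0..<n. ?L $$ (i, \<psi> i)) (n - r)))"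
    by (simp add: b_coeff_def GMF_def dim coeff_sum sum_distrib_left mult.left_commute)
  also have "\<dots> = (\<Sum>\<psi>\<in>?P. ?f \<psi> * of_nat (card {g \<in> ?O. \<psi> \<in> below ?V g}))"
    using term_eq by (intro sum.cong) auto
  also have "\<dots> = (\<Sum>\<psi>\<in>?P. \<Sum>g | g \<in> ?O \<and> \<psi> \<in> below ?V g. ?f \<psi>)" by (simp add: mult.commute)
  also have "\<dots> = (\<Sum>g\<in>?O. \<Sum>\<psi> | \<psi> \<in> ?P \<and> \<psi> \<in> below ?V g. ?f \<psi>)"
    by (rule sum.swap_restrict[OF fP fO])
  also have "\<dots> = orientation_sum ?f n ?E r"
    unfolding orientation_sum_def cycle_weight_def
  proof (rule sum.cong[OF refl])
    fix g
    have "{\<psi>. \<psi> \<in> ?P \<and> \<psi> \<in> below ?V g} = below ?V g" by (auto simp: below_def)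
    then show "(\<Sum>\<psi> | \<psi> \<in> ?P \<and> \<psi> \<in> below ?V g. ?f \<psi>) = sum ?f (below ?V g)" by simp
  qed
  finally show ?thesis .
qed

section \<open>One generalized graph shift\<close>

definition path_arcs :: "'a list \<Rightarrow> ('a \<times> 'a) set" where
  "path_arcs vs = {(vs ! i, vs ! Suc i) | i. Suc i < length vs} \<union> {(vs ! Suc i, vs ! i) | i. Suc i < length vs}"

definition path_reversal :: "'a list \<Rightarrow> 'a \<Rightarrow> 'a" where
  "path_reversal vs x = (case map_of (zip vs (rev vs)) x of None \<Rightarrow> x | Some y \<Rightarrow> y)"

lemma path_reversal_nth:
  assumes "distinct vs" "i < length vs"
  shows "path_reversal vs (vs ! i) = vs ! (length vs - Suc i)"
  using assms by (simp add: path_reversal_def map_of_zip_nth rev_nth)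

lemma path_reversal_notin:
  assumes "x \<notin> set vs" shows "path_reversal vs x = x"
proof -
  have "map_of (zip vs (rev vs)) x = None" using assms by (simp add: map_of_zip_is_None)
  then show ?thesis unfolding path_reversal_def by (simp only: option.case)
qed

lemma path_reversal_involution:
  assumes "distinct vs" shows "path_reversal vs (path_reversal vs x) = x"
proof (cases "x \<in> set vs")
  case True
  then obtain i where "i < length vs" "x = vs ! i" by (auto simp: in_set_conv_nth)
  then show ?thesis using path_reversal_nth[OF assms] by simp
qed (simp add: path_reversal_notin)

lemma path_reversal_permutes:
  assumes "distinct vs" "set vs \<subseteq> V" shows "path_reversal vs permutes V"
  unfolding permutes_def
proof (intro conjI allI impI)
  fix x assume "x \<notin> V"
  then show "path_reversal vs x = x" using assms(2) by (intro path_reversal_notin) blast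
next
  fix y show "\<exists>!x. path_reversal vs x = y" using path_reversal_involution[OF assms(1)] by metis
qed

lemma path_reversal_arcs:
  assumes "distinct vs" "(x, y) \<in> path_arcs vs"
  shows "(path_reversal vs x, path_reversal vs y) \<in> path_arcs vs"
proof -
  have 1: "(path_reversal vs (vs ! i), path_reversal vs (vs ! Suc i)) \<in> path_arcs vs"
    and 2: "(path_reversal vs (vs ! Suc i), path_reversal vs (vs ! i)) \<in> path_arcs vs"
    if i: "Suc i < length vs" for i
  proof -
    let ?j = "length vs - Suc (Suc i)"
    have "Suc ?j < length vs" "length vs - Suc i = Suc ?j" using i by auto
    moreover have "path_reversal vs (vs ! i) = vs ! (length vs - Suc i)"
      "path_reversal vs (vs ! Suc i) = vs ! ?j"
      using i path_reversal_nth[OF assms(1)] by simp_all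
    ultimately show "(path_reversal vs (vs ! i), path_reversal vs (vs ! Suc i)) \<in> path_arcs vs"
      "(path_reversal vs (vs ! Suc i), path_reversal vs (vs ! i)) \<in> path_arcs vs"
      unfolding path_arcs_def by auto
  qed
  then show ?thesis using assms(2) by (auto simp: path_arcs_def)
qed

text \<open>The middle part is a path, whose symmetry is the reversal.\<close>

lemma orientation_sum_path_shift_le:
  assumes f: "f \<in> class_functions n" and W: "\<And>g. cycle_weight f n g \<ge> 0"
    and E: "E \<subseteq> {0..<n} \<times> {0..<n}" and sym: "sym E"
    and vs: "distinct vs" "set vs \<subseteq> {0..<n}" "length vs \<ge> 2"
    and B: "B \<subseteq> {0..<n}" "B \<inter> set vs = {}"
    and hB: "\<And>x y. (x, y) \<in> E \<Longrightarrow> x \<in> B \<Longrightarrow> y \<in> B \<union> {last vs}"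
    and hP: "\<And>x y. x \<in> set vs \<Longrightarrow> y \<in> set vs \<Longrightarrow> (x, y) \<in> E \<longleftrightarrow> (x, y) \<in> path_arcs vs"
    and hI: "\<And>x y. x \<in> set vs \<Longrightarrow> x \<noteq> hd vs \<Longrightarrow> (x, y) \<in> E \<Longrightarrow> y \<in> set vs \<or> x = last vs \<and> y \<in> B"
    and Z: "Z = {z \<in> B. (last vs, z) \<in> E}"
  shows "orientation_sum f n ((E - ({last vs} \<times> Z \<union> Z \<times> {last vs})) \<union> ({hd vs} \<times> Z \<union> Z \<times> {hd vs})) r
    \<le> orientation_sum f n E r"
proof -
  let ?u = "hd vs" and ?w = "last vs" and ?A = "{0..<n} - B - set vs" and ?\<sigma> = "path_reversal vs"
  have ne: "vs \<noteq> []" using vs(3) by auto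
  have u: "?u = vs ! 0" "?u \<in> set vs" and w: "?w = vs ! (length vs - 1)" "?w \<in> set vs"
    using ne by (simp_all add: hd_conv_nth last_conv_nth)
  have "?u \<noteq> ?w"
    unfolding u(1) w(1) using vs(3) ne by (subst nth_eq_iff_index_eq[OF vs(1)]) auto
  have symD: "(y, x) \<in> E" if "(x, y) \<in> E" for x y using sym that by (rule symD)
  show ?thesis
  proof (rule orientation_sum_shift_le[OF f W E sym, where A = ?A and B = B and \<sigma> = ?\<sigma>])
    show "?u \<notin> ?A \<union> B" "?w \<notin> ?A \<union> B" using u w B by auto
    show "?u < n" using u vs by auto
    show "?\<sigma> permutes {0..<n}" by (rule path_reversal_permutes[OF vs(1,2)])
    show "\<And>x. ?\<sigma> (?\<sigma> x) = x" by (rule path_reversal_involution[OF vs(1)])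
    show "?\<sigma> ?u = ?w" unfolding u(1) using path_reversal_nth[OF vs(1), of 0] ne w(1) by simp
    show "\<And>x. x \<in> ?A \<union> B \<Longrightarrow> ?\<sigma> x = x" using B by (intro path_reversal_notin) blast
    show "y \<in> ?A \<union> {?u}" if "(x, y) \<in> E" "x \<in> ?A" for x y
      using that E symD[OF that(1)] hB[of y x] hI[of y x] w by blast
    show "(?\<sigma> x, ?\<sigma> y) \<in> E" if e: "(x, y) \<in> E" and xy: "x \<notin> ?A \<union> B" "y \<notin> ?A \<union> B" for x y
    proof -
      have m: "x \<in> set vs" "y \<in> set vs" using e E xy by auto
      then have "(?\<sigma> x, ?\<sigma> y) \<in> path_arcs vs" using path_reversal_arcs[OF vs(1)] hP e by blast
      moreover have "?\<sigma> z \<in> set vs" if "z \<in> set vs" for z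
        using permutes_in_image[OF path_reversal_permutes[OF vs(1) order_refl]] that by blast
      ultimately show ?thesis using hP m by blast
    qed
  qed (use B hB Z \<open>?u \<noteq> ?w\<close> in auto)
qed

lemma pcas_zip:
  assumes "xs \<noteq> []"
  shows "pcas (hd xs) (zip xs (tl xs)) (last xs)" "pawalk_verts (hd xs) (zip xs (tl xs)) = xs"
  using assms
proof (induction xs rule: list_nonempty_induct)
  case (cons x xs)
  { case 1 show ?case using cons by (cases xs) auto }
  { case 2 show ?case using cons by (cases xs) auto }
qed auto

lemma pcas_imp_zip:
  "pcas u p v \<Longrightarrow> p = zip (pawalk_verts u p) (tl (pawalk_verts u p)) \<and>
     pawalk_verts u p = map fst p @ [v] \<and> hd (pawalk_verts u p) = u"
proof (induction p arbitrary: u)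
  case (Cons e p)
  obtain a b where e: "e = (a, b)" by (cases e)
  have ua: "u = a" and cas: "pcas b p v" using Cons.prems by (auto simp: e)
  define W where "W = pawalk_verts b p"
  have IH: "p = zip W (tl W)" "W = map fst p @ [v]" "hd W = b"
    using Cons.IH[OF cas] unfolding W_def by blast+
  have "W = b # tl W" using IH(2,3) by (cases W) auto
  then have "zip (a # W) W = (a, b) # zip W (tl W)" by (metis zip_Cons_Cons)
  then have "e # p = zip (a # W) (tl (a # W))" using IH(1) by (simp add: e)
  moreover have "a # W = map fst (e # p) @ [v]" using IH(2) by (simp add: e)
  moreover have "pawalk_verts u (e # p) = a # W" by (simp add: e ua W_def)
  ultimately show ?case unfolding ua by (metis list.sel(1))
qed auto

lemma set_zip_tl: "set (zip xs (tl xs)) = {(xs ! i, xs ! Suc i) | i. Suc i < length xs}"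
proof -
  have "(\<exists>i. p = (xs ! i, tl xs ! i) \<and> i < min (length xs) (length (tl xs))) \<longleftrightarrow>
      (\<exists>i. p = (xs ! i, xs ! Suc i) \<and> Suc i < length xs)" for p
    by (rule ex_cong1) (auto simp: nth_tl)
  then show ?thesis unfolding set_zip by blast
qed

lemma successively_subset_zip: "successively (\<lambda>x y. (x, y) \<in> E) xs \<longleftrightarrow> set (zip xs (tl xs)) \<subseteq> E"
  unfolding set_zip_tl successively_conv_nth by blast

lemma undirected_cycle_of_list:
  assumes xs: "distinct xs" "length xs \<ge> 3" "successively (\<lambda>x y. (x, y) \<in> parcs G) (xs @ [hd xs])"
    and G: "hd xs \<in> pverts G"
  shows "undirected_cycle G (zip (xs @ [hd xs]) (tl (xs @ [hd xs])))"
    and "cycle_verts (zip (xs @ [hd xs]) (tl (xs @ [hd xs]))) = set xs"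
proof -
  let ?ys = "xs @ [hd xs]"
  let ?c = "zip ?ys (tl ?ys)"
  have ne: "xs \<noteq> []" using xs by auto
  have hd: "hd ?ys = hd xs" "last ?ys = hd xs" using ne by simp_all
  have tl: "tl ?ys = tl xs @ [hd xs]" using ne by simp
  have len: "length ?c = length xs" using ne by simp
  have "distinct (hd xs # tl xs)" using xs(1) ne by simp
  then have "distinct (tl ?ys)" unfolding tl by simp
  then have "pre_digraph.cycle (with_proj G) ?c"
    unfolding pre_digraph.cycle_def pre_digraph.awalk_def
    using pcas_zip[of ?ys] G xs(3) hd len xs(2) by (auto simp: successively_subset_zip cas_with_proj_eq awalk_verts_with_proj_eq intro!: exI[of _ "hd xs"])
  then show "undirected_cycle G ?c" using xs(2) len by (simp add: undirected_cycle_def)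
  have "map fst ?c = take (length (tl ?ys)) ?ys" by (simp add: map_fst_zip_take)
  also have "\<dots> = xs" using ne by simp
  finally show "cycle_verts ?c = set xs" unfolding cycle_verts_def by (metis list.set_map)
qed

text \<open>Shortcutting at repeated vertices.\<close>

lemma rtrancl_distinct_list:
  assumes "(a, b) \<in> R\<^sup>*"
  shows "\<exists>xs. xs \<noteq> [] \<and> hd xs = a \<and> last xs = b \<and> distinct xs \<and> successively (\<lambda>x y. (x, y) \<in> R) xs"
  using assms
proof (induction rule: rtrancl_induct)
  case base
  show ?case by (rule exI[of _ "[a]"]) auto
next
  case (step y z)
  then obtain xs where xs: "xs \<noteq> []" "hd xs = a" "last xs = y" "distinct xs" "successively (\<lambda>x y. (x, y) \<in> R) xs"
    by blast
  show ?case
  proof (cases "z \<in> set xs")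
    case True
    then obtain ps qs where s: "xs = ps @ z # qs" by (auto simp: in_set_conv_decomp)
    have "successively (\<lambda>x y. (x, y) \<in> R) ((ps @ [z]) @ qs)" using xs(5) s by simp
    then have "successively (\<lambda>x y. (x, y) \<in> R) (ps @ [z])" unfolding successively_append_iff by blast
    moreover have "hd (ps @ [z]) = a" using xs(2) s by (cases ps) auto
    moreover have "distinct (ps @ [z])" using xs(4) s by simp
    ultimately show ?thesis by (intro exI[of _ "ps @ [z]"]) simp
  next
    case False
    then show ?thesis using xs step
      by (intro exI[of _ "xs @ [z]"]) (auto simp: successively_append_iff)
  qed
qed

lemma apath_list:
  assumes "pre_digraph.apath (with_proj G) u P w" "u \<noteq> w"
  obtains vs where "vs = pawalk_verts u P" "distinct vs" "hd vs = u" "last vs = w" "length vs \<ge> 2"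
    "P = zip vs (tl vs)" "successively (\<lambda>x y. (x, y) \<in> parcs G) vs" "fst (last P) = vs ! (length vs - 2)"
proof
  let ?vs = "pawalk_verts u P"
  have cas: "pcas u P w" and sub: "set P \<subseteq> parcs G" and d: "distinct ?vs"
    using assms(1) by (auto simp: pre_digraph.apath_def pre_digraph.awalk_def cas_with_proj_eq awalk_verts_with_proj_eq)
  note z = pcas_imp_zip[OF cas]
  show "?vs = pawalk_verts u P" ..
  show "distinct ?vs" by (rule d)
  show "hd ?vs = u" "last ?vs = w" using z by auto
  have "P \<noteq> []" using cas assms(2) by auto
  moreover have "length ?vs = Suc (length P)"
    using arg_cong[OF z[THEN conjunct2, THEN conjunct1], of length] by simp
  ultimately show "length ?vs \<ge> 2" by (cases P) simp_all
  show "P = zip ?vs (tl ?vs)" using z by blast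
  then show "successively (\<lambda>x y. (x, y) \<in> parcs G) ?vs" unfolding successively_subset_zip using sub by simp
  have "?vs ! (length ?vs - 2) = (map fst P @ [w]) ! (length P - 1)" using z by simp
  also have "\<dots> = fst (last P)" using \<open>P \<noteq> []\<close> by (simp add: nth_append last_conv_nth)
  finally show "fst (last P) = ?vs ! (length ?vs - 2)" by simp
qed

text \<open>
  Let \<open>B0\<close> be the set of vertices that can be reached from \<open>w\<close> without
  using an edge of the path. It does not contain \<open>u\<close>: a path from \<open>w\<close>
  to \<open>u\<close> in the rest of the graph cannot meet the interior vertices, which have
  degree 2, and would close a cycle through \<open>u\<close> and \<open>w\<close>. So the part
  attached at \<open>w\<close> is separated from the part attached at \<open>u\<close>.
\<close>

lemma orientation_sum_ggs_le:
  assumes f: "f \<in> class_functions n" and W: "\<And>g. cycle_weight f n g \<ge> 0"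
    and G: "simple_graph_on n G" and ggs: "ggs G G'"
  shows "orientation_sum f n (parcs G') r \<le> orientation_sum f n (parcs G) r"
proof -
  let ?E = "parcs G"
  note E = simple_graph_onD[OF G]
  have symD: "(y, x) \<in> ?E" if "(x, y) \<in> ?E" for x y using E(2) that by (rule symD)
  obtain u w P where uw: "u \<noteq> w" and path: "pre_digraph.apath (with_proj G) u P w"
    and deg: "\<forall>x \<in> set (pawalk_verts u P) - {u, w}. out_degree (with_proj G) x = 2"
    and nocyc: "\<not> (\<exists>c. undirected_cycle G c \<and> u \<in> cycle_verts c \<and> w \<in> cycle_verts c)"
    and G': "G' = move_neighbours G u w (fst (last P))"
    using ggs unfolding ggs_def awalk_verts_with_proj_eq by blast
  obtain vs where vs: "vs = pawalk_verts u P" "distinct vs" "hd vs = u" "last vs = w" "length vs \<ge> 2"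
    "successively (\<lambda>x y. (x, y) \<in> ?E) vs" "fst (last P) = vs ! (length vs - 2)"
    using apath_list[OF path uw] by metis
  have ne: "vs \<noteq> []" using vs by auto
  have u0: "u = vs ! 0" and wl: "w = vs ! (length vs - 1)" using vs ne by (simp_all add: hd_conv_nth last_conv_nth)
  have nthE: "(vs ! i, vs ! Suc i) \<in> ?E" if "Suc i < length vs" for i
    using successively_nth[OF vs(6) that] .
  have PAE: "path_arcs vs \<subseteq> ?E" using nthE symD by (auto simp: path_arcs_def)
  have nth_eq: "vs ! i = vs ! j \<longleftrightarrow> i = j" if "i < length vs" "j < length vs" for i j
    using nth_eq_iff_index_eq[OF vs(2) that] .
  have vsV: "set vs \<subseteq> {0..<n}"
  proof
    fix x assume "x \<in> set vs"
    then obtain i where i: "i < length vs" "x = vs ! i" by (auto simp: in_set_conv_nth)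
    have "\<exists>y. (x, y) \<in> ?E"
    proof (cases "Suc i < length vs")
      case True
      then show ?thesis using nthE i by blast
    next
      case False
      then have "Suc (i - 1) < length vs" "i = Suc (i - 1)" using i vs(5) by auto
      then show ?thesis using symD[OF nthE] i by metis
    qed
    then show "x \<in> {0..<n}" using E(1) by blast
  qed
  define R where "R = ?E - path_arcs vs"
  have symR: "(y, x) \<in> R" if "(x, y) \<in> R" for x y using that symD by (auto simp: R_def path_arcs_def)
  have interior: "(x, y) \<notin> R" if x: "x \<in> set vs" "x \<noteq> u" "x \<noteq> w" for x y
  proof -
    obtain i where i: "i < length vs" "x = vs ! i" using x by (auto simp: in_set_conv_nth)
    have i0: "i \<noteq> 0" "Suc i < length vs" using i x u0 wl by (metis, metis Suc_lessI diff_Suc_1)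
    then obtain j where j: "i = Suc j" by (cases i) auto
    let ?N = "{vs ! j, vs ! Suc i}"
    have sub: "?N \<subseteq> nbrs ?E x" using nthE[OF i0(2)] symD[OF nthE[of j]] i j by (auto simp: nbrs_def)
    have "card ?N = 2" using nth_eq[of j "Suc i"] i0 j by simp
    moreover have "card (nbrs ?E x) = 2" using deg x vs(1) by (simp add: out_degree_nbrs)
    ultimately have N: "nbrs ?E x = ?N" using sub by (metis card_subset_eq card.infinite zero_neq_numeral)
    have pa: "(x, vs ! j) \<in> path_arcs vs" "(x, vs ! Suc i) \<in> path_arcs vs"
      unfolding path_arcs_def i(2) j using i0 j by auto
    have "(x, y) \<in> path_arcs vs" if "(x, y) \<in> ?E"
    proof -
      have "y \<in> ?N" unfolding N[symmetric] using that by (simp add: nbrs_def)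
      then show ?thesis using pa by blast
    qed
    then show ?thesis by (auto simp: R_def)
  qed
  define B0 where "B0 = {x. (w, x) \<in> R\<^sup>*}"
  have uB0: "u \<notin> B0"
  proof
    assume "u \<in> B0"
    then obtain xs where xs: "xs \<noteq> []" "hd xs = w" "last xs = u" "distinct xs" "successively (\<lambda>x y. (x, y) \<in> R) xs"
      using rtrancl_distinct_list[of w u R] by (auto simp: B0_def)
    obtain ys where ys: "xs = w # ys @ [u]"
    proof -
      obtain zs where zs: "xs = w # zs" using xs(1,2) by (cases xs) auto
      have "zs \<noteq> []" using zs xs(3) uw by auto
      then have "zs = butlast zs @ [u]" using zs xs(3) by (metis append_butlast_last_id last_ConsR)
      then show ?thesis using zs that by blast
    qed
    have step: "(xs ! i, xs ! Suc i) \<in> R" if "Suc i < length xs" for i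
      using successively_nth[OF xs(5) that] .
    have disj: "set ys \<inter> set vs = {}"
    proof (rule ccontr)
      assume "set ys \<inter> set vs \<noteq> {}"
      then obtain x where x: "x \<in> set ys" "x \<in> set vs" by blast
      then obtain i where i: "i < length ys" "x = ys ! i" by (auto simp: in_set_conv_nth)
      have "x \<noteq> u" "x \<noteq> w" using x xs(4) ys by auto
      moreover have "(xs ! Suc i, xs ! Suc (Suc i)) \<in> R" using step[of "Suc i"] i ys by simp
      moreover have "xs ! Suc i = x" using i ys by (simp add: nth_append)
      ultimately show False using interior[OF x(2)] by simp
    qed
    \<comment> \<open>the closed walk along \<open>vs\<close> from \<open>u\<close> to \<open>w\<close> and back to \<open>u\<close> through \<open>ys\<close>\<close>
    let ?L = "vs @ ys"
    have "distinct ?L" using vs(2) xs(4) ys disj by auto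
    moreover have "length ?L \<ge> 3"
    proof (cases "ys = []")
      case True
      then have wu: "(w, u) \<in> R" using step[of 0] ys by simp
      show ?thesis
      proof (rule ccontr)
        assume "\<not> ?thesis"
        then have "length vs = 2" using vs(5) by simp
        then have "(w, u) \<in> path_arcs vs" unfolding path_arcs_def u0 wl by auto
        then show False using wu by (simp add: R_def)
      qed
    next
      case False
      then show ?thesis using vs(5) by (cases ys) auto
    qed
    moreover have "successively (\<lambda>x y. (x, y) \<in> ?E) (?L @ [hd ?L])"
    proof -
      have "successively (\<lambda>x y. (x, y) \<in> ?E) xs"
        using xs(5) by (rule successively_mono) (auto simp: R_def)
      then have "successively (\<lambda>x y. (x, y) \<in> ?E) (ys @ [u])" "(w, hd (ys @ [u])) \<in> ?E"
        unfolding ys by (auto simp: successively_Cons)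
      then have "successively (\<lambda>x y. (x, y) \<in> ?E) (vs @ (ys @ [u]))"
        using vs(6,4) by (simp add: successively_append_iff)
      then show ?thesis using ne vs(3) by simp
    qed
    moreover have "hd ?L \<in> pverts G"
    proof -
      have "hd vs \<in> {0..<n}" using hd_in_set[OF ne] vsV by blast
      then show ?thesis using ne G by (simp add: simple_graph_on_def)
    qed
    ultimately have "undirected_cycle G (zip (?L @ [hd ?L]) (tl (?L @ [hd ?L])))"
      "cycle_verts (zip (?L @ [hd ?L]) (tl (?L @ [hd ?L]))) = set ?L"
      using undirected_cycle_of_list[of ?L G] by blast+
    moreover have "u \<in> set ?L" "w \<in> set ?L" using ne u0 wl by auto
    ultimately show False using nocyc by blast
  qed
  have B0vs: "x = w" if x: "x \<in> B0" "x \<in> set vs" for x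
  proof (rule ccontr)
    assume "x \<noteq> w"
    have "(w, x) \<in> R\<^sup>*" using x by (simp add: B0_def)
    then obtain y where "(y, x) \<in> R" using \<open>x \<noteq> w\<close> by (metis rtranclE)
    moreover have "x \<noteq> u" using x uB0 by blast
    ultimately show False using interior[OF x(2)] \<open>x \<noteq> w\<close> symR by blast
  qed
  define B where "B = B0 - {w}"
  define Z where "Z = {z \<in> B. (last vs, z) \<in> ?E}"
  have wB0: "w \<in> B0" by (simp add: B0_def)
  have stepB0: "y \<in> B0" if "x \<in> B0" "(x, y) \<in> R" for x y
    using that by (auto simp: B0_def intro: rtrancl_into_rtrancl)
  have PAvs: "x \<in> set vs \<and> y \<in> set vs" if "(x, y) \<in> path_arcs vs" for x y using that by (auto simp: path_arcs_def)
  have "orientation_sum f n ((?E - ({last vs} \<times> Z \<union> Z \<times> {last vs})) \<union> ({hd vs} \<times> Z \<union> Z \<times> {hd vs})) r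
      \<le> orientation_sum f n ?E r"
  proof (rule orientation_sum_path_shift_le[OF f W E(1,2) vs(2) vsV vs(5) _ _ _ _ _ Z_def])
    have wV: "w \<in> {0..<n}" using vsV last_in_set[OF ne] vs(4) by blast
    have "x \<in> {0..<n}" if "(w, x) \<in> R\<^sup>*" for x
      using that by (rule rtranclE) (use wV E(1) in \<open>auto simp: R_def\<close>)
    then show "B \<subseteq> {0..<n}" by (auto simp: B_def B0_def)
    show "B \<inter> set vs = {}" using B0vs by (auto simp: B_def)
    show "y \<in> B \<union> {last vs}" if "(x, y) \<in> ?E" "x \<in> B" for x y
    proof -
      have "x \<notin> set vs" using that B0vs by (auto simp: B_def)
      then have "(x, y) \<in> R" using that PAvs by (auto simp: R_def)
      then show ?thesis using stepB0 that vs(4) by (auto simp: B_def)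
    qed
    show "(x, y) \<in> ?E \<longleftrightarrow> (x, y) \<in> path_arcs vs" if xy: "x \<in> set vs" "y \<in> set vs" for x y
    proof
      assume e: "(x, y) \<in> ?E"
      show "(x, y) \<in> path_arcs vs"
      proof (rule ccontr)
        assume "(x, y) \<notin> path_arcs vs"
        then have r: "(x, y) \<in> R" using e by (simp add: R_def)
        then have "x = u \<or> x = w" "y = u \<or> y = w" using interior[OF xy(1), of y] interior[OF xy(2), of x] symR by blast+
        moreover have "x \<noteq> y" using e E(3) by blast
        ultimately have "(w, u) \<in> R" using r symR by blast
        then show False using uB0 by (auto simp: B0_def)
      qed
    qed (use PAE in blast)
    show "y \<in> set vs \<or> x = last vs \<and> y \<in> B" if x: "x \<in> set vs" "x \<noteq> hd vs" "(x, y) \<in> ?E" for x y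
    proof (cases "(x, y) \<in> path_arcs vs")
      case False
      then have r: "(x, y) \<in> R" using x by (simp add: R_def)
      then have "x = w" using interior x vs(3) by blast
      moreover have "y \<noteq> w" using x(3) E(3) \<open>x = w\<close> by blast
      ultimately show ?thesis using stepB0[OF wB0] r vs(4) by (auto simp: B_def)
    qed (use PAvs in blast)
  qed
  moreover have "Z = {z. (w, z) \<in> ?E \<and> z \<noteq> fst (last P)}"
  proof -
    have pw: "(w, z) \<in> path_arcs vs \<longleftrightarrow> z = vs ! (length vs - 2)" for z
    proof
      assume "(w, z) \<in> path_arcs vs"
      then obtain i where i: "Suc i < length vs" "w = vs ! i \<and> z = vs ! Suc i \<or> w = vs ! Suc i \<and> z = vs ! i"
        by (auto simp: path_arcs_def)
      have L: "length vs - 1 < length vs" using i(1) by linarith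
      have "w \<noteq> vs ! i" unfolding wl using nth_eq[of "length vs - 1" i] i(1) L by linarith
      then have zi: "z = vs ! i" "w = vs ! Suc i" using i(2) by blast+
      then have "Suc i = length vs - 1" using nth_eq[OF i(1) L] wl by metis
      then have "i = length vs - 2" by linarith
      then show "z = vs ! (length vs - 2)" using zi(1) by blast
    next
      assume z: "z = vs ! (length vs - 2)"
      have "Suc (length vs - 2) = length vs - 1" using vs(5) by simp
      then have "(w, z) = (vs ! Suc (length vs - 2), vs ! (length vs - 2))" "Suc (length vs - 2) < length vs"
        using vs(5) by (simp_all add: z wl)
      then show "(w, z) \<in> path_arcs vs" unfolding path_arcs_def by blast
    qed
    have "z \<in> B \<longleftrightarrow> z \<noteq> vs ! (length vs - 2)" if e: "(w, z) \<in> ?E" for z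
    proof
      assume "z \<in> B"
      then have "z \<notin> set vs" using B0vs by (auto simp: B_def)
      then show "z \<noteq> vs ! (length vs - 2)" using vs(5) nth_mem[of "length vs - 2" vs] by auto
    next
      assume "z \<noteq> vs ! (length vs - 2)"
      then have "(w, z) \<in> R" using pw e by (simp add: R_def)
      then show "z \<in> B" using stepB0[OF wB0] E(3) e by (auto simp: B_def)
    qed
    then show ?thesis unfolding Z_def vs(4,7) by blast
  qed
  ultimately show ?thesis unfolding G' move_neighbours_def Let_def vs(3,4) by simp
qed

section \<open>Cycles with a rooted tree: the star is minimal\<close>

text \<open>
  The cycle on \<open>0, \<dots>, m - 1\<close> with a tree on the remaining vertices attached
  at 0; each vertex \<open>x\<close> of the tree is joined to its parent \<open>par x\<close>.
\<close>

definition cycle_tree_arcs :: "nat \<Rightarrow> nat \<Rightarrow> (nat \<Rightarrow> nat) \<Rightarrow> (nat \<times> nat) set" where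
  "cycle_tree_arcs m n par = (let E = cycle_edge_set m \<union> {(x, par x) | x. m \<le> x \<and> x < n} in E \<union> E\<inverse>)"

text \<open>
  The rank \<open>\<rho>\<close> witnesses that following the parents ends at the root 0.
  Outside of the tree the value is fixed to be 0, so that iterating \<open>par\<close> never
  returns to the tree from there.
\<close>

definition parent_function :: "nat \<Rightarrow> nat \<Rightarrow> (nat \<Rightarrow> nat) \<Rightarrow> (nat \<Rightarrow> nat) \<Rightarrow> bool" where
  "parent_function m n \<rho> par \<longleftrightarrow>
     (\<forall>x. m \<le> x \<and> x < n \<longrightarrow> (par x = 0 \<or> m \<le> par x \<and> par x < n) \<and> \<rho> (par x) < \<rho> x) \<and>
     (\<forall>x. \<not> (m \<le> x \<and> x < n) \<longrightarrow> par x = 0)"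

lemma cycle_tree_arcs_cases:
  assumes "(x, y) \<in> cycle_tree_arcs m n par"
  obtains "(x, y) \<in> cycle_edge_set m" | "(y, x) \<in> cycle_edge_set m"
    | "m \<le> x" "x < n" "y = par x" | "m \<le> y" "y < n" "x = par y"
  using assms by (auto simp: cycle_tree_arcs_def Let_def)

lemma cycle_edge_setD: "(x, y) \<in> cycle_edge_set m \<Longrightarrow> x < m \<and> y < m \<and> y = Suc x mod m"
  by (auto simp: cycle_edge_set_def)

lemma sym_cycle_tree_arcs: "sym (cycle_tree_arcs m n par)"
  by (auto simp: cycle_tree_arcs_def Let_def sym_def)

lemma tree_arcI:
  assumes "m \<le> x" "x < n"
  shows "(x, par x) \<in> cycle_tree_arcs m n par" "(par x, x) \<in> cycle_tree_arcs m n par"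
  using assms by (auto simp: cycle_tree_arcs_def Let_def)

context
  fixes m n :: nat and \<rho> par :: "nat \<Rightarrow> nat"
  assumes m: "2 \<le> m" "m \<le> n" and pf: "parent_function m n \<rho> par"
begin

lemma parD:
  assumes "m \<le> x" "x < n"
  shows "par x = 0 \<or> m \<le> par x \<and> par x < n" "\<rho> (par x) < \<rho> x" "par x < n"
  using pf assms m unfolding parent_function_def by auto

lemma par_outside: "\<not> (m \<le> x \<and> x < n) \<Longrightarrow> par x = 0"
  using pf unfolding parent_function_def by blast

lemma cycle_tree_arcs_subset: "cycle_tree_arcs m n par \<subseteq> {0..<n} \<times> {0..<n}"
proof -
  have "x < n \<and> y < n" if "(x, y) \<in> cycle_tree_arcs m n par" for x y
    using that
  proof (rule cycle_tree_arcs_cases)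
    assume "(x, y) \<in> cycle_edge_set m"
    then show ?thesis using cycle_edge_setD[of x y m] m by simp
  next
    assume "(y, x) \<in> cycle_edge_set m"
    then show ?thesis using cycle_edge_setD[of y x m] m by simp
  next
    assume "m \<le> x" "x < n" "y = par x"
    then show ?thesis using parD(3) by simp
  next
    assume "m \<le> y" "y < n" "x = par y"
    then show ?thesis using parD(3) by simp
  qed
  then show ?thesis by auto
qed

lemma cycle_tree_arcs_irrefl: "(x, x) \<notin> cycle_tree_arcs m n par"
proof
  assume "(x, x) \<in> cycle_tree_arcs m n par"
  then show False
  proof (rule cycle_tree_arcs_cases)
    have "False" if "(x, x) \<in> cycle_edge_set m"
    proof -
      have "x < m" "x = Suc x mod m" using cycle_edge_setD[OF that] by auto
      then show False using m by (cases "Suc x = m") auto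
    qed
    then show "(x, x) \<in> cycle_edge_set m \<Longrightarrow> False" "(x, x) \<in> cycle_edge_set m \<Longrightarrow> False" by auto
  qed (use parD(2)[of x] in auto)
qed

definition descendants :: "nat set \<Rightarrow> nat set" where
  "descendants Z = {x. \<exists>k. (par ^^ k) x \<in> Z}"

lemma descendants_iff: "x \<in> descendants Z \<longleftrightarrow> x \<in> Z \<or> par x \<in> descendants Z"
proof
  assume "x \<in> descendants Z"
  then obtain k where "(par ^^ k) x \<in> Z" by (auto simp: descendants_def)
  then show "x \<in> Z \<or> par x \<in> descendants Z"
    by (cases k) (auto simp: descendants_def funpow_swap1)
next
  assume "x \<in> Z \<or> par x \<in> descendants Z"
  then show "x \<in> descendants Z"
  proof
    assume "x \<in> Z"
    then have "(par ^^ 0) x \<in> Z" by simp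
    then show ?thesis unfolding descendants_def by blast
  next
    assume "par x \<in> descendants Z"
    then obtain k where "(par ^^ k) (par x) \<in> Z" by (auto simp: descendants_def)
    then have "(par ^^ Suc k) x \<in> Z" by (simp add: funpow_swap1)
    then show ?thesis unfolding descendants_def by blast
  qed
qed

lemma descendants_props:
  assumes Z: "\<And>z. z \<in> Z \<Longrightarrow> m \<le> z \<and> z < n \<and> par z = a" and x: "x \<in> descendants Z"
  shows "m \<le> x \<and> x < n \<and> \<rho> a < \<rho> x"
proof -
  have "(par ^^ k) x \<in> Z \<Longrightarrow> m \<le> x \<and> x < n \<and> \<rho> a < \<rho> x" for k
  proof (induction k arbitrary: x)
    case 0
    then have "x \<in> Z" by simp
    then show ?case using Z[of x] parD(2)[of x] by auto
  next
    case (Suc k)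
    then have "(par ^^ k) (par x) \<in> Z" by (simp add: funpow_swap1)
    then have px: "m \<le> par x" "\<rho> a < \<rho> (par x)" using Suc.IH by auto
    then have "m \<le> x \<and> x < n" using par_outside[of x] m by force
    then show ?case using px parD(2)[of x] by auto
  qed
  then show ?thesis using x by (auto simp: descendants_def)
qed

text \<open>
  Moving the subtrees rooted at the children \<open>Z\<close> of the last vertex of a path to
  its first vertex is a graph shift, in which the part attached at the last vertex consists of
  the descendants of \<open>Z\<close>.
\<close>

lemma reattach_le:
  assumes f: "f \<in> class_functions n" and W: "\<And>g. cycle_weight f n g \<ge> 0"
    and Z: "\<And>z. z \<in> Z \<Longrightarrow> m \<le> z \<and> z < n \<and> par z = last vs"
    and vs: "distinct vs" "set vs \<subseteq> {0..<n}" "length vs \<ge> 2"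
    and d: "descendants Z \<inter> set vs = {}"
    and hP: "\<And>x y. x \<in> set vs \<Longrightarrow> y \<in> set vs \<Longrightarrow> (x, y) \<in> cycle_tree_arcs m n par \<longleftrightarrow> (x, y) \<in> path_arcs vs"
    and hI: "\<And>x y. x \<in> set vs \<Longrightarrow> x \<noteq> hd vs \<Longrightarrow> (x, y) \<in> cycle_tree_arcs m n par \<Longrightarrow> y \<in> set vs \<or> x = last vs \<and> y \<in> Z"
    and par': "par' = (\<lambda>x. if x \<in> Z then hd vs else par x)"
  shows "orientation_sum f n (cycle_tree_arcs m n par') r \<le> orientation_sum f n (cycle_tree_arcs m n par) r"
proof -
  let ?E = "cycle_tree_arcs m n par" and ?B = "descendants Z" and ?a = "last vs" and ?b = "hd vs"
  have Bp: "m \<le> x \<and> x < n \<and> \<rho> ?a < \<rho> x" if "x \<in> ?B" for x using descendants_props[OF Z that] by blast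
  have aB: "?a \<notin> ?B" using Bp[of ?a] by auto
  have noc: "(x, y) \<notin> cycle_edge_set m" "(y, x) \<notin> cycle_edge_set m" if "m \<le> x" for x y
    using cycle_edge_setD[of x y m] cycle_edge_setD[of y x m] that by auto
  have ZB: "Z \<subseteq> ?B" using descendants_iff by blast
  have hB: "y \<in> ?B \<union> {?a}" if e: "(x, y) \<in> ?E" and x: "x \<in> ?B" for x y
    using e
  proof (rule cycle_tree_arcs_cases)
    assume "y = par x"
    then show ?thesis using descendants_iff[of x Z] x Z[of x] by auto
  next
    assume "x = par y"
    then show ?thesis using descendants_iff[of y Z] x by auto
  qed (use noc Bp[OF x] in auto)
  have Zeq: "Z = {z \<in> ?B. (?a, z) \<in> ?E}"
  proof
    show "Z \<subseteq> {z \<in> ?B. (?a, z) \<in> ?E}" using Z ZB tree_arcI(2)[of m _ n par] by fastforce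
    show "{z \<in> ?B. (?a, z) \<in> ?E} \<subseteq> Z"
    proof
      fix z assume "z \<in> {z \<in> ?B. (?a, z) \<in> ?E}"
      then have z: "z \<in> ?B" "(?a, z) \<in> ?E" by auto
      from z(2) show "z \<in> Z"
      proof (rule cycle_tree_arcs_cases)
        assume "z = par ?a"
        then show ?thesis using descendants_iff[of ?a Z] z(1) aB by auto
      next
        assume "?a = par z"
        then show ?thesis using descendants_iff[of z Z] z(1) aB by auto
      qed (use noc Bp[OF z(1)] in auto)
    qed
  qed
  have za: "z \<noteq> par ?a \<or> \<not> (m \<le> ?a \<and> ?a < n)" if "z \<in> Z" for z
    using parD(2)[of ?a] parD(2)[of z] Z[OF that] by force
  have "cycle_tree_arcs m n par' = (?E - ({?a} \<times> Z \<union> Z \<times> {?a})) \<union> ({?b} \<times> Z \<union> Z \<times> {?b})" (is "?L = ?R")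
  proof
    show "?L \<subseteq> ?R"
    proof
      fix p assume p: "p \<in> ?L"
      obtain x y where xy: "p = (x, y)" by (cases p)
      have nz: "x \<notin> Z" if "x < m" for x using Z[of x] that by auto
      from p[unfolded xy] show "p \<in> ?R"
      proof (rule cycle_tree_arcs_cases)
        assume a: "(x, y) \<in> cycle_edge_set m"
        then have "(x, y) \<in> ?E" by (simp add: cycle_tree_arcs_def Let_def)
        then show ?thesis using nz cycle_edge_setD[OF a] xy by auto
      next
        assume a: "(y, x) \<in> cycle_edge_set m"
        then have "(x, y) \<in> ?E" by (simp add: cycle_tree_arcs_def Let_def)
        then show ?thesis using nz cycle_edge_setD[OF a] xy by auto
      next
        assume a: "m \<le> x" "x < n" "y = par' x"
        show ?thesis
        proof (cases "x \<in> Z")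
          case True
          then show ?thesis using a xy par' by auto
        next
          case False
          then have "y = par x" using a par' by simp
          moreover have "(x, y) \<in> ?E" using tree_arcI(1)[OF a(1,2)] \<open>y = par x\<close> by blast
          moreover have "\<not> (x = ?a \<and> y \<in> Z)" using za a \<open>y = par x\<close> by blast
          ultimately show ?thesis using False xy by auto
        qed
      next
        assume a: "m \<le> y" "y < n" "x = par' y"
        show ?thesis
        proof (cases "y \<in> Z")
          case True
          then show ?thesis using a xy par' by auto
        next
          case False
          then have "x = par y" using a par' by simp
          moreover have "(x, y) \<in> ?E" using tree_arcI(2)[OF a(1,2)] \<open>x = par y\<close> by blast
          moreover have "\<not> (y = ?a \<and> x \<in> Z)" using za a \<open>x = par y\<close> by blast
          ultimately show ?thesis using False xy by auto
        qed
      qed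
    qed
    show "?R \<subseteq> ?L"
    proof
      fix p assume p: "p \<in> ?R"
      obtain x y where xy: "p = (x, y)" by (cases p)
      have ZL: "(z, ?b) \<in> ?L \<and> (?b, z) \<in> ?L" if "z \<in> Z" for z
        using tree_arcI[of m z n par'] Z[OF that] that par' by simp
      from p consider "x = ?b" "y \<in> Z" | "y = ?b" "x \<in> Z" | "(x, y) \<in> ?E" "\<not> (x = ?a \<and> y \<in> Z)" "\<not> (y = ?a \<and> x \<in> Z)"
        unfolding xy by blast
      then show "p \<in> ?L"
      proof cases
        case 3
        from 3(1) show ?thesis unfolding xy
        proof (rule cycle_tree_arcs_cases)
          assume a: "m \<le> x" "x < n" "y = par x"
          then have "x \<notin> Z" using 3 Z by blast
          then have "y = par' x" using a par' by simp
          then show "(x, y) \<in> ?L" using tree_arcI(1)[OF a(1,2), of par'] by simp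
        next
          assume a: "m \<le> y" "y < n" "x = par y"
          then have "y \<notin> Z" using 3 Z by blast
          then have "x = par' y" using a par' by simp
          then show "(x, y) \<in> ?L" using tree_arcI(2)[OF a(1,2), of par'] by simp
        qed (simp_all add: cycle_tree_arcs_def Let_def)
      qed (use ZL xy in blast)+
    qed
  qed
  moreover have "orientation_sum f n ((?E - ({?a} \<times> Z \<union> Z \<times> {?a})) \<union> ({?b} \<times> Z \<union> Z \<times> {?b})) r \<le> orientation_sum f n ?E r"
  proof (rule orientation_sum_path_shift_le[OF f W cycle_tree_arcs_subset sym_cycle_tree_arcs vs _ d hB hP _ Zeq])
    show "?B \<subseteq> {0..<n}" using Bp by auto
    show "y \<in> set vs \<or> x = last vs \<and> y \<in> ?B" if "x \<in> set vs" "x \<noteq> hd vs" "(x, y) \<in> ?E" for x y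
      using hI[OF that] ZB by blast
  qed
  ultimately show ?thesis by simp
qed

text \<open>The rank may skip values; the depth is the distance to the root.\<close>

lemma ex_depth:
  "\<exists>d. d 0 = 0 \<and> (\<forall>x. m \<le> x \<and> x < n \<longrightarrow> d x = Suc (d (par x)))"
proof -
  have ex: "\<exists>k. (par ^^ k) x = 0" for x
  proof (induction "\<rho> x" arbitrary: x rule: less_induct)
    case less
    show ?case
    proof (cases "m \<le> x \<and> x < n")
      case True
      then obtain k where "(par ^^ k) (par x) = 0" using less parD(2)[of x] by blast
      then have "(par ^^ Suc k) x = 0" by (simp add: funpow_swap1)
      then show ?thesis by blast
    next
      case False
      then have "(par ^^ 1) x = 0" using par_outside by simp
      then show ?thesis by blast
    qed
  qed
  define d where "d x = (LEAST k. (par ^^ k) x = 0)" for x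
  have "d x = Suc (d (par x))" if x: "m \<le> x \<and> x < n" for x
  proof -
    obtain k where k: "(par ^^ k) x = 0" using ex by blast
    have "\<not> (par ^^ 0) x = 0" using x m by simp
    from Least_Suc[of "\<lambda>k. (par ^^ k) x = 0", OF k this] show ?thesis by (simp add: d_def funpow_swap1)
  qed
  moreover have "d 0 = 0" unfolding d_def by (rule Least_eq_0) simp
  ultimately show ?thesis by blast
qed

text \<open>Colour the cycle alternately and the tree by the parity of the depth.\<close>

lemma cycle_tree_two_colouring:
  assumes "even m"
  shows "\<exists>c. \<forall>x y. (x, y) \<in> cycle_tree_arcs m n par \<longrightarrow> (c x \<longleftrightarrow> \<not> c y)"
proof -
  obtain d where d: "d 0 = 0" "\<And>x. m \<le> x \<and> x < n \<Longrightarrow> d x = Suc (d (par x))" using ex_depth by blast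
  define c where "c x = (if x < m then even x else even (d x :: nat))" for x
  have cyc: "c x \<longleftrightarrow> \<not> c y" if "(x, y) \<in> cycle_edge_set m" for x y
  proof -
    have "x < m" "y < m" "y = Suc x mod m" using cycle_edge_setD[OF that] by auto
    then show ?thesis using assms by (cases "Suc x = m") (auto simp: c_def)
  qed
  have tree: "c x \<longleftrightarrow> \<not> c (par x)" if "m \<le> x" "x < n" for x
  proof -
    have dx: "d x = Suc (d (par x))" using d(2) that by blast
    show ?thesis using parD(1)[OF that]
    proof
      assume "par x = 0"
      then show ?thesis using dx d(1) m that by (simp add: c_def)
    next
      assume "m \<le> par x \<and> par x < n"
      then show ?thesis using dx that by (simp add: c_def)
    qed
  qed
  have "c x \<longleftrightarrow> \<not> c y" if "(x, y) \<in> cycle_tree_arcs m n par" for x y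
    using that by (rule cycle_tree_arcs_cases) (use cyc tree in blast)+
  then show ?thesis by blast
qed

end

text \<open>
  As long as some parent is not the root, a vertex of least rank among those with such a parent
  has a parent \<open>w\<close> that is a child of the root. Moving the children of
  \<open>w\<close> to the root is a shift along the edge between them and leaves fewer vertices
  whose parent is not the root.
\<close>

lemma star_le:
  assumes m: "2 \<le> m" "m \<le> n" and f: "f \<in> class_functions n" and W: "\<And>g. cycle_weight f n g \<ge> 0"
  shows "parent_function m n \<rho> par \<Longrightarrow>
    orientation_sum f n (cycle_tree_arcs m n (\<lambda>_. 0)) r \<le> orientation_sum f n (cycle_tree_arcs m n par) r"
proof (induction "card {x. par x \<noteq> 0}" arbitrary: par rule: less_induct)
  case less
  note pf = less.prems
  note out = par_outside[OF m pf] and pD = parD[OF m pf]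
  have sub: "{x. par x \<noteq> 0} \<subseteq> {m..<n}"
  proof
    fix x assume "x \<in> {x. par x \<noteq> 0}"
    then show "x \<in> {m..<n}" using out[of x] by auto
  qed
  show ?case
  proof (cases "\<forall>x. par x = 0")
    case True
    then have "par = (\<lambda>_. 0)" by auto
    then show ?thesis by simp
  next
    case False
    then obtain x0 where "par x0 \<noteq> 0" by blast
    then obtain x where x: "par x \<noteq> 0" and least: "\<forall>y. par y \<noteq> 0 \<longrightarrow> \<rho> x \<le> \<rho> y"
      using ex_has_least_nat[of "\<lambda>x. par x \<noteq> 0" x0 \<rho>] by blast
    have xr: "m \<le> x" "x < n" using x sub by auto
    define w where "w = par x"
    have w: "m \<le> w" "w < n" using pD(1)[OF xr] x by (auto simp: w_def)
    have "\<rho> w < \<rho> x" using pD(2)[OF xr] by (simp add: w_def)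
    then have w0: "par w = 0" using least by (metis not_less)
    define Z where "Z = {z. par z = w}"
    have Z: "m \<le> z \<and> z < n \<and> par z = last [0, w]" if "z \<in> Z" for z
      using that out[of z] w m by (auto simp: Z_def)
    have Z': "\<And>z. z \<in> Z \<Longrightarrow> m \<le> z \<and> z < n \<and> par z = w" using Z by simp
    let ?par' = "\<lambda>z. if z \<in> Z then hd [0, w] else par z"
    have step: "orientation_sum f n (cycle_tree_arcs m n ?par') r \<le> orientation_sum f n (cycle_tree_arcs m n par) r"
    proof (rule reattach_le[OF m pf f W Z _ _ _ _ _ _ refl])
      show "distinct [0, w]" "set [0, w] \<subseteq> {0..<n}" "2 \<le> length [0, w]" using w m by auto
      show "descendants par Z \<inter> set [0, w] = {}"
        using descendants_props[OF m pf Z'] m by fastforce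
      have 0: "(0, w) \<in> cycle_tree_arcs m n par" "(w, 0) \<in> cycle_tree_arcs m n par"
        using tree_arcI[OF w(1,2), of par] w0 by simp_all
      show "(a, b) \<in> cycle_tree_arcs m n par \<longleftrightarrow> (a, b) \<in> path_arcs [0, w]" if "a \<in> set [0, w]" "b \<in> set [0, w]" for a b
        using that 0 cycle_tree_arcs_irrefl[OF m pf] w m by (auto simp: path_arcs_def)
      show "b \<in> set [0, w] \<or> a = last [0, w] \<and> b \<in> Z"
        if "a \<in> set [0, w]" "a \<noteq> hd [0, w]" "(a, b) \<in> cycle_tree_arcs m n par" for a b
      proof -
        have a: "a = w" using that by simp
        from that(3) show ?thesis
          by (rule cycle_tree_arcs_cases) (use a w w0 cycle_edge_setD[of a b m] cycle_edge_setD[of b a m] in \<open>auto simp: Z_def\<close>)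
      qed
    qed
    have pf': "parent_function m n \<rho> ?par'"
      unfolding parent_function_def
    proof (intro conjI allI impI)
      fix z assume z: "m \<le> z \<and> z < n"
      show "?par' z = 0 \<or> m \<le> ?par' z \<and> ?par' z < n" using pD(1)[of z] z by auto
      show "\<rho> (?par' z) < \<rho> z" using pD(2)[of z] pD(2)[OF w(1,2)] z w0 Z'[of z] by (auto intro: less_trans)
    next
      fix z assume "\<not> (m \<le> z \<and> z < n)"
      then show "?par' z = 0" using out[of z] by auto
    qed
    have "{z. ?par' z \<noteq> 0} \<subset> {z. par z \<noteq> 0}"
    proof
      show "{z. ?par' z \<noteq> 0} \<subseteq> {z. par z \<noteq> 0}" by auto
      have "x \<in> Z" by (simp add: Z_def w_def)
      then show "{z. ?par' z \<noteq> 0} \<noteq> {z. par z \<noteq> 0}" using x by auto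
    qed
    then have "card {z. ?par' z \<noteq> 0} < card {z. par z \<noteq> 0}"
      using sub finite_subset[OF sub] by (intro psubset_card_mono) auto
    from less.hyps[OF this pf'] step show ?thesis by simp
  qed
qed

section \<open>Cycles with a rooted tree: the path is maximal\<close>

text \<open>The tree that is a path \<open>0, m, m + 1, \<dots>, n - 1\<close>.\<close>

definition path_parent :: "nat \<Rightarrow> nat \<Rightarrow> nat \<Rightarrow> nat" where
  "path_parent m n x = (if m < x \<and> x < n then x - 1 else 0)"

text \<open>
  If no vertex has two children, then there is at most one vertex of each depth, and numbering
  by depth gives the path.
\<close>

lemma injective_parent_relabel:
  assumes m: "2 \<le> m" "m \<le> n" and pf: "parent_function m n \<rho> par"
    and inj: "inj_on par {m..<n}"
  shows "\<exists>\<sigma>. \<sigma> permutes {0..<n} \<and>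
    (\<lambda>(x, y). (\<sigma> x, \<sigma> y)) ` cycle_tree_arcs m n par = cycle_tree_arcs m n (path_parent m n)"
proof -
  note pD = parD[OF m pf]
  obtain d where d: "d 0 = 0" "\<And>x. m \<le> x \<and> x < n \<Longrightarrow> d x = Suc (d (par x))"
    using ex_depth[OF m pf] by blast
  let ?T = "{m..<n}"
  have d_inj: "x = y" if "x \<in> ?T" "y \<in> ?T" "d x = d y" for x y
    using that
  proof (induction "d x" arbitrary: x y rule: less_induct)
    case less
    have dx: "d x = Suc (d (par x))" and dy: "d y = Suc (d (par y))" using d(2) less.prems by auto
    then have eq: "d (par x) = d (par y)" using less.prems(3) by simp
    have px: "par x = 0 \<or> par x \<in> ?T" "par y = 0 \<or> par y \<in> ?T" using pD(1) less.prems by auto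
    have pos: "d z > 0" if "z \<in> ?T" for z using d(2)[of z] that by simp
    have "par x = par y"
    proof (cases "par x = 0 \<or> par y = 0")
      case True
      then have "d (par x) = 0" "d (par y) = 0" using eq d(1) by auto
      then have "par x = 0" "par y = 0" using px pos by (metis less_irrefl)+
      then show ?thesis by simp
    next
      case False
      then have "par x \<in> ?T" "par y \<in> ?T" using px by (simp_all del: atLeastLessThan_iff)
      then show ?thesis using less.hyps[of "par x" "par y"] dx eq by simp
    qed
    then show ?case using inj_onD[OF inj] less.prems by blast
  qed
  have inj_d: "inj_on d ?T" using d_inj by (auto simp: inj_on_def)
  have down: "k \<in> d ` ?T" if "x \<in> ?T" "0 < k" "k \<le> d x" for x k
    using that
  proof (induction "d x" arbitrary: x)
    case (Suc e)
    show ?case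
    proof (cases "k = d x")
      case False
      have dx: "d x = Suc (d (par x))" using d(2) Suc.prems by auto
      then have k: "k \<le> d (par x)" using False Suc.prems by simp
      then have "par x \<noteq> 0" using d(1) Suc.prems by (metis le_zero_eq less_irrefl)
      then have "par x \<in> ?T" using pD(1)[of x] Suc.prems by auto
      then show ?thesis using Suc.hyps(1)[of "par x"] Suc.hyps(2) dx k Suc.prems(2) by simp
    qed (use Suc.prems in blast)
  qed simp
  have d_bound: "1 \<le> d x \<and> d x \<le> n - m" if "x \<in> ?T" for x
  proof -
    have "{1..d x} \<subseteq> d ` ?T" using down[OF that] by auto
    then have "card {1..d x} \<le> card (d ` ?T)" by (intro card_mono) auto
    also have "\<dots> \<le> n - m" using card_image_le[of ?T d] by simp
    finally show ?thesis using d(2)[of x] that by simp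
  qed
  define \<sigma> where "\<sigma> x = (if x \<in> ?T then m + d x - 1 else x)" for x
  have \<sigma>T: "\<sigma> x \<in> ?T" if "x \<in> ?T" for x using d_bound[OF that] that m by (auto simp: \<sigma>_def)
  have \<sigma>inj: "inj_on \<sigma> ?T"
  proof (rule inj_onI)
    fix x y assume xy: "x \<in> ?T" "y \<in> ?T" "\<sigma> x = \<sigma> y"
    then have "m + d x - 1 = m + d y - 1" by (simp add: \<sigma>_def)
    then have "d x = d y" using d_bound[OF xy(1)] d_bound[OF xy(2)] by linarith
    then show "x = y" using d_inj xy by blast
  qed
  have "\<sigma> ` ?T = ?T" using \<sigma>T \<sigma>inj by (intro endo_inj_surj) auto
  then have "\<sigma> permutes ?T" using \<sigma>inj by (intro bij_imp_permutes) (auto simp: bij_betw_def \<sigma>_def)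
  then have perm: "\<sigma> permutes {0..<n}" by (rule permutes_subset) auto
  have par: "\<sigma> (par x) = path_parent m n (\<sigma> x)" if x: "x \<in> ?T" for x
  proof -
    have dx: "d x = Suc (d (par x))" using d(2) x by auto
    have sx: "\<sigma> x = m + d (par x)" using x dx by (simp add: \<sigma>_def)
    show ?thesis
    proof (cases "par x = 0")
      case True
      then show ?thesis using sx d(1) m by (simp add: \<sigma>_def path_parent_def)
    next
      case False
      then have p: "par x \<in> ?T" using pD(1)[of x] x by auto
      have "d (par x) \<ge> 1" using d_bound[OF p] by simp
      moreover have "\<sigma> x < n" using \<sigma>T[OF x] by simp
      ultimately show ?thesis using sx p by (simp add: \<sigma>_def path_parent_def)
    qed
  qed
  let ?s = "\<lambda>(x, y). (\<sigma> x, \<sigma> y)"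
  have cyc: "?s ` cycle_edge_set m = cycle_edge_set m"
  proof -
    have "?s p = p" if "p \<in> cycle_edge_set m" for p
    proof -
      obtain x y where "p = (x, y)" by (cases p)
      then show ?thesis using cycle_edge_setD[of x y m] that by (simp add: \<sigma>_def)
    qed
    then show ?thesis by simp
  qed
  have tree: "?s ` {(x, par x) | x. m \<le> x \<and> x < n} = {(x, path_parent m n x) | x. m \<le> x \<and> x < n}"
  proof -
    have a: "{(x, p x) | x. m \<le> x \<and> x < n} = (\<lambda>x. (x, p x)) ` ?T" for p :: "nat \<Rightarrow> nat" by auto
    have "?s ` (\<lambda>x. (x, par x)) ` ?T = (\<lambda>x. (\<sigma> x, path_parent m n (\<sigma> x))) ` ?T"
      unfolding image_image using par by (intro image_cong) auto
    also have "\<dots> = (\<lambda>x. (x, path_parent m n x)) ` \<sigma> ` ?T" by (simp only: image_image)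
    also have "\<sigma> ` ?T = ?T" by fact
    finally show ?thesis unfolding a .
  qed
  have conv: "?s ` (E\<inverse>) = (?s ` E)\<inverse>" for E :: "(nat \<times> nat) set" by force
  have "?s ` cycle_tree_arcs m n par = cycle_tree_arcs m n (path_parent m n)"
    unfolding cycle_tree_arcs_def Let_def by (simp only: image_Un conv cyc tree)
  then show ?thesis using perm by blast
qed

text \<open>Go down from \<open>v\<close> until there are no more children.\<close>

lemma ex_pendant_chain:
  assumes m: "2 \<le> m" "m \<le> n" and pf: "parent_function m n \<rho> par"
  shows "v < n \<Longrightarrow> m \<le> v \<Longrightarrow>
    \<exists>vs. vs \<noteq> [] \<and> hd vs = v \<and> successively (\<lambda>x y. m \<le> y \<and> y < n \<and> par y = x) vs \<and>
      (\<forall>x\<in>set vs. m \<le> x \<and> x < n \<and> \<rho> v \<le> \<rho> x) \<and> (\<forall>y. m \<le> y \<and> y < n \<longrightarrow> par y \<noteq> last vs)"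
proof (induction "Max (\<rho> ` {0..<n}) - \<rho> v" arbitrary: v rule: less_induct)
  case less
  note pD = parD[OF m pf]
  show ?case
  proof (cases "\<exists>y. m \<le> y \<and> y < n \<and> par y = v")
    case True
    then obtain y where y: "m \<le> y" "y < n" "par y = v" by blast
    have \<rho>: "\<rho> v < \<rho> y" using pD(2) y by blast
    have "\<rho> y \<le> Max (\<rho> ` {0..<n})" using y by (intro Max_ge) auto
    then have "Max (\<rho> ` {0..<n}) - \<rho> y < Max (\<rho> ` {0..<n}) - \<rho> v" using \<rho> by simp
    from less.hyps[OF this y(2,1)] obtain vs where vs: "vs \<noteq> []" "hd vs = y"
      "successively (\<lambda>x y. m \<le> y \<and> y < n \<and> par y = x) vs"
      "\<forall>x\<in>set vs. m \<le> x \<and> x < n \<and> \<rho> y \<le> \<rho> x" "\<forall>y. m \<le> y \<and> y < n \<longrightarrow> par y \<noteq> last vs" by blast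
    show ?thesis
      using vs y \<rho> less.prems by (intro exI[of _ "v # vs"]) (auto simp: successively_Cons intro: less_imp_le less_le_trans)
  next
    case False
    then show ?thesis using less.prems by (intro exI[of _ "[v]"]) auto
  qed
qed

lemma chain_nth:
  assumes "successively (\<lambda>x y. m \<le> y \<and> y < n \<and> par y = x) vs" "Suc i < length vs"
  shows "m \<le> vs ! Suc i" "vs ! Suc i < n" "par (vs ! Suc i) = vs ! i"
  using successively_nth[OF assms] by auto

text \<open>
  Choose a branching vertex \<open>u\<close> of largest rank. Below each of its children the
  tree is a bare path, so all other branches at \<open>u\<close> can be moved to the end
  \<open>w\<close> of one of these paths, and the original graph arises from the new one by a
  shift. The new parent function has the additional value \<open>w\<close>, which ensures
  termination.
\<close>

lemma path_ge:
  assumes m: "2 \<le> m" "m \<le> n" and f: "f \<in> class_functions n" and W: "\<And>g. cycle_weight f n g \<ge> 0"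
  shows "parent_function m n \<rho> par \<Longrightarrow>
    orientation_sum f n (cycle_tree_arcs m n par) r \<le> orientation_sum f n (cycle_tree_arcs m n (path_parent m n)) r"
proof (induction "n - card (par ` {m..<n})" arbitrary: par \<rho> rule: less_induct)
  case less
  note pf = less.prems
  note out = par_outside[OF m pf] and pD = parD[OF m pf]
  let ?T = "{m..<n}"
  show ?case
  proof (cases "inj_on par ?T")
    case True
    obtain \<sigma> where "\<sigma> permutes {0..<n}"
      "(\<lambda>(x, y). (\<sigma> x, \<sigma> y)) ` cycle_tree_arcs m n par = cycle_tree_arcs m n (path_parent m n)"
      using injective_parent_relabel[OF m pf True] by blast
    then show ?thesis using orientation_sum_relabel[OF f, of \<sigma> "cycle_tree_arcs m n par" r] by simp
  next
    case False
    define branching where "branching u \<longleftrightarrow> (\<exists>x\<in>?T. \<exists>y\<in>?T. x \<noteq> y \<and> par x = u \<and> par y = u)" for u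
    let ?U = "{u. branching u}"
    have U: "?U \<subseteq> par ` ?T" by (auto simp: branching_def)
    then have fU: "finite ?U" by (rule finite_subset) simp
    have "?U \<noteq> {}" using False by (auto simp: inj_on_def branching_def)
    then have "Max (\<rho> ` ?U) \<in> \<rho> ` ?U" using fU by (intro Max_in) auto
    then obtain u where u: "branching u" "\<rho> u = Max (\<rho> ` ?U)" by auto
    have umax: "\<not> branching v" if "\<rho> u < \<rho> v" for v
    proof
      assume "branching v"
      then have "\<rho> v \<le> \<rho> u" unfolding u(2) using fU by (intro Max_ge) auto
      then show False using that by simp
    qed
    obtain p q where pq: "p \<in> ?T" "q \<in> ?T" "p \<noteq> q" "par p = u" "par q = u"
      using u(1) by (auto simp: branching_def)
    have up: "\<rho> u < \<rho> p" using pD(2)[of p] pq by auto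
    have uT: "u = 0 \<or> u \<in> ?T" using pD(1)[of p] pq by auto
    obtain ws where ws: "ws \<noteq> []" "hd ws = p" "successively (\<lambda>x y. m \<le> y \<and> y < n \<and> par y = x) ws"
      "\<forall>x\<in>set ws. m \<le> x \<and> x < n \<and> \<rho> p \<le> \<rho> x" "\<forall>y. m \<le> y \<and> y < n \<longrightarrow> par y \<noteq> last ws"
      using ex_pendant_chain[OF m pf, of p] pq by auto
    define vs where "vs = u # ws"
    have chain: "successively (\<lambda>x y. m \<le> y \<and> y < n \<and> par y = x) vs"
      using ws(1-3) pq by (auto simp: vs_def successively_Cons)
    note cn = chain_nth[OF chain]
    have hdlast: "hd vs = u" "last vs = last ws" and len: "length vs \<ge> 2"
      using ws(1) by (auto simp: vs_def Suc_le_eq)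
    define w where "w = last ws"
    have wmem: "w \<in> set ws" using ws(1) by (simp add: w_def)
    have w: "m \<le> w" "w < n" "\<rho> p \<le> \<rho> w" using ws(4) wmem by auto
    have wsu: "\<rho> u < \<rho> x" if "x \<in> set ws" for x using ws(4) that up by fastforce
    have mono: "\<rho> (vs ! i) < \<rho> (vs ! j)" if "i < j" "j < length vs" for i j
      using that
    proof (induction j rule: less_induct)
      case (less j)
      then obtain k where k: "j = Suc k" by (cases j) auto
      have "\<rho> (vs ! k) < \<rho> (vs ! j)" using cn[of k] pD(2)[of "vs ! j"] less.prems k by simp
      moreover have "\<rho> (vs ! i) \<le> \<rho> (vs ! k)" using less.IH[of k] less.prems k by (cases "i = k") auto
      ultimately show ?case by simp
    qed
    have dist: "distinct vs" unfolding distinct_conv_nth using mono by (metis less_irrefl nat_neq_iff)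
    have le_w: "\<rho> x \<le> \<rho> w" if xv: "x \<in> set vs" for x
    proof -
      obtain i where i: "i < length vs" "x = vs ! i" using xv by (auto simp: in_set_conv_nth)
      have "w = vs ! (length vs - 1)" using ws(1) by (simp add: w_def vs_def last_conv_nth)
      moreover have "\<rho> (vs ! i) < \<rho> (vs ! (length vs - 1))" if "i \<noteq> length vs - 1"
        by (rule mono) (use that i in linarith)+
      ultimately show ?thesis using i by (cases "i = length vs - 1") auto
    qed
    define Z where "Z = {z \<in> ?T. par z = u \<and> z \<noteq> p}"
    have Zu: "\<And>z. z \<in> Z \<Longrightarrow> m \<le> z \<and> z < n \<and> par z = u" by (auto simp: Z_def)
    define par' where "par' x = (if x \<in> Z then w else par x)" for x
    define D where "D = descendants par Z"
    have Du: "m \<le> x \<and> x < n \<and> \<rho> u < \<rho> x" if "x \<in> D" for x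
      using descendants_props[OF m pf Zu] that by (auto simp: D_def)
    have Diff: "x \<in> D \<longleftrightarrow> x \<in> Z \<or> par x \<in> D" for x
      unfolding D_def by (rule descendants_iff[OF m pf])
    have vsZ: "vs ! i \<notin> Z" if "i < length vs" for i
    proof
      assume z: "vs ! i \<in> Z"
      show False
      proof (cases i)
        case 0
        then have "u \<in> Z" using z by (simp add: vs_def)
        then show False using Zu[of u] pD(2)[of u] by auto
      next
        case (Suc j)
        then have "vs ! j = u" using cn[of j] that Zu[OF z] by simp
        moreover have "vs ! 0 = u" by (simp add: vs_def)
        ultimately have "j = 0" using mono[of 0 j] that Suc by (cases "j = 0") auto
        then have "vs ! i = p" using Suc ws(1,2) by (simp add: vs_def hd_conv_nth)
        then show False using z by (simp add: Z_def)
      qed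
    qed
    have vsD: "vs ! i \<notin> D" if "i < length vs" for i
      using that
    proof (induction i)
      case 0
      show ?case using Du[of u] by (auto simp: vs_def)
    next
      case (Suc i)
      then show ?case using Diff[of "vs ! Suc i"] vsZ[of "Suc i"] cn[of i] by simp
    qed
    have wD: "w \<notin> D" using vsD[of "length vs - 1"] ws(1) by (simp add: w_def vs_def last_conv_nth)
    \<comment> \<open>raise the ranks in the moved branches above the rank of their new attaching vertex \<open>w\<close>\<close>
    define \<rho>' where "\<rho>' x = (if x \<in> D then \<rho> x + \<rho> w + 1 else \<rho> x)" for x
    have pf': "parent_function m n \<rho>' par'"
      unfolding parent_function_def
    proof (intro conjI allI impI)
      fix x assume x: "m \<le> x \<and> x < n"
      show "par' x = 0 \<or> m \<le> par' x \<and> par' x < n" using pD(1)[of x] x w by (auto simp: par'_def)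
      show "\<rho>' (par' x) < \<rho>' x"
      proof (cases "x \<in> Z")
        case True
        then have "x \<in> D" using Diff by blast
        then show ?thesis using True wD by (simp add: par'_def \<rho>'_def)
      next
        case False
        then have "x \<in> D \<longleftrightarrow> par x \<in> D" using Diff by blast
        then show ?thesis using False pD(2)[of x] x by (simp add: par'_def \<rho>'_def)
      qed
    next
      fix x assume x: "\<not> (m \<le> x \<and> x < n)"
      then have "x \<notin> Z" using Zu by blast
      then show "par' x = 0" using out[OF x] by (simp add: par'_def)
    qed
    note out' = par_outside[OF m pf'] and pD' = parD[OF m pf']
    have Zw: "m \<le> z \<and> z < n \<and> par' z = last vs" if "z \<in> Z" for z
      using Zu[OF that] that hdlast(2) by (simp add: par'_def w_def)
    have dvs: "descendants par' Z \<inter> set vs = {}"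
    proof (rule ccontr)
      assume "descendants par' Z \<inter> set vs \<noteq> {}"
      then obtain x where x: "x \<in> descendants par' Z" "x \<in> set vs" by blast
      then obtain i where "i < length vs" "x = vs ! i" by (auto simp: in_set_conv_nth)
      then have "\<rho>' x = \<rho> x" using vsD by (simp add: \<rho>'_def)
      moreover have "\<rho>' w < \<rho>' x" using descendants_props[OF m pf' Zw x(1)] hdlast(2) by (simp add: w_def)
      ultimately show False using le_w[OF x(2)] wD by (simp add: \<rho>'_def)
    qed
    have memvs: "x \<in> set vs \<Longrightarrow> x = u \<or> m \<le> x \<and> x < n" for x using ws(4) by (auto simp: vs_def)
    have noc: "(x, y) \<notin> cycle_edge_set m" if "x \<in> set vs" "y \<in> set vs" for x y
    proof
      assume c: "(x, y) \<in> cycle_edge_set m"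
      then have "x < m" "y < m" using cycle_edge_setD by blast+
      then have "x = u" "y = u" using memvs[OF that(1)] memvs[OF that(2)] by simp_all
      moreover have "(x, y) \<in> cycle_tree_arcs m n par" using c by (simp add: cycle_tree_arcs_def Let_def)
      ultimately show False using cycle_tree_arcs_irrefl[OF m pf] by blast
    qed
    have up_arc: "(x, par' x) \<in> path_arcs vs \<and> (par' x, x) \<in> path_arcs vs"
      if x: "x \<in> set vs" "m \<le> x" "x < n" and px: "par' x \<in> set vs" for x
    proof -
      obtain i where i: "i < length vs" "x = vs ! i" using x(1) by (auto simp: in_set_conv_nth)
      have pe: "par' x = par x" using vsZ i by (simp add: par'_def)
      show ?thesis
      proof (cases i)
        case 0
        obtain j where j: "j < length vs" "par x = vs ! j" using px pe by (auto simp: in_set_conv_nth)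
        have "\<rho> (par x) < \<rho> (vs ! 0)" using pD(2)[of x] x i 0 by simp
        then show ?thesis using mono[of 0 j] j by (cases "j = 0") auto
      next
        case (Suc j)
        then have "par x = vs ! j" using cn[of j] i by simp
        then show ?thesis using pe i Suc unfolding path_arcs_def by auto
      qed
    qed
    have "orientation_sum f n (cycle_tree_arcs m n (\<lambda>x. if x \<in> Z then hd vs else par' x)) r
        \<le> orientation_sum f n (cycle_tree_arcs m n par') r"
    proof (rule reattach_le[OF m pf' f W Zw dist _ len dvs _ _ refl])
      show "set vs \<subseteq> {0..<n}" using memvs uT m by fastforce
      show "(x, y) \<in> cycle_tree_arcs m n par' \<longleftrightarrow> (x, y) \<in> path_arcs vs" if xy: "x \<in> set vs" "y \<in> set vs" for x y
      proof
        assume "(x, y) \<in> cycle_tree_arcs m n par'"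
        then show "(x, y) \<in> path_arcs vs"
          by (rule cycle_tree_arcs_cases) (use noc xy up_arc in blast)+
      next
        have a: "(vs ! Suc i, vs ! i) \<in> cycle_tree_arcs m n par' \<and> (vs ! i, vs ! Suc i) \<in> cycle_tree_arcs m n par'"
          if "Suc i < length vs" for i
        proof -
          have "par' (vs ! Suc i) = vs ! i" using cn(3)[OF that] vsZ[OF that] by (simp add: par'_def)
          then show ?thesis using tree_arcI[OF cn(1,2)[OF that], of par'] by simp
        qed
        assume "(x, y) \<in> path_arcs vs"
        then show "(x, y) \<in> cycle_tree_arcs m n par'" using a by (auto simp: path_arcs_def)
      qed
      show "y \<in> set vs \<or> x = last vs \<and> y \<in> Z"
        if xy: "x \<in> set vs" "x \<noteq> hd vs" "(x, y) \<in> cycle_tree_arcs m n par'" for x y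
      proof -
        obtain i where i: "i < length vs" "x = vs ! i" using xy(1) by (auto simp: in_set_conv_nth)
        have "i \<noteq> 0" using xy(2) i hdlast(1) by (cases i) (auto simp: vs_def)
        then obtain j where j: "i = Suc j" by (cases i) auto
        have xws: "x \<in> set ws" using xy hdlast by (auto simp: vs_def)
        have xm: "m \<le> x" using ws(4) xws by blast
        from xy(3) show ?thesis
        proof (rule cycle_tree_arcs_cases)
          assume "y = par' x"
          then have "y = vs ! j" using vsZ i j cn[of j] by (simp add: par'_def)
          then show ?thesis using i j by simp
        next
          assume y: "m \<le> y" "y < n" "x = par' y"
          show ?thesis
          proof (cases "y \<in> Z")
            case True
            then show ?thesis using y hdlast by (simp add: par'_def w_def)
          next
            case False
            then have py: "par y = x" using y by (simp add: par'_def)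
            have "x \<noteq> last ws" using ws(5) y py by blast
            then have "Suc i < length vs" using i ws(1) by (metis One_nat_def Suc_lessI diff_Suc_1 hdlast(2) last_conv_nth length_0_conv not_less_zero)
            then have "vs ! Suc i \<in> ?T" "par (vs ! Suc i) = x" "vs ! Suc i \<in> set vs" using cn[of i] i by auto
            moreover have "\<not> branching x" using umax wsu[OF xws] by blast
            moreover have "y \<in> ?T" using y by simp
            ultimately have "y = vs ! Suc i" using py unfolding branching_def by blast
            then show ?thesis using \<open>vs ! Suc i \<in> set vs\<close> by simp
          qed
        qed (use xm cycle_edge_setD[of x y m] cycle_edge_setD[of y x m] in auto)
      qed
    qed
    moreover have "(\<lambda>x. if x \<in> Z then hd vs else par' x) = par"
      using Zu hdlast(1) by (auto simp: par'_def fun_eq_iff)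
    moreover have "orientation_sum f n (cycle_tree_arcs m n par') r
        \<le> orientation_sum f n (cycle_tree_arcs m n (path_parent m n)) r"
    proof (rule less.hyps[OF _ pf'])
      have sub: "insert w (par ` ?T) \<subseteq> par' ` ?T"
      proof
        fix y assume "y \<in> insert w (par ` ?T)"
        then consider "y = w" | x where "x \<in> ?T" "y = par x" by blast
        then show "y \<in> par' ` ?T"
        proof cases
          case 1
          have "q \<in> Z" using pq by (simp add: Z_def)
          then show ?thesis using 1 pq(2) by (intro image_eqI[of _ _ q]) (auto simp: par'_def)
        next
          case 2
          show ?thesis
          proof (cases "x \<in> Z")
            case True
            then have "y = par' p" using 2 Zu[OF True] pq by (simp add: par'_def Z_def)
            then show ?thesis using pq by blast
          next
            case False
            then show ?thesis using 2 by (intro image_eqI[of _ _ x]) (auto simp: par'_def)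
          qed
        qed
      qed
      have "w \<notin> par ` ?T" using ws(5) by (auto simp: w_def)
      then have "Suc (card (par ` ?T)) = card (insert w (par ` ?T))" by simp
      also have "\<dots> \<le> card (par' ` ?T)" using sub by (intro card_mono) auto
      finally have "card (par ` ?T) < card (par' ` ?T)" by simp
      moreover have "card (par' ` ?T) \<le> n" using card_image_le[of ?T par'] by simp
      ultimately show "n - card (par' ` ?T) < n - card (par ` ?T)" by simp
    qed
    ultimately show ?thesis by simp
  qed
qed

section \<open>The shape of unicyclic graphs with one branching cycle vertex\<close>

text \<open>
  Connectivity of a digraph is defined by its symmetric closure, which is the graph itself here.
\<close>

lemma connected_rtrancl:
  assumes G: "simple_graph_on n G" and con: "Digraph_Component.connected (with_proj G)" and xy: "x < n" "y < n"
  shows "(x, y) \<in> (parcs G)\<^sup>*"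
proof -
  have V: "pverts G = {0..<n}" using G by (simp add: simple_graph_on_def)
  have sym: "sym (parcs G)" by (rule simple_graph_onD(2)[OF G])
  let ?S = "mk_symmetric (with_proj G)"
  have "parcs ?S = parcs G"
    using sym by (force simp: parcs_mk_symmetric sym_def)
  moreover have "x \<rightarrow>\<^sup>*\<^bsub>with_proj ?S\<^esub> y"
    using con xy V unfolding connected_def strongly_connected_def by simp
  then have "(x, y) \<in> (arcs_ends (with_proj ?S))\<^sup>*" by (rule reachable_rtranclI)
  ultimately show ?thesis by simp
qed

lemma undirected_cycle_vertex_list:
  assumes "undirected_cycle G c"
  obtains xs where "length xs = length c" "distinct xs" "set xs = cycle_verts c"
    "set c = {(xs ! i, xs ! (Suc i mod length xs)) | i. i < length xs}" "set c \<subseteq> parcs G"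
proof -
  obtain u where u: "pre_digraph.awalk (with_proj G) u c u" "distinct (tl (pawalk_verts u c))" "c \<noteq> []"
    using assms unfolding undirected_cycle_def pre_digraph.cycle_def awalk_verts_with_proj_eq by blast
  have cas: "pcas u c u" and sub: "set c \<subseteq> parcs G"
    using u(1) by (auto simp: pre_digraph.awalk_def cas_with_proj_eq)
  define xs where "xs = map fst c"
  have z: "c = zip (pawalk_verts u c) (tl (pawalk_verts u c))" "pawalk_verts u c = xs @ [u]" "hd (pawalk_verts u c) = u"
    using pcas_imp_zip[OF cas] by (auto simp: xs_def)
  have ne: "xs \<noteq> []" using u(3) by (simp add: xs_def)
  have hd: "hd xs = u" using z(2,3) ne by simp
  have "distinct (tl xs @ [u])" using u(2) z(2) ne by simp
  then have "distinct (u # tl xs)" by auto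
  moreover have "u # tl xs = xs" using hd ne by auto
  ultimately have dist: "distinct xs" by (simp only:)
  have "set c = {((xs @ [u]) ! i, (xs @ [u]) ! Suc i) | i. Suc i < length (xs @ [u])}"
    using set_zip_tl[of "xs @ [u]"] z(1) unfolding z(2) by simp
  also have "\<dots> = {(xs ! i, xs ! (Suc i mod length xs)) | i. i < length xs}"
  proof -
    have "(xs @ [u]) ! i = xs ! i \<and> (xs @ [u]) ! Suc i = xs ! (Suc i mod length xs)" if "i < length xs" for i
    proof (cases "Suc i = length xs")
      case True
      then have "(xs @ [u]) ! Suc i = u" by (metis nth_append_length)
      moreover have "xs ! (Suc i mod length xs) = u" using True hd ne by (simp add: hd_conv_nth)
      ultimately show ?thesis using that by (simp add: nth_append)
    next
      case False
      then show ?thesis using that by (simp add: nth_append)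
    qed
    then show ?thesis by (intro Collect_cong) (metis (no_types, lifting) length_append_singleton Suc_less_eq)
  qed
  finally have "set c = {(xs ! i, xs ! (Suc i mod length xs)) | i. i < length xs}" .
  moreover have "set xs = cycle_verts c" by (simp add: xs_def cycle_verts_def)
  ultimately show ?thesis using that[of xs] dist sub by (simp add: xs_def)
qed

lemma rotated_cycle_arcs:
  assumes "j < length xs"
  shows "{(rotate j xs ! i, rotate j xs ! (Suc i mod length xs)) | i. i < length xs} =
    {(xs ! i, xs ! (Suc i mod length xs)) | i. i < length xs}" (is "?L = ?R")
proof
  let ?m = "length xs"
  have m: "?m > 0" using assms by linarith
  have arc: "(rotate j xs ! i, rotate j xs ! (Suc i mod ?m)) = (xs ! k, xs ! (Suc k mod ?m))"
    if "i < ?m" "k = (j + i) mod ?m" for i k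
    using that m by (simp add: nth_rotate mod_simps)
  show "?L \<subseteq> ?R"
  proof
    fix p assume "p \<in> ?L"
    then obtain i where i: "i < ?m" "p = (rotate j xs ! i, rotate j xs ! (Suc i mod ?m))" by blast
    then show "p \<in> ?R" using arc[OF i(1) refl] m by (auto intro!: exI[of _ "(j + i) mod ?m"])
  qed
  show "?R \<subseteq> ?L"
  proof
    fix p assume "p \<in> ?R"
    then obtain k where k: "k < ?m" "p = (xs ! k, xs ! (Suc k mod ?m))" by blast
    define i where "i = (k + ?m - j) mod ?m"
    have "(j + i) mod ?m = (j + (k + ?m - j)) mod ?m" by (simp add: i_def mod_simps)
    also have "j + (k + ?m - j) = k + ?m" using assms by simp
    finally have "k = (j + i) mod ?m" using k(1) by simp
    moreover have "i < ?m" using m by (simp add: i_def)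
    ultimately have "i < ?m \<and> p = (rotate j xs ! i, rotate j xs ! (Suc i mod ?m))"
      using arc[of i k] k(2) by simp
    then show "p \<in> ?L" by blast
  qed
qed

text \<open>A second connection between the endpoints of an edge would close another cycle.\<close>

lemma unicyclic_other_arcs_bridges:
  assumes G: "simple_graph_on n G" and e: "(x, y) \<in> parcs G" "{x, y} \<notin> cycle_edges c"
    and uniq: "\<And>c'. undirected_cycle G c' \<Longrightarrow> cycle_edges c' = cycle_edges c"
  shows "(x, y) \<notin> (parcs G - {(x, y), (y, x)})\<^sup>*"
proof
  let ?R = "parcs G - {(x, y), (y, x)}"
  note E = simple_graph_onD[OF G]
  assume "(x, y) \<in> ?R\<^sup>*"
  then obtain xs where xs: "xs \<noteq> []" "hd xs = x" "last xs = y" "distinct xs" "successively (\<lambda>a b. (a, b) \<in> ?R) xs"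
    using rtrancl_distinct_list by metis
  have xy: "x \<noteq> y" using e E(3) by blast
  have len: "length xs \<ge> 3"
  proof (rule ccontr)
    assume "\<not> ?thesis"
    moreover have "length xs \<noteq> 0" using xs(1) by simp
    ultimately have "length xs = 1 \<or> length xs = 2" by linarith
    then show False
    proof
      assume "length xs = 1"
      then show False using xs(2,3) xy by (cases xs) auto
    next
      assume "length xs = 2"
      then obtain a b where "xs = [a, b]" by (auto simp: length_Suc_conv numeral_2_eq_2)
      then show False using xs(2,3,5) by simp
    qed
  qed
  have "successively (\<lambda>a b. (a, b) \<in> parcs G) xs" using xs(5) by (rule successively_mono) auto
  moreover have "(y, x) \<in> parcs G" using e(1) E(2) by (auto dest: symD)
  ultimately have closed: "successively (\<lambda>a b. (a, b) \<in> parcs G) (xs @ [hd xs])"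
    using xs(1-3) by (simp add: successively_append_iff)
  let ?ys = "xs @ [hd xs]"
  let ?c = "zip ?ys (tl ?ys)"
  have "hd xs \<in> pverts G" using e(1) E(1) xs(2) G by (auto simp: simple_graph_on_def)
  then have "undirected_cycle G ?c" using undirected_cycle_of_list(1)[OF xs(4) len closed] by blast
  then have "cycle_edges ?c = cycle_edges c" by (rule uniq)
  moreover have "(y, x) \<in> set ?c"
  proof -
    have "(?ys ! (length xs - 1), ?ys ! Suc (length xs - 1)) \<in> set ?c"
      unfolding set_zip_tl using xs(1) by (auto intro!: exI[of _ "length xs - 1"])
    moreover have "?ys ! (length xs - 1) = y" using xs(1,3) by (simp add: nth_append last_conv_nth)
    moreover have "?ys ! Suc (length xs - 1) = x" using xs(1,2) by (simp add: nth_append)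
    ultimately show ?thesis by simp
  qed
  then have "{x, y} \<in> cycle_edges ?c" unfolding cycle_edges_def by force
  ultimately show False using e(2) by simp
qed

text \<open>
  All vertices of the cycle except \<open>v\<close> have their two neighbours on the cycle. Let
  the parent of a vertex off the cycle be a neighbour closer to \<open>v\<close>. An edge that
  belongs neither to the cycle nor to this tree would be a bridge, but its endpoints are both
  connected to \<open>v\<close> in the tree.
\<close>

lemma Omega_C_relabel:
  assumes G: "G \<in> Omega_C m n"
  shows "\<exists>\<sigma> \<rho> par. \<sigma> permutes {0..<n} \<and> parent_function m n \<rho> par \<and>
    (\<lambda>(x, y). (\<sigma> x, \<sigma> y)) ` parcs G = cycle_tree_arcs m n par"
proof -
  let ?V = "{0..<n}" and ?E = "parcs G"
  have sg: "simple_graph_on n G" and con: "Digraph_Component.connected (with_proj G)" using G by (auto simp: Omega_C_def)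
  note E = simple_graph_onD[OF sg]
  have symD: "(y, x) \<in> ?E" if "(x, y) \<in> ?E" for x y using E(2) that by (rule symD)
  obtain c where c: "undirected_cycle G c" "length c = m"
    and uniq: "\<And>c'. undirected_cycle G c' \<Longrightarrow> cycle_edges c' = cycle_edges c"
    and ex1: "\<exists>!v. v \<in> cycle_verts c \<and> out_degree (with_proj G) v \<noteq> 2"
    using G unfolding Omega_C_def by blast
  obtain ys where ys0: "length ys = length c" "distinct ys" "set ys = cycle_verts c"
    "set c = {(ys ! i, ys ! (Suc i mod length ys)) | i. i < length ys}" "set c \<subseteq> ?E"
    by (rule undirected_cycle_vertex_list[OF c(1)])
  note ys = ys0[unfolded c(2)]
  obtain v where v: "v \<in> set ys" "\<And>x. x \<in> set ys \<Longrightarrow> x \<noteq> v \<Longrightarrow> card (nbrs ?E x) = 2"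
    using ex1 ys(3) out_degree_nbrs[of G] by metis
  obtain j where j: "j < length ys" "ys ! j = v" using v(1) by (auto simp: in_set_conv_nth)
  define xs where "xs = rotate j ys"
  define C where "C = set xs"
  have m3: "m \<ge> 3" using c by (simp add: undirected_cycle_def)
  have xs: "length xs = m" "distinct xs" "xs ! 0 = v" "C = set ys"
    using ys j nth_rotate[of 0 ys j] m3 by (auto simp: xs_def C_def)
  define CA where "CA = {(xs ! i, xs ! (Suc i mod m)) | i. i < m}"
  have CAc: "CA = set c" using rotated_cycle_arcs[OF j(1)] ys(1,4) by (simp add: CA_def xs_def)
  have CAE: "CA \<subseteq> ?E" using CAc ys(5) by simp
  have CV: "C \<subseteq> ?V"
  proof
    fix x assume "x \<in> C"
    then obtain i where "i < m" "x = xs ! i" using xs(1) by (auto simp: C_def in_set_conv_nth)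
    then have "(x, xs ! (Suc i mod m)) \<in> CA" by (auto simp: CA_def)
    then show "x \<in> ?V" using CAE E(1) by blast
  qed
  have nth_eq: "xs ! a = xs ! b \<longleftrightarrow> a = b" if "a < m" "b < m" for a b
    using nth_eq_iff_index_eq[OF xs(2)] that xs(1) by simp
  have vC: "v \<in> C" using v(1) xs(4) by simp
  have inC: "(x, y) \<in> CA \<union> CA\<inverse>" if e: "(x, y) \<in> ?E" and x: "x \<in> C" "x \<noteq> v" for x y
  proof -
    obtain i where i: "i < m" "x = xs ! i" using x(1) xs(1) by (auto simp: C_def in_set_conv_nth)
    have "i \<noteq> 0" using x(2) i xs(3) by (cases i) auto
    then obtain p where p: "i = Suc p" by (cases i) auto
    let ?s = "Suc i mod m"
    have s: "?s < m" "?s \<noteq> p" using i p m3 by (cases "Suc i = m"; simp)+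
    have 1: "(x, xs ! ?s) \<in> CA" using i by (auto simp: CA_def)
    have "(xs ! p, xs ! (Suc p mod m)) \<in> CA" using i p by (auto simp: CA_def)
    then have 2: "(xs ! p, x) \<in> CA" using i p by simp
    have "{xs ! p, xs ! ?s} \<subseteq> nbrs ?E x" using 1 2 CAE symD by (auto simp: nbrs_def)
    moreover have "card {xs ! p, xs ! ?s} = 2" using nth_eq[of p ?s] s i p by simp
    moreover have "card (nbrs ?E x) = 2" using v(2) x xs(4) by blast
    ultimately have N: "nbrs ?E x = {xs ! p, xs ! ?s}"
      by (metis card.infinite card_subset_eq zero_neq_numeral)
    have "y \<in> {xs ! p, xs ! ?s}" unfolding N[symmetric] using e by (simp add: nbrs_def)
    then show ?thesis using 1 2 by blast
  qed
  \<comment> \<open>the distance to \<open>v\<close>\<close>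
  define D where "D x = (LEAST k. (x, v) \<in> ?E ^^ k)" for x
  have vn: "v < n" using vC CV by auto
  have step: "\<exists>y. (x, y) \<in> ?E \<and> D y < D x" if x: "x < n" "x \<noteq> v" for x
  proof -
    have "(x, v) \<in> ?E\<^sup>*" by (rule connected_rtrancl[OF sg con x(1) vn])
    then obtain k0 where "(x, v) \<in> ?E ^^ k0" using rtrancl_imp_relpow by blast
    then have k: "(x, v) \<in> ?E ^^ D x" unfolding D_def by (rule LeastI)
    have "D x \<noteq> 0" using k x(2) by (cases "D x") auto
    then obtain l where l: "D x = Suc l" by (cases "D x") auto
    then obtain y where y: "(x, y) \<in> ?E" "(y, v) \<in> ?E ^^ l" using relpow_Suc_D2[of x v l ?E] k by auto
    have "D y \<le> l" unfolding D_def by (rule Least_le) (rule y(2))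
    then show ?thesis using y(1) l by auto
  qed
  define par0 where "par0 x = (SOME y. (x, y) \<in> ?E \<and> D y < D x)" for x
  have par0: "(x, par0 x) \<in> ?E" "D (par0 x) < D x" if "x < n" "x \<noteq> v" for x
    using someI_ex[OF step[OF that]] by (auto simp: par0_def)
  let ?W = "?V - C"
  have W: "x < n" "x \<noteq> v" if "x \<in> ?W" for x using that vC by auto
  have CAmem: "x \<in> C \<and> y \<in> C" if e: "(x, y) \<in> CA" for x y
  proof -
    obtain i where i: "i < m" "x = xs ! i" "y = xs ! (Suc i mod m)" using e unfolding CA_def by blast
    have "Suc i mod m < m" using m3 by simp
    then show ?thesis using i xs(1) nth_mem by (simp add: C_def)
  qed
  have par0_mem: "par0 x = v \<or> par0 x \<in> ?W" if x: "x \<in> ?W" for x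
  proof -
    have e: "(x, par0 x) \<in> ?E" using par0(1) W[OF x] by blast
    have "par0 x = v" if "par0 x \<in> C"
    proof (rule ccontr)
      assume "par0 x \<noteq> v"
      then have "(par0 x, x) \<in> CA \<union> CA\<inverse>" using inC[OF symD[OF e]] that by blast
      then show False using CAmem x by blast
    qed
    then show ?thesis using e E(1) by blast
  qed
  define TA where "TA = {(x, par0 x) | x. x \<in> ?W}"
  have TAE: "TA \<union> TA\<inverse> \<subseteq> ?E" using par0(1) W symD by (auto simp: TA_def)
  have reach: "(x, v) \<in> (TA \<union> TA\<inverse>)\<^sup>*" if "x = v \<or> x \<in> ?W" for x
    using that
  proof (induction "D x" arbitrary: x rule: less_induct)
    case less
    show ?case
    proof (cases "x = v")
      case False
      then have x: "x \<in> ?W" using less.prems by blast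
      have "D (par0 x) < D x" using par0(2) W[OF x] by blast
      then have "(par0 x, v) \<in> (TA \<union> TA\<inverse>)\<^sup>*" using less.hyps par0_mem[OF x] by blast
      moreover have "(x, par0 x) \<in> TA \<union> TA\<inverse>" using x by (auto simp: TA_def)
      ultimately show ?thesis by (rule converse_rtrancl_into_rtrancl[rotated])
    qed simp
  qed
  have Eeq: "?E = CA \<union> CA\<inverse> \<union> (TA \<union> TA\<inverse>)"
  proof
    show "CA \<union> CA\<inverse> \<union> (TA \<union> TA\<inverse>) \<subseteq> ?E" using CAE TAE symD by blast
    show "?E \<subseteq> CA \<union> CA\<inverse> \<union> (TA \<union> TA\<inverse>)"
    proof (rule ccontr)
      assume "\<not> ?thesis"
      then obtain x y where e: "(x, y) \<in> ?E" and nc: "(x, y) \<notin> CA \<union> CA\<inverse>" and nt: "(x, y) \<notin> TA \<union> TA\<inverse>" by fast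
      have nt': "(y, x) \<notin> TA \<union> TA\<inverse>" using nt by blast
      have x: "x = v \<or> x \<in> ?W" using inC[OF e] nc e E(1) by blast
      have y: "y = v \<or> y \<in> ?W" using inC[OF symD[OF e]] nc e E(1) by blast
      have "(v, y) \<in> (TA \<union> TA\<inverse>)\<^sup>*"
      proof -
        have "sym ((TA \<union> TA\<inverse>)\<^sup>*)" by (rule sym_rtrancl) (auto simp: sym_def)
        then show ?thesis using reach[OF y] by (rule Relation.symD)
      qed
      then have "(x, y) \<in> (TA \<union> TA\<inverse>)\<^sup>*" using reach[OF x] by simp
      moreover have "(TA \<union> TA\<inverse>)\<^sup>* \<subseteq> (?E - {(x, y), (y, x)})\<^sup>*" using TAE nt nt' by (intro rtrancl_mono) blast
      ultimately have "(x, y) \<in> (?E - {(x, y), (y, x)})\<^sup>*" by blast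
      moreover have "{x, y} \<notin> cycle_edges c"
      proof
        assume "{x, y} \<in> cycle_edges c"
        then obtain a b where "(a, b) \<in> CA" "{x, y} = {a, b}" unfolding cycle_edges_def CAc by auto
        then show False using nc by (auto simp: doubleton_eq_iff)
      qed
      ultimately show False using unicyclic_other_arcs_bridges[OF sg e _ uniq] by blast
    qed
  qed
  \<comment> \<open>label the cycle in cyclic order starting with 0 at \<open>v\<close>, and the other vertices in any order\<close>
  have fC: "finite C" "card C = m" using xs(1,2) distinct_card[of xs] by (auto simp: C_def)
  have mn: "m \<le> n" using fC card_mono[OF _ CV] by simp
  have "card ?W = card {m..<n}" using fC CV by (simp add: card_Diff_subset)
  then obtain h where h: "bij_betw h ?W {m..<n}" using finite_same_card_bij[of ?W "{m..<n}"] by auto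
  define ix where "ix = the_inv_into {..<m} (\<lambda>i. xs ! i)"
  have bx: "bij_betw (\<lambda>i. xs ! i) {..<m} C" using bij_betw_nth[OF xs(2)] xs(1) by (simp add: C_def)
  have bix: "bij_betw ix C {..<m}" unfolding ix_def by (rule bij_betw_the_inv_into[OF bx])
  have ix: "ix (xs ! i) = i" if "i < m" for i
    unfolding ix_def using bx that by (intro the_inv_into_f_f) (auto simp: bij_betw_def)
  define \<sigma> where "\<sigma> x = (if x \<in> C then ix x else if x \<in> ?V then h x else x)" for x
  have "bij_betw \<sigma> C {..<m}" using bix by (rule bij_betw_cong[THEN iffD1, rotated]) (simp add: \<sigma>_def)
  moreover have b2: "bij_betw \<sigma> ?W {m..<n}" using h by (rule bij_betw_cong[THEN iffD1, rotated]) (simp add: \<sigma>_def)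
  ultimately have "bij_betw \<sigma> (C \<union> ?W) ({..<m} \<union> {m..<n})" by (rule bij_betw_combine) auto
  moreover have "C \<union> ?W = ?V" "{..<m} \<union> {m..<n} = ?V" using CV mn by auto
  ultimately have "bij_betw \<sigma> ?V ?V" by simp
  then have perm: "\<sigma> permutes ?V" by (rule bij_imp_permutes) (use CV in \<open>auto simp: \<sigma>_def\<close>)
  have \<sigma>W: "m \<le> \<sigma> x \<and> \<sigma> x < n" if "x \<in> ?W" for x using bij_betwE[OF b2] that by auto
  have \<sigma>v: "\<sigma> v = 0" using ix[of 0] m3 vC xs(3) by (simp add: \<sigma>_def)
  let ?i = "inv_into UNIV \<sigma>"
  have inv: "?i (\<sigma> x) = x" "\<sigma> (?i x) = x" for x using permutes_inverses[OF perm] by auto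
  have iW: "?i y \<in> ?W" if "m \<le> y" "y < n" for y
  proof -
    have "y \<in> \<sigma> ` ?W" using b2 that by (auto simp: bij_betw_def)
    then show ?thesis using inv by auto
  qed
  define par where "par y = (if m \<le> y \<and> y < n then \<sigma> (par0 (?i y)) else 0)" for y
  define \<rho> where "\<rho> y = D (?i y)" for y
  have pf: "parent_function m n \<rho> par"
    unfolding parent_function_def
  proof (intro conjI allI impI)
    fix y assume y: "m \<le> y \<and> y < n"
    then have iy: "?i y \<in> ?W" using iW by blast
    show "par y = 0 \<or> m \<le> par y \<and> par y < n" using par0_mem[OF iy] \<sigma>v \<sigma>W y by (auto simp: par_def)
    show "\<rho> (par y) < \<rho> y" using par0(2)[of "?i y"] W[OF iy] y inv by (simp add: par_def \<rho>_def)
  next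
    fix y assume "\<not> (m \<le> y \<and> y < n)"
    then show "par y = 0" unfolding par_def by (rule if_not_P)
  qed
  let ?s = "\<lambda>(x, y). (\<sigma> x, \<sigma> y)"
  have conv: "?s ` (X\<inverse>) = (?s ` X)\<inverse>" for X :: "(nat \<times> nat) set" by force
  have "?s ` CA = cycle_edge_set m"
  proof -
    have "CA = (\<lambda>i. (xs ! i, xs ! (Suc i mod m))) ` {0..<m}" by (auto simp: CA_def)
    then have "?s ` CA = (\<lambda>i. (\<sigma> (xs ! i), \<sigma> (xs ! (Suc i mod m)))) ` {0..<m}" by (simp add: image_image)
    also have "\<dots> = (\<lambda>i. (i, Suc i mod m)) ` {0..<m}"
    proof (rule image_cong[OF refl])
      fix i assume "i \<in> {0..<m}"
      then have i: "i < m" "Suc i mod m < m" by auto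
      have "\<sigma> (xs ! k) = k" if "k < m" for k using ix[OF that] that xs(1) by (simp add: \<sigma>_def C_def)
      then show "(\<sigma> (xs ! i), \<sigma> (xs ! (Suc i mod m))) = (i, Suc i mod m)" using i by simp
    qed
    finally show ?thesis by (simp add: cycle_edge_set_def)
  qed
  moreover have "?s ` TA = {(y, par y) | y. m \<le> y \<and> y < n}"
  proof
    show "?s ` TA \<subseteq> {(y, par y) | y. m \<le> y \<and> y < n}"
    proof
      fix p assume "p \<in> ?s ` TA"
      then obtain x where x: "x \<in> ?W" "p = (\<sigma> x, \<sigma> (par0 x))" by (auto simp: TA_def)
      then have "p = (\<sigma> x, par (\<sigma> x))" using \<sigma>W[OF x(1)] inv by (simp add: par_def)
      then show "p \<in> {(y, par y) | y. m \<le> y \<and> y < n}" using \<sigma>W[OF x(1)] by blast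
    qed
    show "{(y, par y) | y. m \<le> y \<and> y < n} \<subseteq> ?s ` TA"
    proof
      fix p assume "p \<in> {(y, par y) | y. m \<le> y \<and> y < n}"
      then obtain y where y: "m \<le> y" "y < n" "p = (y, par y)" by blast
      have "(?i y, par0 (?i y)) \<in> TA" using iW[OF y(1,2)] by (auto simp: TA_def)
      moreover have "p = ?s (?i y, par0 (?i y))" using y inv by (simp add: par_def)
      ultimately show "p \<in> ?s ` TA" by blast
    qed
  qed
  ultimately have "?s ` ?E = cycle_tree_arcs m n par"
    unfolding Eeq cycle_tree_arcs_def Let_def by (simp only: image_Un conv) blast
  then show ?thesis using perm pf by blast
qed

lemma simple_graph_onI:
  assumes "E \<subseteq> {0..<n} \<times> {0..<n}" "sym E" "\<And>x. (x, x) \<notin> E"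
  shows "simple_graph_on n \<lparr>pverts = {0..<n}, parcs = E\<rparr>"
proof -
  let ?G = "\<lparr>pverts = {0..<n}, parcs = E\<rparr>"
  have "finite E" using assms(1) finite_subset by blast
  then have "pair_graph ?G"
    using assms
    by unfold_locales (auto simp: symmetric_def)
  then show ?thesis by (simp add: simple_graph_on_def)
qed

lemma bipartiteI:
  assumes "parcs G \<subseteq> pverts G \<times> pverts G" "\<And>x y. (x, y) \<in> parcs G \<Longrightarrow> c x \<longleftrightarrow> \<not> c y"
  shows "bipartite G"
  unfolding bipartite_def using assms by (intro exI[of _ "{x \<in> pverts G. c x}"]) fast

lemma parcs_cycle_star: "parcs (cycle_star m n) = cycle_tree_arcs m n (\<lambda>_. 0)"
  by (auto simp: cycle_star_def graph_of_edges_def cycle_tree_arcs_def Let_def)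

lemma parcs_cycle_path:
  assumes "m < n"
  shows "parcs (cycle_path m n) = cycle_tree_arcs m n (path_parent m n)"
proof -
  have eq: "{(0, m)} \<union> {(j, Suc j) | j. m \<le> j \<and> Suc j < n} = {(x, path_parent m n x) | x. m \<le> x \<and> x < n}\<inverse>" (is "?L = ?R")
  proof
    show "?L \<subseteq> ?R"
    proof
      fix p assume "p \<in> ?L"
      then consider "p = (0, m)" | j where "p = (j, Suc j)" "m \<le> j" "Suc j < n" by blast
      then obtain x where "m \<le> x" "x < n" "p = (path_parent m n x, x)"
      proof cases
        case 1
        then show ?thesis using that[of m] assms by (simp add: path_parent_def)
      next
        case (2 j)
        then show ?thesis using that[of "Suc j"] by (simp add: path_parent_def)
      qed
      then show "p \<in> ?R" by blast
    qed
    show "?R \<subseteq> ?L"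
    proof
      fix p assume "p \<in> ?R"
      then obtain x where x: "m \<le> x" "x < n" "p = (path_parent m n x, x)" by auto
      show "p \<in> ?L"
      proof (cases "x = m")
        case False
        then obtain j where "x = Suc j" "m \<le> j" using x by (cases x) auto
        then show ?thesis using x by (auto simp: path_parent_def)
      qed (use x in \<open>simp add: path_parent_def\<close>)
    qed
  qed
  show ?thesis
    unfolding cycle_path_def graph_of_edges_def cycle_tree_arcs_def Let_def pair_pre_digraph.select_convs
      Un_assoc[of "cycle_edge_set m"] eq
    by (simp only: converse_Un converse_converse Un_ac)
qed

lemma parent_function_star: "2 \<le> m \<Longrightarrow> parent_function m n (\<lambda>x. x) (\<lambda>_. 0)"
  by (auto simp: parent_function_def)

lemma parent_function_path: "2 \<le> m \<Longrightarrow> parent_function m n (\<lambda>x. x) (path_parent m n)"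
  by (auto simp: parent_function_def path_parent_def)

theorem theorem18:
  fixes n r :: nat and lam :: "nat list" and \<tau> :: symfun
  assumes "r \<le> n"
    and "is_partition n lam"
    and "\<tau> \<in> {schur_sf lam, elem_sf lam, psum_sf lam, homog_sf lam}"
  shows "(\<forall>G\<^sub>1 G\<^sub>2.
            simple_graph_on n G\<^sub>1 \<and> Digraph_Component.connected (with_proj G\<^sub>1) \<and> bipartite G\<^sub>1 \<and>
            simple_graph_on n G\<^sub>2 \<and> Digraph_Component.connected (with_proj G\<^sub>2) \<and> bipartite G\<^sub>2 \<and>
            ggs G\<^sub>1 G\<^sub>2 \<longrightarrow>
            b_coeff \<tau> r (laplacian n G\<^sub>2) \<le> b_coeff \<tau> r (laplacian n G\<^sub>1)) \<and>
         (\<forall>k \<ge> 2. n > 2 * k \<longrightarrow>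
            (\<forall>G \<in> Omega_C (2 * k) n.
               b_coeff \<tau> r (laplacian n (cycle_star (2 * k) n)) \<le> b_coeff \<tau> r (laplacian n G) \<and>
               b_coeff \<tau> r (laplacian n G) \<le> b_coeff \<tau> r (laplacian n (cycle_path (2 * k) n))))"
proof -
  let ?f = "frob_ch_inv n \<tau>"
  have f: "?f \<in> class_functions n" and W: "\<And>g. cycle_weight ?f n g \<ge> 0"
    using frob_ch_inv_cycle_weight_nonneg[OF assms(2,3)] by auto
  note b = b_coeff_eq_orientation_sum[OF _ _ assms(1), of _ \<tau>]
  have part1: "b_coeff \<tau> r (laplacian n G\<^sub>2) \<le> b_coeff \<tau> r (laplacian n G\<^sub>1)"
    if "simple_graph_on n G\<^sub>1" "bipartite G\<^sub>1" "simple_graph_on n G\<^sub>2" "bipartite G\<^sub>2" "ggs G\<^sub>1 G\<^sub>2" for G\<^sub>1 G\<^sub>2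
    using orientation_sum_ggs_le[OF f W that(1,5), of r] b that by simp
  have part2: "b_coeff \<tau> r (laplacian n (cycle_star (2 * k) n)) \<le> b_coeff \<tau> r (laplacian n G) \<and>
      b_coeff \<tau> r (laplacian n G) \<le> b_coeff \<tau> r (laplacian n (cycle_path (2 * k) n))"
    if k: "k \<ge> 2" "n > 2 * k" and G: "G \<in> Omega_C (2 * k) n" for k G
  proof -
    let ?m = "2 * k"
    have m: "2 \<le> ?m" "?m \<le> n" using k by auto
    have tree_graph: "b_coeff \<tau> r (laplacian n H) = orientation_sum ?f n (cycle_tree_arcs ?m n par) r"
      if H: "parcs H = cycle_tree_arcs ?m n par" "pverts H = {0..<n}" and pf: "parent_function ?m n \<rho> par" for H par \<rho>
    proof -
      have E: "parcs H \<subseteq> {0..<n} \<times> {0..<n}" "sym (parcs H)" "\<And>x. (x, x) \<notin> parcs H"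
        unfolding H(1) using cycle_tree_arcs_subset[OF m pf] sym_cycle_tree_arcs cycle_tree_arcs_irrefl[OF m pf] by auto
      have Heq: "H = \<lparr>pverts = {0..<n}, parcs = parcs H\<rparr>" using H(2) by simp
      have "simple_graph_on n H" by (subst Heq) (rule simple_graph_onI[OF E])
      moreover obtain c where "\<forall>x y. (x, y) \<in> cycle_tree_arcs ?m n par \<longrightarrow> (c x \<longleftrightarrow> \<not> c y)"
        using cycle_tree_two_colouring[OF m pf] by auto
      then have "bipartite H" using E(1) H by (intro bipartiteI[where c = c]) auto
      ultimately show ?thesis using b[of H] H(1) by simp
    qed
    have star: "b_coeff \<tau> r (laplacian n (cycle_star ?m n)) = orientation_sum ?f n (cycle_tree_arcs ?m n (\<lambda>_. 0)) r"
      using parent_function_star[OF m(1), of n]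
      by (intro tree_graph[OF parcs_cycle_star]) (auto simp: cycle_star_def graph_of_edges_def)
    have path: "b_coeff \<tau> r (laplacian n (cycle_path ?m n)) = orientation_sum ?f n (cycle_tree_arcs ?m n (path_parent ?m n)) r"
      using parent_function_path[OF m(1), of n]
      by (intro tree_graph[OF parcs_cycle_path[OF k(2)]]) (auto simp: cycle_path_def graph_of_edges_def)
    obtain \<sigma> \<rho> par where s: "\<sigma> permutes {0..<n}" and pf: "parent_function ?m n \<rho> par"
      and im: "(\<lambda>(x, y). (\<sigma> x, \<sigma> y)) ` parcs G = cycle_tree_arcs ?m n par"
      using Omega_C_relabel[OF G] by blast
    have sg: "simple_graph_on n G" using G by (simp add: Omega_C_def)
    obtain c where c: "\<forall>x y. (x, y) \<in> cycle_tree_arcs ?m n par \<longrightarrow> (c x \<longleftrightarrow> \<not> c y)"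
      using cycle_tree_two_colouring[OF m pf] by auto
    have "bipartite G"
    proof (rule bipartiteI[where c = "\<lambda>x. c (\<sigma> x)"])
      show "parcs G \<subseteq> pverts G \<times> pverts G" using simple_graph_onD(1)[OF sg] sg by (simp add: simple_graph_on_def)
      fix x y assume "(x, y) \<in> parcs G"
      then have "(\<sigma> x, \<sigma> y) \<in> cycle_tree_arcs ?m n par" unfolding im[symmetric] by force
      then show "c (\<sigma> x) \<longleftrightarrow> \<not> c (\<sigma> y)" using c by blast
    qed
    then have "b_coeff \<tau> r (laplacian n G) = orientation_sum ?f n (cycle_tree_arcs ?m n par) r"
      using b[OF sg] orientation_sum_relabel[OF f s, of "parcs G" r] im by simp
    then show ?thesis using star_le[OF m f W pf, of r] path_ge[OF m f W pf, of r] star path by simp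
  qed
  show ?thesis using part1 part2 by blast
qed

end
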